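(* For every integer $k\ge 2$, the polygonal semigroup generated by the triangle with vertex set $\{(4,0),\,(4+2k,0),\,(4+k,k)\}$ is Gorenstein.
   Context: $\mathbb{N}$ denotes the nonnegative integers. For a compact convex polygon $F\subset\mathbb{R}^2_{\ge 0}$ (here a full triangle), put $F_i=\{iX\mid X\in F\}$ for $i\in\mathbb{N}$; the polygonal semigroup generated by $F$ is $\mathcal{P}=\bigcup_{i=0}^\infty F_i\cap\mathbb{N}^2$. Fix a field $K$; a semigroup $S$ is called Gorenstein if the semigroup ring $K[S]$ is a Gorenstein ring. *)

theory Defs
  imports
    "HOL-Analysis.Convex"
    "HOL-Library.Poly_Mapping"
    "HOL-Algebra.Module"
    "HOL-Algebra.Ring_Divisibility"
begin

section \<open>Polygonal semigroups and semigroup rings\<close>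

definition polygonal_semigroup :: "(real \<times> real) set \<Rightarrow> (nat \<times> nat) set" where
  "polygonal_semigroup F =
     (\<Union>i. {(x, y). (real x, real y) \<in> (\<lambda>X. real i *\<^sub>R X) ` F})"

text \<open>
  The multiplication of \<^typ>\<open>'s \<Rightarrow>\<^sub>0 'k\<close> is convolution, so for a submonoid \<open>S\<close> the following is the
  subring \<open>K[S]\<close> of the monoid algebra of the ambient monoid, where \<open>K\<close> is the field \<open>'k\<close>.
\<close>

definition semigroup_ring :: "'s::comm_monoid_add set \<Rightarrow> ('s \<Rightarrow>\<^sub>0 'k::field) ring" where
  "semigroup_ring S =
     \<lparr>carrier = {p. Poly_Mapping.keys p \<subseteq> S}, mult = (*), one = 1, zero = 0, add = (+)\<rparr>"


section \<open>Localization of a commutative ring at a prime ideal\<close>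

definition loc_rel :: "('a, 'm) ring_scheme \<Rightarrow> 'a set \<Rightarrow> (('a \<times> 'a) \<times> ('a \<times> 'a)) set" where
  "loc_rel R P =
     {((a, s), (b, t)). a \<in> carrier R \<and> b \<in> carrier R \<and>
        s \<in> carrier R - P \<and> t \<in> carrier R - P \<and>
        (\<exists>u \<in> carrier R - P. u \<otimes>\<^bsub>R\<^esub> (a \<otimes>\<^bsub>R\<^esub> t) = u \<otimes>\<^bsub>R\<^esub> (b \<otimes>\<^bsub>R\<^esub> s))}"

definition loc_frac :: "('a, 'm) ring_scheme \<Rightarrow> 'a set \<Rightarrow> 'a \<Rightarrow> 'a \<Rightarrow> ('a \<times> 'a) set" where
  "loc_frac R P a s = loc_rel R P `` {(a, s)}"

definition localization :: "('a, 'm) ring_scheme \<Rightarrow> 'a set \<Rightarrow> ('a \<times> 'a) set ring" where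
  "localization R P =
     \<lparr>carrier = (carrier R \<times> (carrier R - P)) // loc_rel R P,
      mult = (\<lambda>X Y. \<Union>(a, s) \<in> X. \<Union>(b, t) \<in> Y. loc_frac R P (a \<otimes>\<^bsub>R\<^esub> b) (s \<otimes>\<^bsub>R\<^esub> t)),
      one = loc_frac R P \<one>\<^bsub>R\<^esub> \<one>\<^bsub>R\<^esub>,
      zero = loc_frac R P \<zero>\<^bsub>R\<^esub> \<one>\<^bsub>R\<^esub>,
      add = (\<lambda>X Y. \<Union>(a, s) \<in> X. \<Union>(b, t) \<in> Y.
               loc_frac R P (a \<otimes>\<^bsub>R\<^esub> t \<oplus>\<^bsub>R\<^esub> b \<otimes>\<^bsub>R\<^esub> s) (s \<otimes>\<^bsub>R\<^esub> t))\<rparr>"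


section \<open>Injective dimension and Gorenstein rings\<close>

definition module_hom ::
    "('a, 'r) ring_scheme \<Rightarrow> ('a, 'b, 'm) module_scheme \<Rightarrow> ('a, 'c, 'n) module_scheme \<Rightarrow> ('b \<Rightarrow> 'c) set"
  where
  "module_hom R M N =
     {f. f \<in> carrier M \<rightarrow> carrier N \<and>
         (\<forall>x \<in> carrier M. \<forall>y \<in> carrier M. f (x \<oplus>\<^bsub>M\<^esub> y) = f x \<oplus>\<^bsub>N\<^esub> f y) \<and>
         (\<forall>a \<in> carrier R. \<forall>x \<in> carrier M. f (a \<odot>\<^bsub>M\<^esub> x) = a \<odot>\<^bsub>N\<^esub> f x)}"

definition module_ker :: "('a, 'b, 'm) module_scheme \<Rightarrow> ('a, 'c, 'n) module_scheme \<Rightarrow> ('b \<Rightarrow> 'c) \<Rightarrow> 'b set"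
  where "module_ker M N f = {x \<in> carrier M. f x = \<zero>\<^bsub>N\<^esub>}"

definition self_module :: "('a, 'r) ring_scheme \<Rightarrow> ('a, 'a) module" where
  "self_module R =
     \<lparr>carrier = carrier R, mult = mult R, one = one R, zero = zero R, add = add R, smult = mult R\<rparr>"

text \<open>
  HOL cannot quantify over the modules of all types, so modules over a ring with elements in \<open>'a\<close>
  are taken in the fixed universe \<open>(nat \<times> 'a) set\<close>. Nothing is lost. The universe contains a copy of
  the ring and of its ideals, so by Baer's criterion the extension property below, although it only
  tests modules in the universe, implies the one for all modules. Moreover the
  universe has at least \<open>2 ^ max |R| \<aleph>\<^sub>0\<close> elements, and every \<open>R\<close>-module of at most
  that cardinality embeds into an injective one of at most that cardinality (coinduce its divisible
  hull), so injective resolutions within the universe realise the true injective dimension.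
\<close>

type_synonym 'a modu = "('a, (nat \<times> 'a) set) module"

definition injective_module :: "('a, 'r) ring_scheme \<Rightarrow> 'a modu \<Rightarrow> bool" where
  "injective_module R E \<longleftrightarrow> Module.module R E \<and>
     (\<forall>(M :: 'a modu) N f.
        Module.module R M \<and> submodule N R M \<and> f \<in> module_hom R (M\<lparr>carrier := N\<rparr>) E \<longrightarrow>
        (\<exists>g \<in> module_hom R M E. \<forall>x \<in> N. g x = f x))"

definition injective_resolution ::
    "('a, 'r) ring_scheme \<Rightarrow> ('a, 'b) module \<Rightarrow> ('b \<Rightarrow> (nat \<times> 'a) set) \<Rightarrow>
     (nat \<Rightarrow> 'a modu) \<Rightarrow> (nat \<Rightarrow> (nat \<times> 'a) set \<Rightarrow> (nat \<times> 'a) set) \<Rightarrow> bool" where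
  "injective_resolution R M \<epsilon> E d \<longleftrightarrow>
     (\<forall>i. injective_module R (E i)) \<and>
     \<epsilon> \<in> module_hom R M (E 0) \<and>
     (\<forall>i. d i \<in> module_hom R (E i) (E (Suc i))) \<and>
     inj_on \<epsilon> (carrier M) \<and>
     \<epsilon> ` carrier M = module_ker (E 0) (E 1) (d 0) \<and>
     (\<forall>i. d i ` carrier (E i) = module_ker (E (Suc i)) (E (Suc (Suc i))) (d (Suc i)))"

definition finite_injective_dimension :: "('a, 'r) ring_scheme \<Rightarrow> ('a, 'b) module \<Rightarrow> bool" where
  "finite_injective_dimension R M \<longleftrightarrow>
     (\<exists>n \<epsilon> E d. injective_resolution R M \<epsilon> E d \<and> (\<forall>i>n. carrier (E i) = {\<zero>\<^bsub>E i\<^esub>}))"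

definition gorenstein_ring :: "('a, 'r) ring_scheme \<Rightarrow> bool" where
  "gorenstein_ring R \<longleftrightarrow> cring R \<and> noetherian_ring R \<and>
     (\<forall>P. primeideal P R \<longrightarrow>
        finite_injective_dimension (localization R P) (self_module (localization R P)))"

definition gorenstein_semigroup :: "'k::field itself \<Rightarrow> 's::comm_monoid_add set \<Rightarrow> bool" where
  "gorenstein_semigroup K S \<longleftrightarrow> gorenstein_ring (semigroup_ring S :: ('s \<Rightarrow>\<^sub>0 'k) ring)"

end

theory Submission
  imports Defs "HOL-Library.Product_Lexorder" "HOL-Library.Nat_Bijection"
begin

text \<open>
  Write \<open>S\<close> for the semigroup, \<open>R = K[S]\<close>, \<open>a = (4, 0)\<close> and \<open>b = (4 + k, k)\<close>. The points \<open>a\<close> and \<open>b\<close>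
  span the two edges of the cone of \<open>S\<close>, and \<open>S\<close> is the disjoint union of the translates
  \<open>c + \<nat>a + \<nat>b\<close> for \<open>c\<close> in a finite set \<open>C\<close> of \<open>4k\<close> points. Hence \<open>R\<close> is free over the polynomial ring
  \<open>A = K[X\<^sup>a, X\<^sup>b]\<close>, with the monomials \<open>X\<^sup>c\<close> as a basis. The set \<open>C\<close> is symmetric: it is stable
  under \<open>c \<mapsto> c\<^sub>0 - c\<close> for its point \<open>c\<^sub>0 = (k + 10, k - 1)\<close>. This makes \<open>R\<close> a Frobenius extension
  of \<open>A\<close>: if \<open>\<tau> : R \<rightarrow> A\<close> takes the coordinate at \<open>X\<^bsup>c\<^sub>0\<^esup>\<close>, the matrix of the pairing \<open>(x, y) \<mapsto> \<tau>(x y)\<close> in the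
  basis \<open>C\<close> is a permutation matrix, so \<open>r \<mapsto> \<tau>(r \<cdot> _)\<close> is an isomorphism \<open>R \<cong> Hom\<^sub>A(R, A)\<close>
  (lemmas \<open>frob_nondegenerate\<close> and \<open>semilinear_eq_act_frob\<close>).

  An \<open>A\<close>-linear map is a \<open>K\<close>-linear map that commutes with the two variables of \<open>A\<close>. For
  \<open>\<Phi> \<in> H = Hom\<^sub>K(R, A)\<close> let \<open>D\<^sub>a \<Phi>\<close> and \<open>D\<^sub>b \<Phi>\<close> measure the failure to commute with \<open>X\<^sup>a\<close> and \<open>X\<^sup>b\<close>
  (\<open>discrepancy\<close> below). These operators commute, and because \<open>R\<close> is free over \<open>A\<close> each of them has a
  right inverse that preserves the kernel of the other. Their Koszul complex is therefore exact
  (\<open>koszul_exact\<close>), which gives the resolution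
  \<open>0 \<rightarrow> R \<rightarrow> H \<rightarrow> H \<times> H \<rightarrow> H \<rightarrow> 0\<close>. Its terms are injective \<open>R\<close>-modules: by the adjunction
  \<open>Hom\<^sub>R(M, Hom\<^sub>K(R, A)) = Hom\<^sub>K(M, A)\<close> only extension of linear maps over a field is needed
  (\<open>linmaps_baer\<close>).

  It remains to localize at a prime ideal. Since \<open>R\<close> is a domain, injective modules are divisible, so
  their localization is a quotient by torsion. Since \<open>R\<close> is Noetherian, a homomorphism from an ideal
  into such a quotient lifts after multiplication by one denominator (\<open>lift_finite\<close>), so the localized
  modules satisfy Baer's criterion again (\<open>baer_localized\<close>). The localized resolution shows that
  \<open>R\<^sub>P\<close> has injective dimension at most two (\<open>finite_injective_dimension_localization\<close>).
\<close>

section \<open>Linear graphs and Baer's criterion\<close>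

text \<open>
  Partially defined homomorphisms are represented by their graphs, so that unions of chains and
  one-element extensions are operations on sets. The last clause makes the graph single-valued.
\<close>

definition linear_graph ::
    "('a, 'r) ring_scheme \<Rightarrow> ('a, 'b, 'm) module_scheme \<Rightarrow> ('a, 'c, 'n) module_scheme \<Rightarrow> ('b \<times> 'c) set \<Rightarrow> bool"
  where
  "linear_graph R M N G \<longleftrightarrow>
     G \<subseteq> carrier M \<times> carrier N \<and> (\<zero>\<^bsub>M\<^esub>, \<zero>\<^bsub>N\<^esub>) \<in> G \<and>
     (\<forall>x y x' y'. (x, y) \<in> G \<longrightarrow> (x', y') \<in> G \<longrightarrow> (x \<oplus>\<^bsub>M\<^esub> x', y \<oplus>\<^bsub>N\<^esub> y') \<in> G) \<and>
     (\<forall>r x y. r \<in> carrier R \<longrightarrow> (x, y) \<in> G \<longrightarrow> (r \<odot>\<^bsub>M\<^esub> x, r \<odot>\<^bsub>N\<^esub> y) \<in> G) \<and>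
     (\<forall>y. (\<zero>\<^bsub>M\<^esub>, y) \<in> G \<longrightarrow> y = \<zero>\<^bsub>N\<^esub>)"

lemma linear_graphD:
  assumes "linear_graph R M N G"
  shows "\<And>x y. (x, y) \<in> G \<Longrightarrow> x \<in> carrier M" "\<And>x y. (x, y) \<in> G \<Longrightarrow> y \<in> carrier N"
    and "(\<zero>\<^bsub>M\<^esub>, \<zero>\<^bsub>N\<^esub>) \<in> G"
    and "\<And>x y x' y'. (x, y) \<in> G \<Longrightarrow> (x', y') \<in> G \<Longrightarrow> (x \<oplus>\<^bsub>M\<^esub> x', y \<oplus>\<^bsub>N\<^esub> y') \<in> G"
    and "\<And>r x y. r \<in> carrier R \<Longrightarrow> (x, y) \<in> G \<Longrightarrow> (r \<odot>\<^bsub>M\<^esub> x, r \<odot>\<^bsub>N\<^esub> y) \<in> G"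
    and "\<And>y. (\<zero>\<^bsub>M\<^esub>, y) \<in> G \<Longrightarrow> y = \<zero>\<^bsub>N\<^esub>"
  using assms unfolding linear_graph_def by blast+

lemma module_minus_one:
  assumes "Module.module R M" "x \<in> carrier M"
  shows "(\<ominus>\<^bsub>R\<^esub> \<one>\<^bsub>R\<^esub>) \<odot>\<^bsub>M\<^esub> x = \<ominus>\<^bsub>M\<^esub> x"
proof -
  interpret Module.module R M by fact
  show ?thesis using assms(2) by (simp add: smult_l_minus)
qed

lemma linear_graph_minus:
  assumes M: "Module.module R M" and N: "Module.module R N" and G: "linear_graph R M N G"
    and xy: "(x, y) \<in> G"
  shows "(\<ominus>\<^bsub>M\<^esub> x, \<ominus>\<^bsub>N\<^esub> y) \<in> G"
proof -
  interpret M: Module.module R M by fact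
  have "\<ominus>\<^bsub>R\<^esub> \<one>\<^bsub>R\<^esub> \<in> carrier R" by simp
  from linear_graphD(5)[OF G this xy]
  show ?thesis
    using linear_graphD(1,2)[OF G xy] by (simp add: module_minus_one[OF M] module_minus_one[OF N])
qed

lemma linear_graph_unique:
  assumes M: "Module.module R M" and N: "Module.module R N" and G: "linear_graph R M N G"
    and y: "(x, y) \<in> G" and y': "(x, y') \<in> G"
  shows "y = y'"
proof -
  interpret M: Module.module R M by fact
  interpret N: Module.module R N by fact
  note c = linear_graphD(1,2)[OF G y] linear_graphD(2)[OF G y']
  have "(x \<oplus>\<^bsub>M\<^esub> \<ominus>\<^bsub>M\<^esub> x, y \<oplus>\<^bsub>N\<^esub> \<ominus>\<^bsub>N\<^esub> y') \<in> G"
    by (rule linear_graphD(4)[OF G y linear_graph_minus[OF M N G y']])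
  then have "y \<oplus>\<^bsub>N\<^esub> \<ominus>\<^bsub>N\<^esub> y' = \<zero>\<^bsub>N\<^esub>"
    using c by (simp add: M.M.r_neg linear_graphD(6)[OF G])
  then show ?thesis using c
    by (metis N.M.a_inv_closed N.M.minus_equality N.M.minus_minus)
qed

text \<open>
  The homomorphism can be continued by \<open>x \<mapsto> e\<close> as soon as \<open>e\<close> has the right multiples on the ideal
  of those \<open>r\<close> for which \<open>r x\<close> is in the domain already. Both the Zorn argument of Baer's criterion and
  the lifting through a localization extend homomorphisms in this way.
\<close>

lemma linear_graph_extend:
  assumes M: "Module.module R M" and N: "Module.module R N" and G: "linear_graph R M N G"
    and x: "x \<in> carrier M" and e: "e \<in> carrier N"
    and compat: "\<And>r z. r \<in> carrier R \<Longrightarrow> (r \<odot>\<^bsub>M\<^esub> x, z) \<in> G \<Longrightarrow> z = r \<odot>\<^bsub>N\<^esub> e"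
  obtains G' where "linear_graph R M N G'" "G \<subseteq> G'" "(x, e) \<in> G'"
    and "\<And>v w. (v, w) \<in> G' \<Longrightarrow> \<exists>a b r. (a, b) \<in> G \<and> r \<in> carrier R \<and>
           v = a \<oplus>\<^bsub>M\<^esub> r \<odot>\<^bsub>M\<^esub> x \<and> w = b \<oplus>\<^bsub>N\<^esub> r \<odot>\<^bsub>N\<^esub> e"
proof
  interpret M: Module.module R M by fact
  interpret N: Module.module R N by fact
  define G' where "G' = {(a \<oplus>\<^bsub>M\<^esub> r \<odot>\<^bsub>M\<^esub> x, b \<oplus>\<^bsub>N\<^esub> r \<odot>\<^bsub>N\<^esub> e) | a b r. (a, b) \<in> G \<and> r \<in> carrier R}"
  note c = linear_graphD(1,2)[OF G]
  have G'I: "(v, w) \<in> G'" if "(a, b) \<in> G" "r \<in> carrier R" "v = a \<oplus>\<^bsub>M\<^esub> r \<odot>\<^bsub>M\<^esub> x" "w = b \<oplus>\<^bsub>N\<^esub> r \<odot>\<^bsub>N\<^esub> e"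
    for v w a b r using that unfolding G'_def by blast
  show sub: "G \<subseteq> G'"
  proof
    fix p assume "p \<in> G"
    moreover obtain a b where "p = (a, b)" by force
    ultimately show "p \<in> G'" using c[of a b] x e by (auto intro!: G'I[of a b "\<zero>\<^bsub>R\<^esub>"])
  qed
  show "(x, e) \<in> G'"
    using linear_graphD(3)[OF G] x e by (auto intro!: G'I[of "\<zero>\<^bsub>M\<^esub>" "\<zero>\<^bsub>N\<^esub>" "\<one>\<^bsub>R\<^esub>"])
  show "\<exists>a b r. (a, b) \<in> G \<and> r \<in> carrier R \<and> v = a \<oplus>\<^bsub>M\<^esub> r \<odot>\<^bsub>M\<^esub> x \<and> w = b \<oplus>\<^bsub>N\<^esub> r \<odot>\<^bsub>N\<^esub> e"
    if "(v, w) \<in> G'" for v w using that unfolding G'_def by blast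
  show "linear_graph R M N G'"
    unfolding linear_graph_def
  proof (intro conjI allI impI)
    show "G' \<subseteq> carrier M \<times> carrier N" using c x e unfolding G'_def by auto
    show "(\<zero>\<^bsub>M\<^esub>, \<zero>\<^bsub>N\<^esub>) \<in> G'" using sub linear_graphD(3)[OF G] by blast
  next
    fix v w v' w' assume "(v, w) \<in> G'" "(v', w') \<in> G'"
    then obtain a b r a' b' r' where h: "(a, b) \<in> G" "r \<in> carrier R" "v = a \<oplus>\<^bsub>M\<^esub> r \<odot>\<^bsub>M\<^esub> x"
      "w = b \<oplus>\<^bsub>N\<^esub> r \<odot>\<^bsub>N\<^esub> e" "(a', b') \<in> G" "r' \<in> carrier R" "v' = a' \<oplus>\<^bsub>M\<^esub> r' \<odot>\<^bsub>M\<^esub> x"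
      "w' = b' \<oplus>\<^bsub>N\<^esub> r' \<odot>\<^bsub>N\<^esub> e" unfolding G'_def by blast
    show "(v \<oplus>\<^bsub>M\<^esub> v', w \<oplus>\<^bsub>N\<^esub> w') \<in> G'"
      by (rule G'I[OF linear_graphD(4)[OF G h(1) h(5)], of "r \<oplus>\<^bsub>R\<^esub> r'"])
        (use h c[OF h(1)] c[OF h(5)] x e in
          \<open>simp_all add: M.smult_l_distr N.smult_l_distr M.M.a_ac N.M.a_ac\<close>)
  next
    fix s v w assume s: "s \<in> carrier R" and "(v, w) \<in> G'"
    then obtain a b r where h: "(a, b) \<in> G" "r \<in> carrier R" "v = a \<oplus>\<^bsub>M\<^esub> r \<odot>\<^bsub>M\<^esub> x"
      "w = b \<oplus>\<^bsub>N\<^esub> r \<odot>\<^bsub>N\<^esub> e" unfolding G'_def by blast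
    show "(s \<odot>\<^bsub>M\<^esub> v, s \<odot>\<^bsub>N\<^esub> w) \<in> G'"
      by (rule G'I[OF linear_graphD(5)[OF G s h(1)], of "s \<otimes>\<^bsub>R\<^esub> r"])
        (use h c[OF h(1)] x e s in
          \<open>simp_all add: M.smult_r_distr N.smult_r_distr M.smult_assoc1 N.smult_assoc1\<close>)
  next
    fix w assume "(\<zero>\<^bsub>M\<^esub>, w) \<in> G'"
    then obtain a b r where h: "(a, b) \<in> G" "r \<in> carrier R" "\<zero>\<^bsub>M\<^esub> = a \<oplus>\<^bsub>M\<^esub> r \<odot>\<^bsub>M\<^esub> x"
      "w = b \<oplus>\<^bsub>N\<^esub> r \<odot>\<^bsub>N\<^esub> e" unfolding G'_def by blast
    note ab = c[OF h(1)]
    have rx: "r \<odot>\<^bsub>M\<^esub> x = \<ominus>\<^bsub>M\<^esub> a"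
      using h ab x by (metis M.M.a_comm M.M.minus_equality M.smult_closed)
    have "\<ominus>\<^bsub>N\<^esub> b = r \<odot>\<^bsub>N\<^esub> e"
      by (rule compat[OF h(2)]) (use linear_graph_minus[OF M N G h(1)] rx in simp)
    then show "w = \<zero>\<^bsub>N\<^esub>" using h(4) ab by (metis N.M.r_neg)
  qed
qed

lemma (in cring) idealI':
  assumes "H \<subseteq> carrier R" "\<zero> \<in> H" "\<And>a b. a \<in> H \<Longrightarrow> b \<in> H \<Longrightarrow> a \<oplus> b \<in> H"
    and smult: "\<And>r a. r \<in> carrier R \<Longrightarrow> a \<in> H \<Longrightarrow> r \<otimes> a \<in> H"
  shows "ideal H R"
proof (rule idealI)
  show "ring R" by (rule ring_axioms)
  show "subgroup H (add_monoid R)"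
  proof (rule add.subgroupI)
    show "\<ominus> a \<in> H" if "a \<in> H" for a
      using smult[of "\<ominus> \<one>" a] that assms(1) by (auto simp: l_minus subset_iff)
  qed (use assms in auto)
  show "r \<otimes> a \<in> H" "a \<otimes> r \<in> H" if "a \<in> H" "r \<in> carrier R" for a r
    using that smult[of r a] m_comm[of a r] assms(1) by auto
qed

text \<open>
  A homomorphism from an ideal extends to the ring exactly when it is multiplication by an element.
\<close>

definition baer :: "('a, 'r) ring_scheme \<Rightarrow> ('a, 'b, 'm) module_scheme \<Rightarrow> bool" where
  "baer R E \<longleftrightarrow>
     (\<forall>J f. ideal J R \<and> f \<in> module_hom R ((self_module R)\<lparr>carrier := J\<rparr>) E \<longrightarrow>
        (\<exists>e \<in> carrier E. \<forall>c \<in> J. f c = c \<odot>\<^bsub>E\<^esub> e))"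

lemma self_module_module:
  assumes "cring R" shows "Module.module R (self_module R)"
proof -
  interpret cring R by fact
  show ?thesis
    by (rule moduleI)
      (auto simp: self_module_def assms l_distr r_distr m_assoc
        intro!: abelian_groupI a_assoc a_comm exI[of _ "\<ominus>\<^bsub>R\<^esub> _"] bexI[of _ "\<ominus>\<^bsub>R\<^esub> _"] l_neg)
qed

text \<open>
  Zorn's lemma yields a maximal graph containing that of \<open>f\<close>. If \<open>x\<close> were outside its domain, the
  extension property for the ideal \<open>{r. r x \<in> domain}\<close> would provide the value needed by
  \<open>linear_graph_extend\<close>.
\<close>

theorem baer_extend:
  assumes E: "Module.module R E" and B: "baer R E" and M: "Module.module R M"
    and N: "submodule N R M" and f: "f \<in> module_hom R (M\<lparr>carrier := N\<rparr>) E"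
  shows "\<exists>g \<in> module_hom R M E. \<forall>x \<in> N. g x = f x"
proof -
  interpret M: Module.module R M by fact
  interpret E: Module.module R E by fact
  note Nsub = M.submoduleE[OF N]
  have f_add: "f (x \<oplus>\<^bsub>M\<^esub> y) = f x \<oplus>\<^bsub>E\<^esub> f y" if "x \<in> N" "y \<in> N" for x y
    using f that by (simp add: module_hom_def)
  have f_smult: "f (a \<odot>\<^bsub>M\<^esub> x) = a \<odot>\<^bsub>E\<^esub> f x" if "a \<in> carrier R" "x \<in> N" for a x
    using f that by (simp add: module_hom_def)
  have f_closed: "f x \<in> carrier E" if "x \<in> N" for x
    using f that by (auto simp add: module_hom_def)
  obtain n where n: "n \<in> N" using Nsub(2) by blast
  have N0: "\<zero>\<^bsub>M\<^esub> \<in> N" using Nsub(4)[OF M.R.zero_closed n] Nsub(1) n by auto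
  have f0: "f \<zero>\<^bsub>M\<^esub> = \<zero>\<^bsub>E\<^esub>" using f_smult[of "\<zero>\<^bsub>R\<^esub>" "\<zero>\<^bsub>M\<^esub>"] N0 f_closed[OF N0] by simp
  define Gf where "Gf = (\<lambda>x. (x, f x)) ` N"
  have Gf: "linear_graph R M E Gf"
    unfolding linear_graph_def Gf_def using N0 f0 Nsub f_add f_smult f_closed by (auto simp: image_iff)
  define \<A> where "\<A> = {G. linear_graph R M E G \<and> Gf \<subseteq> G}"
  have "\<exists>G\<in>\<A>. \<forall>X\<in>\<A>. G \<subseteq> X \<longrightarrow> X = G"
  proof (rule subset_Zorn_nonempty)
    show "\<A> \<noteq> {}" using Gf unfolding \<A>_def by blast
  next
    fix C assume ne: "C \<noteq> {}" and chain: "subset.chain \<A> C"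
    have lin: "linear_graph R M E G" "Gf \<subseteq> G" if "G \<in> C" for G
      using chain that unfolding subset.chain_def \<A>_def by auto
    have common: "\<exists>G\<in>C. p \<in> G \<and> q \<in> G" if pq: "p \<in> \<Union>C" "q \<in> \<Union>C" for p q
    proof -
      obtain X Y where XY: "X \<in> C" "p \<in> X" "Y \<in> C" "q \<in> Y" using pq by blast
      moreover have "X \<subseteq> Y \<or> Y \<subseteq> X"
        using chain XY unfolding subset.chain_def by blast
      ultimately show ?thesis by blast
    qed
    have "linear_graph R M E (\<Union>C)"
      unfolding linear_graph_def
    proof (intro conjI allI impI)
      show "\<Union>C \<subseteq> carrier M \<times> carrier E" using linear_graphD(1,2)[OF lin(1)] by fastforce
      show "(\<zero>\<^bsub>M\<^esub>, \<zero>\<^bsub>E\<^esub>) \<in> \<Union>C" using ne linear_graphD(3)[OF lin(1)] by blast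
      show "(x \<oplus>\<^bsub>M\<^esub> x', y \<oplus>\<^bsub>E\<^esub> y') \<in> \<Union>C" if "(x, y) \<in> \<Union>C" "(x', y') \<in> \<Union>C" for x y x' y'
        using common[OF that] linear_graphD(4)[OF lin(1)] by blast
      show "(r \<odot>\<^bsub>M\<^esub> x, r \<odot>\<^bsub>E\<^esub> y) \<in> \<Union>C" if "r \<in> carrier R" "(x, y) \<in> \<Union>C" for r x y
        using that linear_graphD(5)[OF lin(1)] by blast
      show "y = \<zero>\<^bsub>E\<^esub>" if "(\<zero>\<^bsub>M\<^esub>, y) \<in> \<Union>C" for y
        using that linear_graphD(6)[OF lin(1)] by blast
    qed
    then show "\<Union>C \<in> \<A>" using lin ne unfolding \<A>_def by blast
  qed
  then obtain G where GA: "G \<in> \<A>" and maxA: "\<And>X. X \<in> \<A> \<Longrightarrow> G \<subseteq> X \<Longrightarrow> X = G"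
    by blast
  have G: "linear_graph R M E G" and GfG: "Gf \<subseteq> G" using GA unfolding \<A>_def by auto
  have max: "X = G" if "linear_graph R M E X" "G \<subseteq> X" for X
    using maxA[of X] that GfG unfolding \<A>_def by auto
  have total: "\<exists>y. (x, y) \<in> G" if x: "x \<in> carrier M" for x
  proof -
    define J where "J = {r \<in> carrier R. \<exists>y. (r \<odot>\<^bsub>M\<^esub> x, y) \<in> G}"
    define g where "g r = (THE y. (r \<odot>\<^bsub>M\<^esub> x, y) \<in> G)" for r
    have g_eq: "g r = y" if "(r \<odot>\<^bsub>M\<^esub> x, y) \<in> G" for r y
      unfolding g_def by (rule the_equality, rule that, rule linear_graph_unique[OF M E G _ that])
    have J: "ideal J R"
    proof (rule M.R.idealI')
      show "J \<subseteq> carrier R" by (auto simp: J_def)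
      show "\<zero>\<^bsub>R\<^esub> \<in> J" using linear_graphD(3)[OF G] x unfolding J_def by auto
      show "a \<oplus>\<^bsub>R\<^esub> b \<in> J" if "a \<in> J" "b \<in> J" for a b
      proof -
        obtain y z where "a \<in> carrier R" "(a \<odot>\<^bsub>M\<^esub> x, y) \<in> G" "b \<in> carrier R" "(b \<odot>\<^bsub>M\<^esub> x, z) \<in> G"
          using \<open>a \<in> J\<close> \<open>b \<in> J\<close> J_def by blast
        with linear_graphD(4)[OF G, of "a \<odot>\<^bsub>M\<^esub> x" y "b \<odot>\<^bsub>M\<^esub> x" z] x show ?thesis
          unfolding J_def by (auto simp: M.smult_l_distr)
      qed
      show "r \<otimes>\<^bsub>R\<^esub> a \<in> J" if "r \<in> carrier R" "a \<in> J" for r a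
      proof -
        obtain y where "a \<in> carrier R" "(a \<odot>\<^bsub>M\<^esub> x, y) \<in> G" using \<open>a \<in> J\<close> J_def by blast
        with linear_graphD(5)[OF G that(1), of "a \<odot>\<^bsub>M\<^esub> x" y] x that(1) show ?thesis
          unfolding J_def by (auto simp: M.smult_assoc1)
      qed
    qed
    have g: "g \<in> module_hom R ((self_module R)\<lparr>carrier := J\<rparr>) E"
    proof -
      have 1: "g a \<in> carrier E" if "a \<in> J" for a
        using that g_eq linear_graphD(2)[OF G] unfolding J_def by fastforce
      have 2: "g (a \<oplus>\<^bsub>R\<^esub> b) = g a \<oplus>\<^bsub>E\<^esub> g b" if "a \<in> J" "b \<in> J" for a b
      proof -
        obtain y y' where "a \<in> carrier R" "b \<in> carrier R" "(a \<odot>\<^bsub>M\<^esub> x, y) \<in> G" "(b \<odot>\<^bsub>M\<^esub> x, y') \<in> G"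
          using \<open>a \<in> J\<close> \<open>b \<in> J\<close> J_def by blast
        then show ?thesis using linear_graphD(4)[OF G, of "a \<odot>\<^bsub>M\<^esub> x" y "b \<odot>\<^bsub>M\<^esub> x" y'] x
          by (simp add: g_eq M.smult_l_distr)
      qed
      have 3: "g (a \<otimes>\<^bsub>R\<^esub> b) = a \<odot>\<^bsub>E\<^esub> g b" if "a \<in> carrier R" "b \<in> J" for a b
      proof -
        obtain y where "b \<in> carrier R" "(b \<odot>\<^bsub>M\<^esub> x, y) \<in> G"
          using \<open>b \<in> J\<close> J_def by blast
        then show ?thesis using linear_graphD(5)[OF G that(1), of "b \<odot>\<^bsub>M\<^esub> x" y] x that
          by (simp add: g_eq M.smult_assoc1)
      qed
      show ?thesis using 1 2 3 by (auto simp: module_hom_def self_module_def)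
    qed
    obtain e where e: "e \<in> carrier E" "\<And>c. c \<in> J \<Longrightarrow> g c = c \<odot>\<^bsub>E\<^esub> e"
      using B[unfolded baer_def, rule_format, OF conjI[OF J g]] by blast
    have "z = r \<odot>\<^bsub>E\<^esub> e" if "r \<in> carrier R" "(r \<odot>\<^bsub>M\<^esub> x, z) \<in> G" for r z
    proof -
      have "r \<in> J" using that unfolding J_def by blast
      then show ?thesis using e(2)[of r] g_eq[OF that(2)] by simp
    qed
    then obtain G' where "linear_graph R M E G'" "G \<subseteq> G'" "(x, e) \<in> G'"
      by (rule linear_graph_extend[OF M E G x e(1)])
    then show ?thesis using max[of G'] by blast
  qed
  define h where "h x = (THE y. (x, y) \<in> G)" for x
  have h_eq: "h x = y" if "(x, y) \<in> G" for x y
    unfolding h_def by (rule the_equality, rule that, rule linear_graph_unique[OF M E G _ that])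
  have h_mem: "(x, h x) \<in> G" if "x \<in> carrier M" for x
    using total[OF that] h_eq by blast
  show ?thesis
  proof (rule bexI[of _ h])
    show "\<forall>x\<in>N. h x = f x" using GfG h_eq unfolding Gf_def by blast
    show "h \<in> module_hom R M E"
      unfolding module_hom_def
    proof (intro CollectI conjI ballI)
      show "h \<in> carrier M \<rightarrow> carrier E" using h_mem linear_graphD(2)[OF G] by blast
      show "h (x \<oplus>\<^bsub>M\<^esub> y) = h x \<oplus>\<^bsub>E\<^esub> h y" if "x \<in> carrier M" "y \<in> carrier M" for x y
        by (rule h_eq[OF linear_graphD(4)[OF G h_mem[OF that(1)] h_mem[OF that(2)]]])
      show "h (a \<odot>\<^bsub>M\<^esub> x) = a \<odot>\<^bsub>E\<^esub> h x" if "a \<in> carrier R" "x \<in> carrier M" for a x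
        by (rule h_eq[OF linear_graphD(5)[OF G that(1) h_mem[OF that(2)]]])
    qed
  qed
qed

section \<open>Localization of a domain at a prime ideal\<close>

lemma (in Module.module) smult_left_comm:
  assumes "a \<in> carrier R" "b \<in> carrier R" "x \<in> carrier M"
  shows "a \<odot>\<^bsub>M\<^esub> (b \<odot>\<^bsub>M\<^esub> x) = b \<odot>\<^bsub>M\<^esub> (a \<odot>\<^bsub>M\<^esub> x)"
  using assms by (simp add: m_comm flip: smult_assoc1)

locale localized_domain = domain R for R (structure) +
  fixes P assumes prime: "primeideal P R"
begin

abbreviation S where "S \<equiv> carrier R - P"
abbreviation L where "L \<equiv> localization R P"
abbreviation fr where "fr \<equiv> loc_frac R P"

lemma S_one: "\<one> \<in> S"
proof -
  interpret primeideal P R by (rule prime)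
  show ?thesis using I_notcarr one_imp_carrier by auto
qed

lemma S_mult: "s \<in> S \<Longrightarrow> t \<in> S \<Longrightarrow> s \<otimes> t \<in> S"
proof -
  interpret primeideal P R by (rule prime)
  show "s \<in> S \<Longrightarrow> t \<in> S \<Longrightarrow> s \<otimes> t \<in> S" using I_prime by auto
qed

lemma S_carr: "s \<in> S \<Longrightarrow> s \<in> carrier R" by simp

lemma S_nonzero: "s \<in> S \<Longrightarrow> s \<noteq> \<zero>"
proof -
  interpret primeideal P R by (rule prime)
  show "s \<in> S \<Longrightarrow> s \<noteq> \<zero>" using zero_closed by auto
qed

text \<open>
  Elements outside \<open>P\<close> are nonzero and can be cancelled in a domain, so the auxiliary factor \<open>u\<close> in the
  definition of equality of fractions disappears.
\<close>

lemma loc_rel_iff: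
  "((a, s), (b, t)) \<in> loc_rel R P \<longleftrightarrow>
     a \<in> carrier R \<and> b \<in> carrier R \<and> s \<in> S \<and> t \<in> S \<and> a \<otimes> t = b \<otimes> s"
proof -
  have "u \<otimes> (a \<otimes> t) = u \<otimes> (b \<otimes> s) \<longleftrightarrow> a \<otimes> t = b \<otimes> s"
    if "a \<in> carrier R" "b \<in> carrier R" "s \<in> S" "t \<in> S" "u \<in> S" for u
    using that m_lcancel[of u "a \<otimes> t" "b \<otimes> s"] S_nonzero by auto
  then show ?thesis unfolding loc_rel_def using S_one by blast
qed

lemma equiv_loc_rel: "equiv (carrier R \<times> S) (loc_rel R P)"
proof (rule equivI)
  show "loc_rel R P \<subseteq> (carrier R \<times> S) \<times> (carrier R \<times> S)"
    by (auto simp: loc_rel_def)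
  show "refl_on (carrier R \<times> S) (loc_rel R P)"
    by (rule refl_onI) (auto simp: loc_rel_iff)
  show "sym (loc_rel R P)" by (rule symI) (auto simp: loc_rel_iff)
  show "trans (loc_rel R P)"
  proof (rule transI)
    fix x y z assume "(x, y) \<in> loc_rel R P" "(y, z) \<in> loc_rel R P"
    moreover obtain a s b t c u where "x = (a, s)" "y = (b, t)" "z = (c, u)"
      by (metis surj_pair)
    ultimately have h: "a \<in> carrier R" "b \<in> carrier R" "c \<in> carrier R" "s \<in> S" "t \<in> S" "u \<in> S"
      "a \<otimes> t = b \<otimes> s" "b \<otimes> u = c \<otimes> t" "x = (a, s)" "z = (c, u)" by (auto simp: loc_rel_iff)
    have "t \<otimes> (a \<otimes> u) = (a \<otimes> t) \<otimes> u" using h(1-6) by (simp add: m_ac)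
    also have "\<dots> = s \<otimes> (b \<otimes> u)" unfolding h(7) using h(1-6) by (simp add: m_ac)
    also have "\<dots> = t \<otimes> (c \<otimes> s)" unfolding h(8) using h(1-6) by (simp add: m_ac)
    finally have "a \<otimes> u = c \<otimes> s" using h m_lcancel[of t "a \<otimes> u" "c \<otimes> s"] S_nonzero by auto
    then show "(x, z) \<in> loc_rel R P" using h by (simp add: loc_rel_iff)
  qed
qed

lemma fr_eq:
  assumes "a \<in> carrier R" "b \<in> carrier R" "s \<in> S" "t \<in> S"
  shows "fr a s = fr b t \<longleftrightarrow> a \<otimes> t = b \<otimes> s"
  unfolding loc_frac_def using eq_equiv_class_iff[OF equiv_loc_rel, of "(a, s)" "(b, t)"] assms
  by (simp add: loc_rel_iff)

lemma fr_mem: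
  assumes "a \<in> carrier R" "s \<in> S"
  shows "(b, t) \<in> fr a s \<longleftrightarrow> b \<in> carrier R \<and> t \<in> S \<and> fr b t = fr a s"
proof -
  have "(b, t) \<in> fr a s \<longleftrightarrow> b \<in> carrier R \<and> t \<in> S \<and> a \<otimes> t = b \<otimes> s"
    unfolding loc_frac_def using assms by (auto simp: loc_rel_iff)
  then show ?thesis using assms fr_eq[of b a t s] by auto
qed

lemma L_carrier: "X \<in> carrier L \<longleftrightarrow> (\<exists>a\<in>carrier R. \<exists>s\<in>S. X = fr a s)"
  unfolding localization_def loc_frac_def by (auto simp: quotient_def)

lemma fr_closed [simp]: "a \<in> carrier R \<Longrightarrow> s \<in> S \<Longrightarrow> fr a s \<in> carrier L"
  using L_carrier by blast

lemma L_carrierE: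
  assumes "X \<in> carrier L" obtains a s where "a \<in> carrier R" "s \<in> S" "X = fr a s"
  using assms L_carrier by blast

text \<open>
  The operations of the localization are unions over all representatives; such a union collapses to a
  single fraction when the term depends on the fractions only.
\<close>

lemma fr_UN:
  assumes as: "a \<in> carrier R" "s \<in> S" and bt: "b \<in> carrier R" "t \<in> S"
    and f: "\<And>a' s' b' t'. \<lbrakk>a' \<in> carrier R; s' \<in> S; b' \<in> carrier R; t' \<in> S;
              a' \<otimes> s = a \<otimes> s'; b' \<otimes> t = b \<otimes> t'\<rbrakk> \<Longrightarrow> f a' s' b' t' = f a s b t"
  shows "(\<Union>(a', s') \<in> fr a s. \<Union>(b', t') \<in> fr b t. f a' s' b' t') = f a s b t"
proof -
  have m1: "(a, s) \<in> fr a s" and m2: "(b, t) \<in> fr b t" using as bt fr_mem by auto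
  have c: "f a' s' b' t' = f a s b t" if "(a', s') \<in> fr a s" "(b', t') \<in> fr b t" for a' s' b' t'
    using that fr_mem[OF as] fr_mem[OF bt] as bt by (intro f) (auto simp: fr_eq)
  show ?thesis
  proof (intro equalityI subsetI)
    fix z assume "z \<in> (\<Union>(a', s') \<in> fr a s. \<Union>(b', t') \<in> fr b t. f a' s' b' t')"
    then show "z \<in> f a s b t" using c by blast
  next
    fix z assume "z \<in> f a s b t"
    then show "z \<in> (\<Union>(a', s') \<in> fr a s. \<Union>(b', t') \<in> fr b t. f a' s' b' t')" using m1 m2 by blast
  qed
qed

lemma L_mult [simp]:
  assumes "a \<in> carrier R" "s \<in> S" "b \<in> carrier R" "t \<in> S"
  shows "fr a s \<otimes>\<^bsub>L\<^esub> fr b t = fr (a \<otimes> b) (s \<otimes> t)"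
proof -
  have "(\<Union>(a', s') \<in> fr a s. \<Union>(b', t') \<in> fr b t. fr (a' \<otimes> b') (s' \<otimes> t')) = fr (a \<otimes> b) (s \<otimes> t)"
  proof (rule fr_UN[OF assms])
    fix a' s' b' t' assume h: "a' \<in> carrier R" "s' \<in> S" "b' \<in> carrier R" "t' \<in> S"
      "a' \<otimes> s = a \<otimes> s'" "b' \<otimes> t = b \<otimes> t'"
    have c: "s' \<in> carrier R" "t' \<in> carrier R" "s \<in> carrier R" "t \<in> carrier R" using h assms by auto
    have "(a' \<otimes> b') \<otimes> (s \<otimes> t) = (a' \<otimes> s) \<otimes> (b' \<otimes> t)" using h(1,3) c by (simp add: m_ac)
    also have "\<dots> = (a \<otimes> b) \<otimes> (s' \<otimes> t')" unfolding h(5,6) using assms c by (simp add: m_ac)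
    finally show "fr (a' \<otimes> b') (s' \<otimes> t') = fr (a \<otimes> b) (s \<otimes> t)"
      using h assms S_mult by (subst fr_eq) auto
  qed
  then show ?thesis by (simp add: localization_def)
qed

lemma L_add [simp]:
  assumes "a \<in> carrier R" "s \<in> S" "b \<in> carrier R" "t \<in> S"
  shows "fr a s \<oplus>\<^bsub>L\<^esub> fr b t = fr (a \<otimes> t \<oplus> b \<otimes> s) (s \<otimes> t)"
proof -
  have "(\<Union>(a', s') \<in> fr a s. \<Union>(b', t') \<in> fr b t. fr (a' \<otimes> t' \<oplus> b' \<otimes> s') (s' \<otimes> t')) =
      fr (a \<otimes> t \<oplus> b \<otimes> s) (s \<otimes> t)"
  proof (rule fr_UN[OF assms])
    fix a' s' b' t' assume h: "a' \<in> carrier R" "s' \<in> S" "b' \<in> carrier R" "t' \<in> S"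
      "a' \<otimes> s = a \<otimes> s'" "b' \<otimes> t = b \<otimes> t'"
    have c: "s' \<in> carrier R" "t' \<in> carrier R" "s \<in> carrier R" "t \<in> carrier R" using h assms by auto
    have "(a' \<otimes> t' \<oplus> b' \<otimes> s') \<otimes> (s \<otimes> t) = (a' \<otimes> s) \<otimes> (t \<otimes> t') \<oplus> (b' \<otimes> t) \<otimes> (s \<otimes> s')"
      using h(1,3) c by (simp add: m_ac l_distr r_distr)
    also have "\<dots> = (a \<otimes> t \<oplus> b \<otimes> s) \<otimes> (s' \<otimes> t')"
      unfolding h(5,6) using assms c by (simp add: m_ac l_distr r_distr)
    finally show "fr (a' \<otimes> t' \<oplus> b' \<otimes> s') (s' \<otimes> t') = fr (a \<otimes> t \<oplus> b \<otimes> s) (s \<otimes> t)"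
      using h assms S_mult by (subst fr_eq) auto
  qed
  then show ?thesis by (simp add: localization_def)
qed

lemma L_one: "\<one>\<^bsub>L\<^esub> = fr \<one> \<one>" and L_zero: "\<zero>\<^bsub>L\<^esub> = fr \<zero> \<one>"
  by (simp_all add: localization_def)

lemma fr_eqI:
  assumes "a \<in> carrier R" "b \<in> carrier R" "s \<in> S" "t \<in> S" "a \<otimes> t = b \<otimes> s"
  shows "fr a s = fr b t"
  using assms fr_eq by blast

lemma L_cring: "cring L"
proof (rule cringI)
  show "abelian_group L"
  proof (rule abelian_groupI)
    fix x y z assume "x \<in> carrier L" "y \<in> carrier L" "z \<in> carrier L"
    then obtain a s b t c u where h: "a \<in> carrier R" "s \<in> S" "x = fr a s" "b \<in> carrier R" "t \<in> S" "y = fr b t"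
      "c \<in> carrier R" "u \<in> S" "z = fr c u" by (metis L_carrierE)
    have S: "s \<otimes> t \<in> S" "t \<otimes> u \<in> S" using h S_mult by auto
    show "x \<oplus>\<^bsub>L\<^esub> y \<in> carrier L" using h S by simp
    show "x \<oplus>\<^bsub>L\<^esub> y \<oplus>\<^bsub>L\<^esub> z = x \<oplus>\<^bsub>L\<^esub> (y \<oplus>\<^bsub>L\<^esub> z)"
      using h S S_mult by (auto intro!: fr_eqI simp: l_distr r_distr m_ac a_ac)
    show "x \<oplus>\<^bsub>L\<^esub> y = y \<oplus>\<^bsub>L\<^esub> x"
      using h S S_mult by (auto intro!: fr_eqI simp: l_distr r_distr m_ac a_ac)
  next
    show "\<zero>\<^bsub>L\<^esub> \<in> carrier L" using S_one by (simp add: L_zero)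
  next
    fix x assume "x \<in> carrier L"
    then obtain a s where h: "a \<in> carrier R" "s \<in> S" "x = fr a s" by (metis L_carrierE)
    show "\<zero>\<^bsub>L\<^esub> \<oplus>\<^bsub>L\<^esub> x = x" using h S_one by (auto simp: L_zero)
    have "fr (\<ominus> a) s \<oplus>\<^bsub>L\<^esub> x = \<zero>\<^bsub>L\<^esub>"
    proof -
      have "fr (\<ominus> a) s \<oplus>\<^bsub>L\<^esub> x = fr \<zero> (s \<otimes> s)" using h by (simp add: l_minus l_neg)
      also have "\<dots> = \<zero>\<^bsub>L\<^esub>" unfolding L_zero using h S_one S_mult[of s s] by (intro fr_eqI) auto
      finally show ?thesis .
    qed
    then show "\<exists>y\<in>carrier L. y \<oplus>\<^bsub>L\<^esub> x = \<zero>\<^bsub>L\<^esub>" using h by (intro bexI[of _ "fr (\<ominus> a) s"]) auto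
  qed
  show "comm_monoid L"
  proof (rule comm_monoidI)
    fix x y z assume "x \<in> carrier L" "y \<in> carrier L" "z \<in> carrier L"
    then obtain a s b t c u where h: "a \<in> carrier R" "s \<in> S" "x = fr a s" "b \<in> carrier R" "t \<in> S" "y = fr b t"
      "c \<in> carrier R" "u \<in> S" "z = fr c u" by (metis L_carrierE)
    have S: "s \<otimes> t \<in> S" "t \<otimes> u \<in> S" using h S_mult by auto
    show "x \<otimes>\<^bsub>L\<^esub> y \<in> carrier L" using h S by simp
    show "x \<otimes>\<^bsub>L\<^esub> y \<otimes>\<^bsub>L\<^esub> z = x \<otimes>\<^bsub>L\<^esub> (y \<otimes>\<^bsub>L\<^esub> z)" using h S by (simp add: m_assoc)
    show "x \<otimes>\<^bsub>L\<^esub> y = y \<otimes>\<^bsub>L\<^esub> x" using h S by (simp add: m_comm)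
    show "\<one>\<^bsub>L\<^esub> \<otimes>\<^bsub>L\<^esub> x = x" using h S_one by (simp add: L_one)
  next
    show "\<one>\<^bsub>L\<^esub> \<in> carrier L" using S_one by (simp add: L_one)
  qed
  fix x y z assume "x \<in> carrier L" "y \<in> carrier L" "z \<in> carrier L"
  then obtain a s b t c u where h: "a \<in> carrier R" "s \<in> S" "x = fr a s" "b \<in> carrier R" "t \<in> S" "y = fr b t"
    "c \<in> carrier R" "u \<in> S" "z = fr c u" by (metis L_carrierE)
  have S: "s \<otimes> t \<in> S" "s \<otimes> u \<in> S" "t \<otimes> u \<in> S" using h S_mult by auto
  have "fr ((a \<otimes> t \<oplus> b \<otimes> s) \<otimes> c) ((s \<otimes> t) \<otimes> u) =
      fr ((a \<otimes> c) \<otimes> (t \<otimes> u) \<oplus> (b \<otimes> c) \<otimes> (s \<otimes> u)) ((s \<otimes> u) \<otimes> (t \<otimes> u))"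
    by (rule fr_eqI) (use h S S_mult in \<open>simp_all add: l_distr r_distr m_ac\<close>)
  then show "(x \<oplus>\<^bsub>L\<^esub> y) \<otimes>\<^bsub>L\<^esub> z = x \<otimes>\<^bsub>L\<^esub> z \<oplus>\<^bsub>L\<^esub> y \<otimes>\<^bsub>L\<^esub> z"
    using h S by simp
qed

end

section \<open>Localization of a module\<close>

context localized_domain
begin

text \<open>
  The map \<open>q\<close> presents \<open>N\<close> as the localization of \<open>M\<close>. Surjectivity of \<open>q\<close> is a genuine restriction,
  satisfied for modules divisible by the denominators; for them the localization is the quotient by
  torsion.
\<close>

definition is_localized :: "('x \<Rightarrow> 'y) \<Rightarrow> ('a, 'x, 'm) module_scheme \<Rightarrow> (('a \<times> 'a) set, 'y) module \<Rightarrow> bool" where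
  "is_localized q M N \<longleftrightarrow> Module.module L N \<and> q ` carrier M = carrier N \<and>
     (\<forall>x\<in>carrier M. \<forall>y\<in>carrier M. q (x \<oplus>\<^bsub>M\<^esub> y) = q x \<oplus>\<^bsub>N\<^esub> q y) \<and>
     (\<forall>a\<in>carrier R. \<forall>x\<in>carrier M. q (a \<odot>\<^bsub>M\<^esub> x) = fr a \<one> \<odot>\<^bsub>N\<^esub> q x) \<and>
     (\<forall>x\<in>carrier M. \<forall>y\<in>carrier M. q x = q y \<longleftrightarrow> (\<exists>u\<in>S. u \<odot>\<^bsub>M\<^esub> x = u \<odot>\<^bsub>M\<^esub> y))"

text \<open>
  A torsion class is represented by the code of a chosen element of it, so the localization lives in
  any type that can encode \<open>M\<close>. A fraction \<open>a/s\<close> sends the class of \<open>x\<close> to the class of any solution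
  \<open>z\<close> of \<open>s z = a x\<close>; divisibility gives a solution, and its class is unique because \<open>s\<close> is
  injective on classes.
\<close>

lemma exists_localized:
  fixes M :: "('a, 'x, 'm) module_scheme" and enc :: "'x \<Rightarrow> 'y"
  assumes M: "Module.module R M" and div: "\<And>s x. s \<in> S \<Longrightarrow> x \<in> carrier M \<Longrightarrow> \<exists>y\<in>carrier M. s \<odot>\<^bsub>M\<^esub> y = x"
    and enc: "inj_on enc (carrier M)"
  shows "\<exists>q (N :: (('a \<times> 'a) set, 'y) module). is_localized q M N"
proof -
  interpret M: Module.module R M by fact
  define rel where "rel x y \<longleftrightarrow> (\<exists>u\<in>S. u \<odot>\<^bsub>M\<^esub> x = u \<odot>\<^bsub>M\<^esub> y)" for x y
  have rel_refl: "rel x x" for x using S_one unfolding rel_def by blast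
  have rel_sym: "rel x y \<Longrightarrow> rel y x" for x y unfolding rel_def by metis
  have rel_trans: "rel x z" if h: "rel x y" "rel y z" and c: "x \<in> carrier M" "y \<in> carrier M" "z \<in> carrier M" for x y z
  proof -
    obtain u v where uv: "u \<in> S" "v \<in> S" "u \<odot>\<^bsub>M\<^esub> x = u \<odot>\<^bsub>M\<^esub> y" "v \<odot>\<^bsub>M\<^esub> y = v \<odot>\<^bsub>M\<^esub> z"
      using h unfolding rel_def by blast
    have uvc: "u \<in> carrier R" "v \<in> carrier R" using uv by auto
    have "(u \<otimes> v) \<odot>\<^bsub>M\<^esub> x = v \<odot>\<^bsub>M\<^esub> (u \<odot>\<^bsub>M\<^esub> x)" using uvc c by (simp add: M.smult_assoc1 M.smult_left_comm)
    also have "\<dots> = u \<odot>\<^bsub>M\<^esub> (v \<odot>\<^bsub>M\<^esub> y)" unfolding uv(3) using uvc c by (simp add: M.smult_assoc1 M.smult_left_comm)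
    also have "\<dots> = (u \<otimes> v) \<odot>\<^bsub>M\<^esub> z" unfolding uv(4) using uvc c by (simp add: M.smult_assoc1)
    finally show ?thesis using S_mult[OF uv(1,2)] unfolding rel_def by blast
  qed
  define q where "q x = enc (SOME y. y \<in> carrier M \<and> rel x y)" for x
  have q_eq: "q x = q y \<longleftrightarrow> rel x y" if x: "x \<in> carrier M" and y: "y \<in> carrier M" for x y
  proof
    let ?f = "\<lambda>x. SOME y. y \<in> carrier M \<and> rel x y"
    have f: "?f x \<in> carrier M \<and> rel x (?f x)" if "x \<in> carrier M" for x
      by (rule someI[of "\<lambda>y. y \<in> carrier M \<and> rel x y" x]) (simp add: that rel_refl)
    assume "q x = q y"
    then have "?f x = ?f y" unfolding q_def using enc f[OF x] f[OF y] by (auto dest: inj_onD)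
    then show "rel x y" using f[OF x] f[OF y] rel_trans[of x "?f x" y] rel_sym x y by metis
  next
    assume r: "rel x y"
    have "(\<lambda>z. z \<in> carrier M \<and> rel x z) = (\<lambda>z. z \<in> carrier M \<and> rel y z)"
      using rel_trans[OF rel_sym[OF r] _ y x] rel_trans[OF r _ x y] by (intro ext conj_cong refl iffI) simp_all
    then show "q x = q y" unfolding q_def by simp
  qed
  have q_smult: "q (a \<odot>\<^bsub>M\<^esub> x) = q (a \<odot>\<^bsub>M\<^esub> x')"
    if h: "q x = q x'" "a \<in> carrier R" "x \<in> carrier M" "x' \<in> carrier M" for a x x'
  proof -
    obtain u where u: "u \<in> S" "u \<odot>\<^bsub>M\<^esub> x = u \<odot>\<^bsub>M\<^esub> x'" using h q_eq unfolding rel_def by blast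
    have uc: "u \<in> carrier R" using u by auto
    have "u \<odot>\<^bsub>M\<^esub> (a \<odot>\<^bsub>M\<^esub> x) = a \<odot>\<^bsub>M\<^esub> (u \<odot>\<^bsub>M\<^esub> x)" using h uc by (simp add: M.smult_assoc1 M.smult_left_comm)
    also have "\<dots> = u \<odot>\<^bsub>M\<^esub> (a \<odot>\<^bsub>M\<^esub> x')" unfolding u(2) using h uc by (simp add: M.smult_assoc1 M.smult_left_comm)
    finally show ?thesis using q_eq h u(1) unfolding rel_def by auto
  qed
  have q_add: "q (x \<oplus>\<^bsub>M\<^esub> y) = q (x' \<oplus>\<^bsub>M\<^esub> y')"
    if h: "q x = q x'" "q y = q y'" "x \<in> carrier M" "x' \<in> carrier M" "y \<in> carrier M" "y' \<in> carrier M" for x x' y y'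
  proof -
    obtain u where u: "u \<in> S" "u \<odot>\<^bsub>M\<^esub> x = u \<odot>\<^bsub>M\<^esub> x'" using h q_eq unfolding rel_def by blast
    obtain v where v: "v \<in> S" "v \<odot>\<^bsub>M\<^esub> y = v \<odot>\<^bsub>M\<^esub> y'" using h q_eq unfolding rel_def by blast
    have c: "u \<in> carrier R" "v \<in> carrier R" using u v by auto
    have "(u \<otimes> v) \<odot>\<^bsub>M\<^esub> (x \<oplus>\<^bsub>M\<^esub> y) = v \<odot>\<^bsub>M\<^esub> (u \<odot>\<^bsub>M\<^esub> x) \<oplus>\<^bsub>M\<^esub> u \<odot>\<^bsub>M\<^esub> (v \<odot>\<^bsub>M\<^esub> y)"
      using h c by (simp add: M.smult_r_distr M.smult_assoc1 M.smult_left_comm)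
    also have "\<dots> = (u \<otimes> v) \<odot>\<^bsub>M\<^esub> (x' \<oplus>\<^bsub>M\<^esub> y')" unfolding u(2) v(2)
      using h c by (simp add: M.smult_r_distr M.smult_assoc1 M.smult_left_comm)
    finally show ?thesis using q_eq h S_mult[OF u(1) v(1)] unfolding rel_def by auto
  qed
  have q_cancel: "q x = q y" if h: "q (s \<odot>\<^bsub>M\<^esub> x) = q (s \<odot>\<^bsub>M\<^esub> y)" "s \<in> S" "x \<in> carrier M" "y \<in> carrier M" for s x y
  proof -
    obtain u where u: "u \<in> S" "u \<odot>\<^bsub>M\<^esub> (s \<odot>\<^bsub>M\<^esub> x) = u \<odot>\<^bsub>M\<^esub> (s \<odot>\<^bsub>M\<^esub> y)"
      using h q_eq unfolding rel_def by auto
    have "(u \<otimes> s) \<odot>\<^bsub>M\<^esub> x = (u \<otimes> s) \<odot>\<^bsub>M\<^esub> y" using u h by (simp add: M.smult_assoc1)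
    then show ?thesis unfolding q_eq[OF h(3,4)] rel_def using S_mult[OF u(1) h(2)] by blast
  qed
  \<comment> \<open>The scalar multiplication on classes, by solving \<open>s z = a x\<close>.\<close>
  define sm where "sm C X = (THE Z. \<exists>a\<in>carrier R. \<exists>s\<in>S. \<exists>x\<in>carrier M. \<exists>z\<in>carrier M.
      C = fr a s \<and> X = q x \<and> Z = q z \<and> q (s \<odot>\<^bsub>M\<^esub> z) = q (a \<odot>\<^bsub>M\<^esub> x))" for C X
  have sm: "sm (fr a s) (q x) = q z" if h: "a \<in> carrier R" "s \<in> S" "x \<in> carrier M" "z \<in> carrier M"
    "q (s \<odot>\<^bsub>M\<^esub> z) = q (a \<odot>\<^bsub>M\<^esub> x)" for a s x z
    unfolding sm_def
  proof (rule the_equality)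
    show "\<exists>a'\<in>carrier R. \<exists>s'\<in>S. \<exists>x'\<in>carrier M. \<exists>z'\<in>carrier M.
      fr a s = fr a' s' \<and> q x = q x' \<and> q z = q z' \<and> q (s' \<odot>\<^bsub>M\<^esub> z') = q (a' \<odot>\<^bsub>M\<^esub> x')" using h by blast
  next
    fix Z assume "\<exists>a'\<in>carrier R. \<exists>s'\<in>S. \<exists>x'\<in>carrier M. \<exists>z'\<in>carrier M.
      fr a s = fr a' s' \<and> q x = q x' \<and> Z = q z' \<and> q (s' \<odot>\<^bsub>M\<^esub> z') = q (a' \<odot>\<^bsub>M\<^esub> x')"
    then obtain a' s' x' z' where h': "a' \<in> carrier R" "s' \<in> S" "x' \<in> carrier M" "z' \<in> carrier M"
      "fr a s = fr a' s'" "q x = q x'" "Z = q z'" "q (s' \<odot>\<^bsub>M\<^esub> z') = q (a' \<odot>\<^bsub>M\<^esub> x')" by blast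
    have e: "a \<otimes> s' = a' \<otimes> s" using h h' fr_eq by blast
    have c: "s \<in> carrier R" "s' \<in> carrier R" using h h' by auto
    have "q (s \<odot>\<^bsub>M\<^esub> (s' \<odot>\<^bsub>M\<^esub> z)) = q (s' \<odot>\<^bsub>M\<^esub> (s \<odot>\<^bsub>M\<^esub> z))"
      using h c by (simp add: M.smult_assoc1 M.smult_left_comm)
    also have "\<dots> = q (s' \<odot>\<^bsub>M\<^esub> (a \<odot>\<^bsub>M\<^esub> x))" by (rule q_smult[OF h(5)]) (use h c in auto)
    also have "s' \<odot>\<^bsub>M\<^esub> (a \<odot>\<^bsub>M\<^esub> x) = (a' \<otimes> s) \<odot>\<^bsub>M\<^esub> x" unfolding e[symmetric]
      using h c by (simp add: M.smult_assoc1 M.smult_left_comm)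
    also have "q \<dots> = q ((a' \<otimes> s) \<odot>\<^bsub>M\<^esub> x')" by (rule q_smult[OF h'(6)]) (use h h' c in auto)
    also have "(a' \<otimes> s) \<odot>\<^bsub>M\<^esub> x' = s \<odot>\<^bsub>M\<^esub> (a' \<odot>\<^bsub>M\<^esub> x')" using h' c by (simp add: M.smult_assoc1 M.smult_left_comm)
    also have "q \<dots> = q (s \<odot>\<^bsub>M\<^esub> (s' \<odot>\<^bsub>M\<^esub> z'))" by (rule q_smult[OF h'(8)[symmetric]]) (use h' c in auto)
    finally have "q (s' \<odot>\<^bsub>M\<^esub> z) = q (s' \<odot>\<^bsub>M\<^esub> z')" by (rule q_cancel) (use h h' c in auto)
    then have "q z = q z'" by (rule q_cancel) (use h h' c in auto)
    then show "Z = q z" using h' by simp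
  qed
  define N where "N = \<lparr>carrier = q ` carrier M, mult = (\<lambda>_ _. q \<zero>\<^bsub>M\<^esub>), one = q \<zero>\<^bsub>M\<^esub>, zero = q \<zero>\<^bsub>M\<^esub>,
     add = (\<lambda>X Y. q (inv_into (carrier M) q X \<oplus>\<^bsub>M\<^esub> inv_into (carrier M) q Y)), smult = sm\<rparr>"
  have N_add: "q x \<oplus>\<^bsub>N\<^esub> q y = q (x \<oplus>\<^bsub>M\<^esub> y)" if "x \<in> carrier M" "y \<in> carrier M" for x y
    unfolding N_def using that
    by (auto intro!: q_add inv_into_into simp: f_inv_into_f)
  have N_sm: "fr a s \<odot>\<^bsub>N\<^esub> q x = q z" if "a \<in> carrier R" "s \<in> S" "x \<in> carrier M" "z \<in> carrier M"
    "s \<odot>\<^bsub>M\<^esub> z = a \<odot>\<^bsub>M\<^esub> x" for a s x z using sm that unfolding N_def by simp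
  have N_carr: "carrier N = q ` carrier M" and N_zero: "\<zero>\<^bsub>N\<^esub> = q \<zero>\<^bsub>M\<^esub>" unfolding N_def by simp_all
  have smE: "\<exists>z\<in>carrier M. s \<odot>\<^bsub>M\<^esub> z = a \<odot>\<^bsub>M\<^esub> x \<and> fr a s \<odot>\<^bsub>N\<^esub> q x = q z"
    if h: "a \<in> carrier R" "s \<in> S" "x \<in> carrier M" for a s x
  proof -
    obtain z where "z \<in> carrier M" "s \<odot>\<^bsub>M\<^esub> z = a \<odot>\<^bsub>M\<^esub> x" using div[OF h(2), of "a \<odot>\<^bsub>M\<^esub> x"] h by auto
    then show ?thesis using N_sm h by blast
  qed
  have "Module.module L N"
  proof (rule moduleI)
    show "cring L" by (rule L_cring)
    show "abelian_group N"
    proof (rule abelian_groupI)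
      fix X assume "X \<in> carrier N"
      then obtain x where x: "x \<in> carrier M" "X = q x" unfolding N_carr by blast
      show "\<zero>\<^bsub>N\<^esub> \<oplus>\<^bsub>N\<^esub> X = X" using x by (simp add: N_zero N_add)
      show "\<exists>Y\<in>carrier N. Y \<oplus>\<^bsub>N\<^esub> X = \<zero>\<^bsub>N\<^esub>"
        using x by (intro bexI[of _ "q (\<ominus>\<^bsub>M\<^esub> x)"]) (auto simp: N_zero N_add N_carr M.M.l_neg)
    qed (auto simp: N_carr N_zero N_add M.M.a_ac)
  next
    fix A X assume "A \<in> carrier L" "X \<in> carrier N"
    then obtain a s x where h: "A = fr a s" "X = q x" "a \<in> carrier R" "s \<in> S" "x \<in> carrier M"
      unfolding N_carr by (elim L_carrierE imageE)
    then show "A \<odot>\<^bsub>N\<^esub> X \<in> carrier N" using smE[OF h(3-5)] by (auto simp: N_carr)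
  next
    fix A B X assume "A \<in> carrier L" "B \<in> carrier L" "X \<in> carrier N"
    then obtain a s b t x where h: "A = fr a s" "B = fr b t" "X = q x" "a \<in> carrier R" "s \<in> S"
      "b \<in> carrier R" "t \<in> S" "x \<in> carrier M"
      unfolding N_carr by (elim L_carrierE imageE)
    have c: "s \<in> carrier R" "t \<in> carrier R" "s \<otimes> t \<in> S" using h S_mult by auto
    obtain z where z: "z \<in> carrier M" "s \<odot>\<^bsub>M\<^esub> z = a \<odot>\<^bsub>M\<^esub> x" "fr a s \<odot>\<^bsub>N\<^esub> q x = q z" using smE h by blast
    obtain w where w: "w \<in> carrier M" "t \<odot>\<^bsub>M\<^esub> w = b \<odot>\<^bsub>M\<^esub> x" "fr b t \<odot>\<^bsub>N\<^esub> q x = q w" using smE h by blast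
    have "(s \<otimes> t) \<odot>\<^bsub>M\<^esub> (z \<oplus>\<^bsub>M\<^esub> w) = t \<odot>\<^bsub>M\<^esub> (s \<odot>\<^bsub>M\<^esub> z) \<oplus>\<^bsub>M\<^esub> s \<odot>\<^bsub>M\<^esub> (t \<odot>\<^bsub>M\<^esub> w)"
      using z(1) w(1) c by (simp add: M.smult_r_distr M.smult_assoc1 M.smult_left_comm)
    also have "\<dots> = (a \<otimes> t \<oplus> b \<otimes> s) \<odot>\<^bsub>M\<^esub> x" unfolding z(2) w(2)
      using h c by (simp add: M.smult_l_distr M.smult_assoc1 M.smult_left_comm)
    finally show "(A \<oplus>\<^bsub>L\<^esub> B) \<odot>\<^bsub>N\<^esub> X = A \<odot>\<^bsub>N\<^esub> X \<oplus>\<^bsub>N\<^esub> B \<odot>\<^bsub>N\<^esub> X"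
      using h c z w by (simp add: N_add N_sm)
    obtain v where v: "v \<in> carrier M" "s \<odot>\<^bsub>M\<^esub> v = a \<odot>\<^bsub>M\<^esub> w" "fr a s \<odot>\<^bsub>N\<^esub> q w = q v" using smE h w(1) by blast
    have "(s \<otimes> t) \<odot>\<^bsub>M\<^esub> v = t \<odot>\<^bsub>M\<^esub> (s \<odot>\<^bsub>M\<^esub> v)" using v(1) c by (simp add: M.smult_assoc1 M.smult_left_comm)
    also have "\<dots> = a \<odot>\<^bsub>M\<^esub> (t \<odot>\<^bsub>M\<^esub> w)" unfolding v(2) using h w(1) c by (simp add: M.smult_assoc1 M.smult_left_comm)
    also have "\<dots> = (a \<otimes> b) \<odot>\<^bsub>M\<^esub> x" unfolding w(2) using h by (simp add: M.smult_assoc1)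
    finally show "(A \<otimes>\<^bsub>L\<^esub> B) \<odot>\<^bsub>N\<^esub> X = A \<odot>\<^bsub>N\<^esub> (B \<odot>\<^bsub>N\<^esub> X)"
      using h c v w by (simp add: N_sm)
  next
    fix A X Y assume "A \<in> carrier L" "X \<in> carrier N" "Y \<in> carrier N"
    then obtain a s x y where h: "A = fr a s" "X = q x" "Y = q y" "a \<in> carrier R" "s \<in> S"
      "x \<in> carrier M" "y \<in> carrier M"
      unfolding N_carr by (elim L_carrierE imageE)
    obtain z where z: "z \<in> carrier M" "s \<odot>\<^bsub>M\<^esub> z = a \<odot>\<^bsub>M\<^esub> x" "fr a s \<odot>\<^bsub>N\<^esub> q x = q z" using smE h by blast
    obtain w where w: "w \<in> carrier M" "s \<odot>\<^bsub>M\<^esub> w = a \<odot>\<^bsub>M\<^esub> y" "fr a s \<odot>\<^bsub>N\<^esub> q y = q w" using smE h by blast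
    have "fr a s \<odot>\<^bsub>N\<^esub> q (x \<oplus>\<^bsub>M\<^esub> y) = q (z \<oplus>\<^bsub>M\<^esub> w)"
      by (rule N_sm) (use h z w in \<open>auto simp: M.smult_r_distr\<close>)
    then show "A \<odot>\<^bsub>N\<^esub> (X \<oplus>\<^bsub>N\<^esub> Y) = A \<odot>\<^bsub>N\<^esub> X \<oplus>\<^bsub>N\<^esub> A \<odot>\<^bsub>N\<^esub> Y"
      using h z w by (simp add: N_add)
  next
    fix X assume "X \<in> carrier N"
    then obtain x where "x \<in> carrier M" "X = q x" unfolding N_carr by blast
    then show "\<one>\<^bsub>L\<^esub> \<odot>\<^bsub>N\<^esub> X = X" unfolding L_one using S_one by (auto intro!: N_sm)
  qed
  then have "is_localized q M N"
    unfolding is_localized_def using N_carr N_add S_one q_eq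
    by (auto simp: rel_def intro!: N_sm[symmetric])
  then show ?thesis by blast
qed

end

section \<open>Injective modules and localization\<close>

lemma module_homD:
  assumes "f \<in> module_hom R M N"
  shows "\<And>x. x \<in> carrier M \<Longrightarrow> f x \<in> carrier N"
    and "\<And>x y. x \<in> carrier M \<Longrightarrow> y \<in> carrier M \<Longrightarrow> f (x \<oplus>\<^bsub>M\<^esub> y) = f x \<oplus>\<^bsub>N\<^esub> f y"
    and "\<And>a x. a \<in> carrier R \<Longrightarrow> x \<in> carrier M \<Longrightarrow> f (a \<odot>\<^bsub>M\<^esub> x) = a \<odot>\<^bsub>N\<^esub> f x"
  using assms unfolding module_hom_def by auto

text \<open>
  The solution of \<open>s y = x\<close> comes from extending the homomorphism \<open>r s \<mapsto> r x\<close> from the principal ideal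
  of \<open>s\<close>, which is well defined in a domain.
\<close>

lemma baer_divisible:
  assumes R: "domain R" and E: "Module.module R E" and B: "baer R E"
    and s: "s \<in> carrier R" "s \<noteq> \<zero>\<^bsub>R\<^esub>" and x: "x \<in> carrier E"
  shows "\<exists>y\<in>carrier E. s \<odot>\<^bsub>E\<^esub> y = x"
proof -
  interpret domain R by fact
  interpret E: Module.module R E by fact
  define J where "J = {r \<otimes>\<^bsub>R\<^esub> s | r. r \<in> carrier R}"
  define f where "f c = (THE r. r \<in> carrier R \<and> c = r \<otimes>\<^bsub>R\<^esub> s) \<odot>\<^bsub>E\<^esub> x" for c
  have f: "f (r \<otimes>\<^bsub>R\<^esub> s) = r \<odot>\<^bsub>E\<^esub> x" if "r \<in> carrier R" for r
  proof -
    have "(THE r'. r' \<in> carrier R \<and> r \<otimes>\<^bsub>R\<^esub> s = r' \<otimes>\<^bsub>R\<^esub> s) = r"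
      using that s m_rcancel[of s r] by (intro the_equality) auto
    then show ?thesis unfolding f_def by simp
  qed
  have JE: "\<exists>r\<in>carrier R. c = r \<otimes>\<^bsub>R\<^esub> s" if "c \<in> J" for c using that unfolding J_def by blast
  have JI: "r \<otimes>\<^bsub>R\<^esub> s \<in> J" if "r \<in> carrier R" for r using that unfolding J_def by blast
  have J: "ideal J R"
  proof (rule idealI')
    show "J \<subseteq> carrier R" using s unfolding J_def by auto
    show "\<zero>\<^bsub>R\<^esub> \<in> J" using JI[of "\<zero>\<^bsub>R\<^esub>"] s by simp
    show "a \<oplus>\<^bsub>R\<^esub> b \<in> J" if "a \<in> J" "b \<in> J" for a b
    proof -
      obtain r t where "r \<in> carrier R" "t \<in> carrier R" "a = r \<otimes>\<^bsub>R\<^esub> s" "b = t \<otimes>\<^bsub>R\<^esub> s"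
        using JE[OF \<open>a \<in> J\<close>] JE[OF \<open>b \<in> J\<close>] by blast
      then show ?thesis using JI[of "r \<oplus>\<^bsub>R\<^esub> t"] s by (simp add: l_distr)
    qed
    show "r \<otimes>\<^bsub>R\<^esub> a \<in> J" if r: "r \<in> carrier R" and "a \<in> J" for r a
    proof -
      obtain t where "t \<in> carrier R" "a = t \<otimes>\<^bsub>R\<^esub> s" using JE[OF \<open>a \<in> J\<close>] by blast
      then show ?thesis using JI[of "r \<otimes>\<^bsub>R\<^esub> t"] s r by (simp add: m_assoc)
    qed
  qed
  have "f \<in> module_hom R ((self_module R)\<lparr>carrier := J\<rparr>) E"
    unfolding module_hom_def
  proof (intro CollectI conjI ballI)
    show "f \<in> carrier ((self_module R)\<lparr>carrier := J\<rparr>) \<rightarrow> carrier E"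
    proof (rule Pi_I)
      fix c assume "c \<in> carrier ((self_module R)\<lparr>carrier := J\<rparr>)"
      then obtain r where "r \<in> carrier R" "c = r \<otimes>\<^bsub>R\<^esub> s" using JE[of c] by auto
      then show "f c \<in> carrier E" using f x by simp
    qed
  next
    fix a b assume "a \<in> carrier ((self_module R)\<lparr>carrier := J\<rparr>)" "b \<in> carrier ((self_module R)\<lparr>carrier := J\<rparr>)"
    then obtain r t where h: "r \<in> carrier R" "t \<in> carrier R" "a = r \<otimes>\<^bsub>R\<^esub> s" "b = t \<otimes>\<^bsub>R\<^esub> s"
      using JE[of a] JE[of b] by auto
    then show "f (a \<oplus>\<^bsub>(self_module R)\<lparr>carrier := J\<rparr>\<^esub> b) = f a \<oplus>\<^bsub>E\<^esub> f b"
      using f[of "r \<oplus>\<^bsub>R\<^esub> t"] f s x by (simp add: self_module_def l_distr E.smult_l_distr)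
  next
    fix r b assume r: "r \<in> carrier R" and "b \<in> carrier ((self_module R)\<lparr>carrier := J\<rparr>)"
    then obtain t where h: "t \<in> carrier R" "b = t \<otimes>\<^bsub>R\<^esub> s" using JE[of b] by auto
    then show "f (r \<odot>\<^bsub>(self_module R)\<lparr>carrier := J\<rparr>\<^esub> b) = r \<odot>\<^bsub>E\<^esub> f b"
      using f[of "r \<otimes>\<^bsub>R\<^esub> t"] f s x r by (simp add: self_module_def m_assoc E.smult_assoc1)
  qed
  from B[unfolded baer_def, rule_format, OF conjI[OF J this]]
  obtain e where e: "e \<in> carrier E" "\<forall>c\<in>J. f c = c \<odot>\<^bsub>E\<^esub> e" by blast
  have "s \<odot>\<^bsub>E\<^esub> e = f (\<one>\<^bsub>R\<^esub> \<otimes>\<^bsub>R\<^esub> s)" using e JI[of "\<one>\<^bsub>R\<^esub>"] s by auto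
  also have "\<dots> = x" using f[of "\<one>\<^bsub>R\<^esub>"] x by simp
  finally show ?thesis using e by blast
qed

lemma linear_graph_smult:
  assumes M: "Module.module R M" and N: "Module.module R N" and G: "linear_graph R M N G" and v: "v \<in> carrier R"
  shows "linear_graph R M N {(a, v \<odot>\<^bsub>N\<^esub> b) | a b. (a, b) \<in> G}" (is "linear_graph R M N ?G")
proof -
  interpret M: Module.module R M by fact
  interpret N: Module.module R N by fact
  note D = linear_graphD[OF G]
  show ?thesis
    unfolding linear_graph_def
  proof (intro conjI allI impI)
    show "?G \<subseteq> carrier M \<times> carrier N" using D(1,2) v by auto
    show "(\<zero>\<^bsub>M\<^esub>, \<zero>\<^bsub>N\<^esub>) \<in> ?G" using D(3) v by force
  next
    fix x y x' y' assume "(x, y) \<in> ?G" "(x', y') \<in> ?G"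
    then obtain b b' where h: "(x, b) \<in> G" "(x', b') \<in> G" "y = v \<odot>\<^bsub>N\<^esub> b" "y' = v \<odot>\<^bsub>N\<^esub> b'" by blast
    then show "(x \<oplus>\<^bsub>M\<^esub> x', y \<oplus>\<^bsub>N\<^esub> y') \<in> ?G"
      using D(4)[OF h(1,2)] D(2) v by (auto simp: N.smult_r_distr intro!: exI[of _ "b \<oplus>\<^bsub>N\<^esub> b'"])
  next
    fix r x y assume "r \<in> carrier R" "(x, y) \<in> ?G"
    then obtain b where h: "(x, b) \<in> G" "y = v \<odot>\<^bsub>N\<^esub> b" "r \<in> carrier R" by blast
    then show "(r \<odot>\<^bsub>M\<^esub> x, r \<odot>\<^bsub>N\<^esub> y) \<in> ?G"
      using D(5)[OF h(3,1)] D(2) v by (auto simp: N.smult_left_comm[of r v] intro!: exI[of _ "r \<odot>\<^bsub>N\<^esub> b"])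
  next
    fix y assume "(\<zero>\<^bsub>M\<^esub>, y) \<in> ?G"
    then obtain b where "(\<zero>\<^bsub>M\<^esub>, b) \<in> G" "y = v \<odot>\<^bsub>N\<^esub> b" by blast
    moreover from this(1) have "b = \<zero>\<^bsub>N\<^esub>" by (rule D(6))
    ultimately show "y = \<zero>\<^bsub>N\<^esub>" using v by simp
  qed
qed

context localized_domain
begin

lemma is_localizedD:
  assumes "is_localized q M N"
  shows "Module.module L N" "carrier N = q ` carrier M"
    and "\<And>x. x \<in> carrier M \<Longrightarrow> q x \<in> carrier N"
    and "\<And>x y. x \<in> carrier M \<Longrightarrow> y \<in> carrier M \<Longrightarrow> q (x \<oplus>\<^bsub>M\<^esub> y) = q x \<oplus>\<^bsub>N\<^esub> q y"
    and "\<And>a x. a \<in> carrier R \<Longrightarrow> x \<in> carrier M \<Longrightarrow> q (a \<odot>\<^bsub>M\<^esub> x) = fr a \<one> \<odot>\<^bsub>N\<^esub> q x"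
    and "\<And>x y. x \<in> carrier M \<Longrightarrow> y \<in> carrier M \<Longrightarrow>
          q x = q y \<longleftrightarrow> (\<exists>u\<in>S. u \<odot>\<^bsub>M\<^esub> x = u \<odot>\<^bsub>M\<^esub> y)"
  using assms unfolding is_localized_def by blast+

lemma localized_zero:
  assumes M: "Module.module R M" and q: "is_localized q M N"
  shows "q \<zero>\<^bsub>M\<^esub> = \<zero>\<^bsub>N\<^esub>"
proof -
  interpret M: Module.module R M by fact
  interpret N: Module.module L N by (rule is_localizedD(1)[OF q])
  have "q (\<zero> \<odot>\<^bsub>M\<^esub> \<zero>\<^bsub>M\<^esub>) = fr \<zero> \<one> \<odot>\<^bsub>N\<^esub> q \<zero>\<^bsub>M\<^esub>"
    by (rule is_localizedD(5)[OF q]) auto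
  then show ?thesis using is_localizedD(3)[OF q] by (simp flip: L_zero)
qed

lemma fr_inverse: "s \<in> S \<Longrightarrow> fr \<one> s \<otimes>\<^bsub>L\<^esub> fr s \<one> = \<one>\<^bsub>L\<^esub>"
  using S_one fr_eqI[of s \<one> s \<one>] by (simp add: L_one)

lemma fr_split: "a \<in> carrier R \<Longrightarrow> s \<in> S \<Longrightarrow> fr a s = fr \<one> s \<otimes>\<^bsub>L\<^esub> fr a \<one>"
  using S_one by simp

lemma localized_smult:
  assumes M: "Module.module R M" and q: "is_localized q M N"
    and h: "a \<in> carrier R" "s \<in> S" "x \<in> carrier M" "z \<in> carrier M"
  shows "fr a s \<odot>\<^bsub>N\<^esub> q x = q z \<longleftrightarrow> (\<exists>u\<in>S. u \<odot>\<^bsub>M\<^esub> (s \<odot>\<^bsub>M\<^esub> z) = u \<odot>\<^bsub>M\<^esub> (a \<odot>\<^bsub>M\<^esub> x))"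
proof -
  interpret M: Module.module R M by fact
  interpret N: Module.module L N by (rule is_localizedD(1)[OF q])
  note D = is_localizedD[OF q]
  have fc: "fr a \<one> \<in> carrier L" "fr s \<one> \<in> carrier L" "fr \<one> s \<in> carrier L" using h S_one by auto
  have sc: "s \<in> carrier R" using h by simp
  have 1: "fr a s \<odot>\<^bsub>N\<^esub> q x = fr \<one> s \<odot>\<^bsub>N\<^esub> q (a \<odot>\<^bsub>M\<^esub> x)"
    using fr_split[OF h(1,2)] fc D(3)[OF h(3)] h by (simp add: N.smult_assoc1 D(5))
  have 2: "q z = fr \<one> s \<odot>\<^bsub>N\<^esub> q (s \<odot>\<^bsub>M\<^esub> z)"
    using fr_inverse[OF h(2)] fc D(3)[OF h(4)] h sc by (simp add: D(5) flip: N.smult_assoc1)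
  have 3: "fr s \<one> \<odot>\<^bsub>N\<^esub> (fr \<one> s \<odot>\<^bsub>N\<^esub> Y) = Y" if "Y \<in> carrier N" for Y
    using that fc fr_inverse[OF h(2)] by (simp add: N.R.m_comm[of "fr s \<one>"] flip: N.smult_assoc1)
  have "fr a s \<odot>\<^bsub>N\<^esub> q x = q z \<longleftrightarrow> q (s \<odot>\<^bsub>M\<^esub> z) = q (a \<odot>\<^bsub>M\<^esub> x)"
    using 1 2 3[of "q (a \<odot>\<^bsub>M\<^esub> x)"] 3[of "q (s \<odot>\<^bsub>M\<^esub> z)"] D(3) h sc by (metis M.smult_closed)
  also have "\<dots> \<longleftrightarrow> (\<exists>u\<in>S. u \<odot>\<^bsub>M\<^esub> (s \<odot>\<^bsub>M\<^esub> z) = u \<odot>\<^bsub>M\<^esub> (a \<odot>\<^bsub>M\<^esub> x))"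
    by (rule D(6)) (use h sc in auto)
  finally show ?thesis .
qed

lemma finite_common_multiplier:
  assumes "finite B" and "\<And>b. b \<in> B \<Longrightarrow> \<exists>v\<in>S. Q v b"
    and mult: "\<And>v w b. v \<in> S \<Longrightarrow> w \<in> S \<Longrightarrow> b \<in> B \<Longrightarrow> Q v b \<Longrightarrow> Q (w \<otimes> v) b"
  shows "\<exists>v\<in>S. \<forall>b\<in>B. Q v b"
  using assms
proof (induction B rule: finite_induct)
  case empty
  then show ?case using S_one by blast
next
  case (insert b B)
  obtain v where v: "v \<in> S" "\<forall>c\<in>B. Q v c" using insert by blast
  obtain w where w: "w \<in> S" "Q w b" using insert by blast
  have "Q (w \<otimes> v) c" if "c \<in> insert b B" for c
  proof (cases "c = b")
    case True
    then show ?thesis using insert(5)[OF w(1) v(1), of b] w v m_comm[of v w] by auto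
  next
    case False
    then show ?thesis using insert(5)[OF v(1) w(1), of c] v that by auto
  qed
  then show ?case using S_mult v w by blast
qed

text \<open>
  Induction on the generators. When \<open>x\<close> is added, choose \<open>e\<close> with \<open>q e = h x\<close>. For \<open>r x\<close> in the old
  domain, the old lift of \<open>r x\<close> and \<open>u r e\<close> agree in the localization, hence after multiplication by some
  denominator. The ideal of these \<open>r\<close> is finitely generated, so one denominator \<open>v\<close> serves for all of
  them, and \<open>v\<close> times the old lift extends by \<open>x \<mapsto> v u e\<close>.
\<close>

lemma lift_finite:
  assumes noeth: "noetherian_ring R" and M: "Module.module R M" and q: "is_localized q M N"
    and I: "ideal I R"
    and h_closed: "\<And>a. a \<in> I \<Longrightarrow> h a \<in> carrier N"
    and h_add: "\<And>a b. a \<in> I \<Longrightarrow> b \<in> I \<Longrightarrow> h (a \<oplus> b) = h a \<oplus>\<^bsub>N\<^esub> h b"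
    and h_smult: "\<And>r a. r \<in> carrier R \<Longrightarrow> a \<in> I \<Longrightarrow> h (r \<otimes> a) = fr r \<one> \<odot>\<^bsub>N\<^esub> h a"
    and A: "finite A" "A \<subseteq> I"
  shows "\<exists>u\<in>S. \<exists>G. linear_graph R (self_module R) M G \<and> A \<subseteq> Domain G \<and>
           (\<forall>(a, b)\<in>G. a \<in> I \<and> q b = fr u \<one> \<odot>\<^bsub>N\<^esub> h a)"
  using A
proof (induction A rule: finite_induct)
  case empty
  interpret M: Module.module R M by fact
  interpret N: Module.module L N by (rule is_localizedD(1)[OF q])
  interpret I: ideal I R by fact
  have "h (\<zero> \<otimes> \<zero>) = fr \<zero> \<one> \<odot>\<^bsub>N\<^esub> h \<zero>" by (rule h_smult) auto
  then have h0: "h \<zero> = \<zero>\<^bsub>N\<^esub>" using h_closed[of \<zero>] by (simp flip: L_zero)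
  have "linear_graph R (self_module R) M {(\<zero>, \<zero>\<^bsub>M\<^esub>)}"
    unfolding linear_graph_def by (auto simp: self_module_def)
  moreover have "q \<zero>\<^bsub>M\<^esub> = fr \<one> \<one> \<odot>\<^bsub>N\<^esub> h \<zero>"
    using localized_zero[OF M q] h0 S_one by simp
  ultimately show ?case using S_one by (intro bexI[of _ \<one>] exI[of _ "{(\<zero>, \<zero>\<^bsub>M\<^esub>)}"]) auto
next
  case (insert x A)
  interpret M: Module.module R M by fact
  interpret N: Module.module L N by (rule is_localizedD(1)[OF q])
  interpret I: ideal I R by fact
  interpret nr: noetherian_ring R by fact
  have SM: "Module.module R (self_module R)" by (rule self_module_module[OF is_cring])
  obtain u G where u: "u \<in> S" and G: "linear_graph R (self_module R) M G" and AG: "A \<subseteq> Domain G"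
    and GI: "\<And>a b. (a, b) \<in> G \<Longrightarrow> a \<in> I" and Gq: "\<And>a b. (a, b) \<in> G \<Longrightarrow> q b = fr u \<one> \<odot>\<^bsub>N\<^esub> h a"
    using insert by fastforce
  note GD = linear_graphD[OF G, simplified self_module_def, simplified]
  have x: "x \<in> I" "x \<in> carrier R" using insert(4) I.a_subset by auto
  have uc: "u \<in> carrier R" using u by simp
  obtain e where e: "e \<in> carrier M" "h x = q e"
    using h_closed[OF x(1)] unfolding is_localizedD(2)[OF q] by blast
  have fc: "fr u \<one> \<in> carrier L" using uc S_one by simp
  define J where "J = {r \<in> carrier R. \<exists>z. (r \<otimes> x, z) \<in> G}"
  have "ideal J R"
  proof (rule idealI')
    show "J \<subseteq> carrier R" by (auto simp: J_def)
    show "\<zero> \<in> J" using GD(3) x unfolding J_def by auto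
    show "a \<oplus> b \<in> J" if "a \<in> J" "b \<in> J" for a b
    proof -
      obtain y z where "a \<in> carrier R" "b \<in> carrier R" "(a \<otimes> x, y) \<in> G" "(b \<otimes> x, z) \<in> G"
        using \<open>a \<in> J\<close> \<open>b \<in> J\<close> unfolding J_def by blast
      then show ?thesis using GD(4)[of "a \<otimes> x" y "b \<otimes> x" z] x unfolding J_def by (auto simp: l_distr)
    qed
    show "r \<otimes> a \<in> J" if "r \<in> carrier R" "a \<in> J" for r a
    proof -
      obtain y where "a \<in> carrier R" "(a \<otimes> x, y) \<in> G" using \<open>a \<in> J\<close> unfolding J_def by blast
      then show ?thesis using GD(5)[of r "a \<otimes> x" y] x that(1) unfolding J_def by (auto simp: m_assoc)
    qed
  qed
  then obtain B where B: "B \<subseteq> carrier R" "finite B" "J = Idl B" using nr.finetely_gen by blast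
  have BJ: "B \<subseteq> J" unfolding B(3) by (rule genideal_self[OF B(1)])
  \<comment> \<open>\<open>Q v r\<close>: the denominator \<open>v\<close> removes the discrepancy between the old lift of \<open>r x\<close> and \<open>u r e\<close>.\<close>
  define Q where "Q v r \<longleftrightarrow> (\<exists>z. (r \<otimes> x, z) \<in> G \<and> v \<odot>\<^bsub>M\<^esub> z = v \<odot>\<^bsub>M\<^esub> (u \<odot>\<^bsub>M\<^esub> (r \<odot>\<^bsub>M\<^esub> e)))" for v r
  have "\<exists>v\<in>S. \<forall>b\<in>B. Q v b"
  proof (rule finite_common_multiplier[OF B(2)])
    fix b assume "b \<in> B"
    then obtain z where b: "b \<in> carrier R" and z: "(b \<otimes> x, z) \<in> G" using BJ unfolding J_def by blast
    have zc: "z \<in> carrier M" by (rule GD(2)[OF z])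
    have "q z = fr u \<one> \<odot>\<^bsub>N\<^esub> h (b \<otimes> x)" by (rule Gq[OF z])
    also have "\<dots> = q (u \<odot>\<^bsub>M\<^esub> (b \<odot>\<^bsub>M\<^esub> e))"
      using h_smult[OF b x(1)] e b uc by (simp add: is_localizedD(5)[OF q])
    finally show "\<exists>v\<in>S. Q v b"
      using is_localizedD(6)[OF q zc, of "u \<odot>\<^bsub>M\<^esub> (b \<odot>\<^bsub>M\<^esub> e)"] z uc b e unfolding Q_def by auto
  next
    fix v w b assume vw: "v \<in> S" "w \<in> S" "b \<in> B" "Q v b"
    then have b: "b \<in> carrier R" "v \<in> carrier R" "w \<in> carrier R" using B by auto
    obtain z where z: "(b \<otimes> x, z) \<in> G" "v \<odot>\<^bsub>M\<^esub> z = v \<odot>\<^bsub>M\<^esub> (u \<odot>\<^bsub>M\<^esub> (b \<odot>\<^bsub>M\<^esub> e))"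
      using vw unfolding Q_def by blast
    have "(w \<otimes> v) \<odot>\<^bsub>M\<^esub> z = (w \<otimes> v) \<odot>\<^bsub>M\<^esub> (u \<odot>\<^bsub>M\<^esub> (b \<odot>\<^bsub>M\<^esub> e))"
      using b GD(2)[OF z(1)] uc e z(2) by (simp add: M.smult_assoc1)
    then show "Q (w \<otimes> v) b" using z unfolding Q_def by blast
  qed
  then obtain v where v: "v \<in> S" and vB: "\<And>b. b \<in> B \<Longrightarrow> Q v b" by blast
  have vc: "v \<in> carrier R" using v by simp
  have "ideal {r \<in> carrier R. Q v r} R" (is "ideal ?J' R")
  proof (rule idealI')
    show "?J' \<subseteq> carrier R" by auto
    show "\<zero> \<in> ?J'" using GD(3) x e uc vc unfolding Q_def by auto
    show "a \<oplus> b \<in> ?J'" if "a \<in> ?J'" "b \<in> ?J'" for a b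
    proof -
      obtain y z where h: "a \<in> carrier R" "b \<in> carrier R" "(a \<otimes> x, y) \<in> G" "(b \<otimes> x, z) \<in> G"
        "v \<odot>\<^bsub>M\<^esub> y = v \<odot>\<^bsub>M\<^esub> (u \<odot>\<^bsub>M\<^esub> (a \<odot>\<^bsub>M\<^esub> e))" "v \<odot>\<^bsub>M\<^esub> z = v \<odot>\<^bsub>M\<^esub> (u \<odot>\<^bsub>M\<^esub> (b \<odot>\<^bsub>M\<^esub> e))"
        using \<open>a \<in> ?J'\<close> \<open>b \<in> ?J'\<close> unfolding Q_def by blast
      have "v \<odot>\<^bsub>M\<^esub> (y \<oplus>\<^bsub>M\<^esub> z) = v \<odot>\<^bsub>M\<^esub> (u \<odot>\<^bsub>M\<^esub> ((a \<oplus> b) \<odot>\<^bsub>M\<^esub> e))"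
        using h(1,2,5,6) GD(2)[OF h(3)] GD(2)[OF h(4)] vc uc e
        by (simp add: M.smult_r_distr M.smult_l_distr)
      then show ?thesis using GD(4)[OF h(3,4)] h(1,2) x unfolding Q_def by (auto simp: l_distr)
    qed
    show "r \<otimes> a \<in> ?J'" if r: "r \<in> carrier R" and "a \<in> ?J'" for r a
    proof -
      obtain y where h: "a \<in> carrier R" "(a \<otimes> x, y) \<in> G"
        "v \<odot>\<^bsub>M\<^esub> y = v \<odot>\<^bsub>M\<^esub> (u \<odot>\<^bsub>M\<^esub> (a \<odot>\<^bsub>M\<^esub> e))"
        using \<open>a \<in> ?J'\<close> unfolding Q_def by blast
      have "v \<odot>\<^bsub>M\<^esub> (r \<odot>\<^bsub>M\<^esub> y) = r \<odot>\<^bsub>M\<^esub> (v \<odot>\<^bsub>M\<^esub> y)"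
        using GD(2)[OF h(2)] vc r by (simp add: M.smult_left_comm)
      also have "\<dots> = v \<odot>\<^bsub>M\<^esub> (u \<odot>\<^bsub>M\<^esub> ((r \<otimes> a) \<odot>\<^bsub>M\<^esub> e))"
        unfolding h(3) using h(1) vc uc r e by (simp add: M.smult_assoc1 M.smult_left_comm)
      finally show ?thesis using GD(5)[OF r h(2)] h(1) x r unfolding Q_def by (auto simp: m_assoc)
    qed
  qed
  then have JQ: "J \<subseteq> ?J'" unfolding B(3) by (rule genideal_minimal) (use B(1) vB in auto)
  define G1 where "G1 = {(a, v \<odot>\<^bsub>M\<^esub> b) | a b. (a, b) \<in> G}"
  have G1: "linear_graph R (self_module R) M G1"
    unfolding G1_def by (rule linear_graph_smult[OF SM M G vc])
  define e' where "e' = v \<odot>\<^bsub>M\<^esub> (u \<odot>\<^bsub>M\<^esub> e)"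
  have e': "e' \<in> carrier M" using e uc vc unfolding e'_def by simp
  have compat: "z = r \<odot>\<^bsub>M\<^esub> e'" if r: "r \<in> carrier R" and "(r \<odot>\<^bsub>self_module R\<^esub> x, z) \<in> G1" for r z
  proof -
    obtain b where b: "(r \<otimes> x, b) \<in> G" "z = v \<odot>\<^bsub>M\<^esub> b"
      using \<open>(r \<odot>\<^bsub>self_module R\<^esub> x, z) \<in> G1\<close> unfolding G1_def by (auto simp: self_module_def)
    then have "r \<in> J" using r unfolding J_def by blast
    then obtain z' where z': "(r \<otimes> x, z') \<in> G" "v \<odot>\<^bsub>M\<^esub> z' = v \<odot>\<^bsub>M\<^esub> (u \<odot>\<^bsub>M\<^esub> (r \<odot>\<^bsub>M\<^esub> e))"
      using JQ unfolding Q_def by blast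
    have "z' = b" by (rule linear_graph_unique[OF SM M G z'(1) b(1)])
    then show ?thesis using z'(2) b(2) r uc vc e unfolding e'_def by (simp add: M.smult_left_comm)
  qed
  have xs: "x \<in> carrier (self_module R)" using x by (simp add: self_module_def)
  obtain G2 where G2: "linear_graph R (self_module R) M G2" "G1 \<subseteq> G2" "(x, e') \<in> G2"
    and G2E: "\<And>a b. (a, b) \<in> G2 \<Longrightarrow> \<exists>a' b' r. (a', b') \<in> G1 \<and> r \<in> carrier R \<and>
           a = a' \<oplus>\<^bsub>self_module R\<^esub> r \<odot>\<^bsub>self_module R\<^esub> x \<and> b = b' \<oplus>\<^bsub>M\<^esub> r \<odot>\<^bsub>M\<^esub> e'"
    by (rule linear_graph_extend[OF SM M G1 xs e' compat]) blast+
  have vu: "v \<otimes> u \<in> S" by (rule S_mult[OF v u])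
  have frvu: "fr (v \<otimes> u) \<one> = fr v \<one> \<otimes>\<^bsub>L\<^esub> fr u \<one>" using vc uc S_one by simp
  have "a \<in> I \<and> q b = fr (v \<otimes> u) \<one> \<odot>\<^bsub>N\<^esub> h a" if ab: "(a, b) \<in> G2" for a b
  proof -
    obtain a' b' r where k: "(a', b') \<in> G" "r \<in> carrier R" "a = a' \<oplus> r \<otimes> x"
      "b = v \<odot>\<^bsub>M\<^esub> b' \<oplus>\<^bsub>M\<^esub> r \<odot>\<^bsub>M\<^esub> e'"
      using G2E[OF ab] unfolding G1_def by (auto simp: self_module_def)
    have a'I: "a' \<in> I" by (rule GI[OF k(1)])
    have b'M: "b' \<in> carrier M" by (rule GD(2)[OF k(1)])
    have rx: "r \<otimes> x \<in> I" using I.I_l_closed[OF x(1) k(2)] .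
    have hc: "h a' \<in> carrier N" "h x \<in> carrier N" using h_closed a'I x by auto
    have fcs: "fr v \<one> \<in> carrier L" "fr u \<one> \<in> carrier L" "fr r \<one> \<in> carrier L" using vc uc k(2) S_one by auto
    have "q b = fr v \<one> \<odot>\<^bsub>N\<^esub> q b' \<oplus>\<^bsub>N\<^esub> fr r \<one> \<odot>\<^bsub>N\<^esub> (fr v \<one> \<odot>\<^bsub>N\<^esub> (fr u \<one> \<odot>\<^bsub>N\<^esub> q e))"
      using k b'M e e' vc uc by (simp add: is_localizedD(4,5)[OF q] e'_def)
    also have "\<dots> = (fr v \<one> \<otimes>\<^bsub>L\<^esub> fr u \<one>) \<odot>\<^bsub>N\<^esub> (h a' \<oplus>\<^bsub>N\<^esub> fr r \<one> \<odot>\<^bsub>N\<^esub> h x)"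
      using Gq[OF k(1)] hc fcs
      by (simp add: e(2)[symmetric] N.smult_assoc1 N.smult_r_distr N.smult_left_comm)
    also have "h a' \<oplus>\<^bsub>N\<^esub> fr r \<one> \<odot>\<^bsub>N\<^esub> h x = h a" using k(3) h_add[OF a'I rx] h_smult[OF k(2) x(1)] by simp
    finally show ?thesis using frvu k(3) I.a_closed[OF a'I rx] by simp
  qed
  moreover have "insert x A \<subseteq> Domain G2" using AG G2(2,3) unfolding G1_def by blast
  ultimately show ?case using G2(1) vu by (intro bexI[of _ "v \<otimes> u"] exI[of _ G2]) auto
qed


text \<open>
  The homomorphism from an ideal of the localization is determined by its values on fractions \<open>a/1\<close>.
  These values lift, up to a denominator \<open>u\<close>, to a homomorphism from an ideal of \<open>R\<close> into \<open>M\<close>, which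
  is multiplication by some \<open>e\<close>; then \<open>f\<close> is multiplication by \<open>(1/u) q e\<close>.
\<close>

lemma baer_localized:
  assumes noeth: "noetherian_ring R" and M: "Module.module R M" and B: "baer R M"
    and q: "is_localized q M N"
  shows "baer L N"
  unfolding baer_def
proof (intro allI impI, elim conjE)
  fix J f assume J: "ideal J L" and f: "f \<in> module_hom L ((self_module L)\<lparr>carrier := J\<rparr>) N"
  interpret M: Module.module R M by fact
  interpret N: Module.module L N by (rule is_localizedD(1)[OF q])
  interpret J: ideal J L by fact
  interpret nr: noetherian_ring R by fact
  have SM: "Module.module R (self_module R)" by (rule self_module_module[OF is_cring])
  note fD = module_homD[OF f, simplified self_module_def, simplified]
  have one: "\<one> \<in> S" by (rule S_one)
  define I where "I = {a \<in> carrier R. fr a \<one> \<in> J}"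
  define h where "h a = f (fr a \<one>)" for a
  have fr_add: "fr (a \<oplus> b) \<one> = fr a \<one> \<oplus>\<^bsub>L\<^esub> fr b \<one>" if "a \<in> carrier R" "b \<in> carrier R" for a b
    using that one by simp
  have fr_mult: "fr (a \<otimes> b) \<one> = fr a \<one> \<otimes>\<^bsub>L\<^esub> fr b \<one>" if "a \<in> carrier R" "b \<in> carrier R" for a b
    using that one by simp
  have I: "ideal I R"
  proof (rule idealI')
    show "I \<subseteq> carrier R" unfolding I_def by auto
    show "\<zero> \<in> I" using J.zero_closed unfolding I_def L_zero by simp
    show "a \<oplus> b \<in> I" if "a \<in> I" "b \<in> I" for a b
      using that J.a_closed[of "fr a \<one>" "fr b \<one>"] unfolding I_def by (simp add: fr_add del: L_add)
    show "r \<otimes> a \<in> I" if "r \<in> carrier R" "a \<in> I" for r a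
      using that J.I_l_closed[of "fr a \<one>" "fr r \<one>"] one unfolding I_def by (simp add: fr_mult del: L_mult)
  qed
  have h_closed: "h a \<in> carrier N" if "a \<in> I" for a
    using that fD(1) unfolding I_def h_def by simp
  have h_add: "h (a \<oplus> b) = h a \<oplus>\<^bsub>N\<^esub> h b" if "a \<in> I" "b \<in> I" for a b
    using that fD(2)[of "fr a \<one>" "fr b \<one>"] unfolding I_def h_def by (simp add: fr_add del: L_add)
  have h_smult: "h (r \<otimes> a) = fr r \<one> \<odot>\<^bsub>N\<^esub> h a" if "r \<in> carrier R" "a \<in> I" for r a
    using that fD(3)[of "fr r \<one>" "fr a \<one>"] one unfolding I_def h_def by (simp add: fr_mult del: L_mult)
  obtain A where A: "A \<subseteq> carrier R" "finite A" "I = Idl A" using nr.finetely_gen[OF I] by blast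
  have AI: "A \<subseteq> I" unfolding A(3) by (rule genideal_self[OF A(1)])
  from lift_finite[OF noeth M q I h_closed h_add h_smult A(2) AI]
  obtain u G where u: "u \<in> S" and G: "linear_graph R (self_module R) M G" and AG: "A \<subseteq> Domain G"
    and Gq: "\<forall>(a, b)\<in>G. a \<in> I \<and> q b = fr u \<one> \<odot>\<^bsub>N\<^esub> h a" by blast
  note GD = linear_graphD[OF G, simplified self_module_def, simplified]
  have uc: "u \<in> carrier R" using u by simp
  have "ideal (Domain G) R"
  proof (rule idealI')
    show "Domain G \<subseteq> carrier R" using GD(1) by blast
    show "\<zero> \<in> Domain G" using GD(3) by blast
    show "a \<oplus> b \<in> Domain G" if "a \<in> Domain G" "b \<in> Domain G" for a b
      using \<open>a \<in> Domain G\<close> \<open>b \<in> Domain G\<close> GD(4) by blast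
    show "r \<otimes> a \<in> Domain G" if "r \<in> carrier R" "a \<in> Domain G" for r a
      using \<open>r \<in> carrier R\<close> \<open>a \<in> Domain G\<close> GD(5) by blast
  qed
  then have IG: "I \<subseteq> Domain G" unfolding A(3) by (rule genideal_minimal[OF _ AG])
  define g where "g a = (THE b. (a, b) \<in> G)" for a
  have g_eq: "g a = b" if "(a, b) \<in> G" for a b
    unfolding g_def by (rule the_equality, rule that, rule linear_graph_unique[OF SM M G _ that])
  have g_mem: "(a, g a) \<in> G" if a: "a \<in> I" for a
  proof -
    obtain b where "(a, b) \<in> G" using a IG by blast
    then show ?thesis using g_eq by simp
  qed
  have "g \<in> module_hom R ((self_module R)\<lparr>carrier := I\<rparr>) M"
    unfolding module_hom_def
  proof (intro CollectI conjI ballI)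
    show "g \<in> carrier ((self_module R)\<lparr>carrier := I\<rparr>) \<rightarrow> carrier M"
      using g_mem GD(2) by (intro Pi_I) auto
  next
    fix a b assume "a \<in> carrier ((self_module R)\<lparr>carrier := I\<rparr>)" "b \<in> carrier ((self_module R)\<lparr>carrier := I\<rparr>)"
    then have "(a \<oplus> b, g a \<oplus>\<^bsub>M\<^esub> g b) \<in> G" by (intro GD(4) g_mem) auto
    then show "g (a \<oplus>\<^bsub>(self_module R)\<lparr>carrier := I\<rparr>\<^esub> b) = g a \<oplus>\<^bsub>M\<^esub> g b"
      using g_eq by (simp add: self_module_def)
  next
    fix r b assume "r \<in> carrier R" "b \<in> carrier ((self_module R)\<lparr>carrier := I\<rparr>)"
    then have "(r \<otimes> b, r \<odot>\<^bsub>M\<^esub> g b) \<in> G" by (intro GD(5) g_mem) auto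
    then show "g (r \<odot>\<^bsub>(self_module R)\<lparr>carrier := I\<rparr>\<^esub> b) = r \<odot>\<^bsub>M\<^esub> g b"
      using g_eq by (simp add: self_module_def)
  qed
  from B[unfolded baer_def, rule_format, OF conjI[OF I this]]
  obtain e where e: "e \<in> carrier M" "\<forall>c\<in>I. g c = c \<odot>\<^bsub>M\<^esub> e" by blast
  have qe: "q e \<in> carrier N" by (rule is_localizedD(3)[OF q e(1)])
  have fru: "fr \<one> u \<in> carrier L" "fr u \<one> \<in> carrier L" using u one by auto
  define z where "z = fr \<one> u \<odot>\<^bsub>N\<^esub> q e"
  have z: "z \<in> carrier N" using fru qe unfolding z_def by simp
  have hz: "h a = fr a \<one> \<odot>\<^bsub>N\<^esub> z" if a: "a \<in> I" for a
  proof -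
    have ac: "a \<in> carrier R" "fr a \<one> \<in> carrier L" using a one unfolding I_def by auto
    have "fr a \<one> \<odot>\<^bsub>N\<^esub> q e = q (g a)" using e a ac by (simp add: is_localizedD(5)[OF q])
    also have "\<dots> = fr u \<one> \<odot>\<^bsub>N\<^esub> h a" using Gq g_mem[OF a] by blast
    finally have *: "fr a \<one> \<odot>\<^bsub>N\<^esub> q e = fr u \<one> \<odot>\<^bsub>N\<^esub> h a" .
    have "fr a \<one> \<odot>\<^bsub>N\<^esub> z = fr \<one> u \<odot>\<^bsub>N\<^esub> (fr a \<one> \<odot>\<^bsub>N\<^esub> q e)"
      unfolding z_def using ac fru qe by (simp add: N.smult_left_comm)
    also have "\<dots> = h a" unfolding * using fru h_closed[OF a] fr_inverse[OF u]
      by (simp flip: N.smult_assoc1)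
    finally show ?thesis by simp
  qed
  show "\<exists>e\<in>carrier N. \<forall>c\<in>J. f c = c \<odot>\<^bsub>N\<^esub> e"
  proof (rule bexI[OF _ z], rule ballI)
    fix c assume c: "c \<in> J"
    then obtain a s where as: "a \<in> carrier R" "s \<in> S" "c = fr a s"
      using J.a_subset L_carrierE by blast
    have frs: "fr s \<one> \<in> carrier L" "fr \<one> s \<in> carrier L" "fr a \<one> \<in> carrier L" using as one by auto
    have "fr s \<one> \<otimes>\<^bsub>L\<^esub> c = fr (s \<otimes> a) (\<one> \<otimes> s)"
      unfolding as(3) using as one by (intro L_mult) auto
    also have "\<dots> = fr a \<one>"
      by (rule fr_eqI) (use as one in \<open>auto simp: m_comm\<close>)
    finally have "fr s \<one> \<otimes>\<^bsub>L\<^esub> c = fr a \<one>" .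
    then have frJ: "fr a \<one> \<in> J" using J.I_l_closed[OF c frs(1)] by simp
    then have aI: "a \<in> I" using as unfolding I_def by simp
    have ce: "c = fr \<one> s \<otimes>\<^bsub>L\<^esub> fr a \<one>" unfolding as(3) by (rule fr_split[OF as(1,2)])
    have "f c = fr \<one> s \<odot>\<^bsub>N\<^esub> h a" unfolding ce h_def by (rule fD(3)[OF frs(2) frJ])
    also have "\<dots> = c \<odot>\<^bsub>N\<^esub> z" unfolding hz[OF aI] ce using frs z by (simp add: N.smult_assoc1)
    finally show "f c = c \<odot>\<^bsub>N\<^esub> z" .
  qed
qed

lemma localized_eq_zero:
  assumes M: "Module.module R M" and q: "is_localized q M N" and x: "x \<in> carrier M"
  shows "q x = \<zero>\<^bsub>N\<^esub> \<longleftrightarrow> (\<exists>u\<in>S. u \<odot>\<^bsub>M\<^esub> x = \<zero>\<^bsub>M\<^esub>)"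
proof -
  interpret M: Module.module R M by fact
  show ?thesis
    unfolding localized_zero[OF M q, symmetric] is_localizedD(6)[OF q x M.zero_closed] by simp
qed

lemma localized_unscale:
  assumes M: "Module.module R M" and q: "is_localized q M N" and x: "x \<in> carrier M" and u: "u \<in> S"
  shows "q x = fr \<one> u \<odot>\<^bsub>N\<^esub> q (u \<odot>\<^bsub>M\<^esub> x)"
proof -
  interpret N: Module.module L N by (rule is_localizedD(1)[OF q])
  show ?thesis
    using is_localizedD(3,5)[OF q] x u S_one fr_inverse[OF u] by (simp flip: N.smult_assoc1)
qed

lemma localized_hom:
  assumes M: "Module.module R M" and M': "Module.module R M'"
    and q: "is_localized q M N" and q': "is_localized q' M' N'" and f: "f \<in> module_hom R M M'"
  shows "\<exists>g\<in>module_hom L N N'. \<forall>x\<in>carrier M. g (q x) = q' (f x)"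
proof -
  interpret M: Module.module R M by fact
  interpret M': Module.module R M' by fact
  interpret N: Module.module L N by (rule is_localizedD(1)[OF q])
  interpret N': Module.module L N' by (rule is_localizedD(1)[OF q'])
  note D = is_localizedD[OF q] and D' = is_localizedD[OF q'] and f = module_homD[OF f]
  define g where "g X = q' (f (inv_into (carrier M) q X))" for X
  have g: "g (q x) = q' (f x)" if x: "x \<in> carrier M" for x
  proof -
    let ?y = "inv_into (carrier M) q (q x)"
    have y: "?y \<in> carrier M" "q ?y = q x" using x by (auto intro: inv_into_into f_inv_into_f)
    then obtain u where u: "u \<in> S" "u \<odot>\<^bsub>M\<^esub> ?y = u \<odot>\<^bsub>M\<^esub> x" using D(6)[OF y(1) x] by blast
    have uc: "u \<in> carrier R" using u by simp
    have "u \<odot>\<^bsub>M'\<^esub> f ?y = u \<odot>\<^bsub>M'\<^esub> f x" using u(2) f(3)[OF uc y(1)] f(3)[OF uc x] by simp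
    then show ?thesis unfolding g_def using D'(6)[OF f(1)[OF y(1)] f(1)[OF x]] u(1) by blast
  qed
  have "g \<in> module_hom L N N'"
    unfolding module_hom_def
  proof (intro CollectI conjI ballI)
    show "g \<in> carrier N \<rightarrow> carrier N'" unfolding D(2) using g D'(3) f(1) by auto
  next
    fix X Y assume "X \<in> carrier N" "Y \<in> carrier N"
    then obtain x y where h: "x \<in> carrier M" "y \<in> carrier M" "X = q x" "Y = q y" unfolding D(2) by blast
    then show "g (X \<oplus>\<^bsub>N\<^esub> Y) = g X \<oplus>\<^bsub>N'\<^esub> g Y" using f(1,2) by (simp add: g flip: D(4)) (simp add: D'(4))
  next
    fix C X assume C: "C \<in> carrier L" and X: "X \<in> carrier N"
    obtain a s where as: "a \<in> carrier R" "s \<in> S" "C = fr a s" using C L_carrierE by blast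
    obtain x where x: "x \<in> carrier M" "X = q x" using X unfolding D(2) by blast
    have "C \<odot>\<^bsub>N\<^esub> X \<in> carrier N" using C X by simp
    then obtain z where z: "z \<in> carrier M" "C \<odot>\<^bsub>N\<^esub> X = q z" unfolding D(2) by blast
    then obtain u where u: "u \<in> S" "u \<odot>\<^bsub>M\<^esub> (s \<odot>\<^bsub>M\<^esub> z) = u \<odot>\<^bsub>M\<^esub> (a \<odot>\<^bsub>M\<^esub> x)"
      using localized_smult[OF M q as(1,2) x(1) z(1)] as(3) x(2) by blast
    have c: "u \<in> carrier R" "s \<in> carrier R" using u as by auto
    have "f (u \<odot>\<^bsub>M\<^esub> (s \<odot>\<^bsub>M\<^esub> z)) = f (u \<odot>\<^bsub>M\<^esub> (a \<odot>\<^bsub>M\<^esub> x))" using u(2) by simp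
    then have "u \<odot>\<^bsub>M'\<^esub> (s \<odot>\<^bsub>M'\<^esub> f z) = u \<odot>\<^bsub>M'\<^esub> (a \<odot>\<^bsub>M'\<^esub> f x)" using c as x z by (simp add: f(3))
    then have "fr a s \<odot>\<^bsub>N'\<^esub> q' (f x) = q' (f z)"
      using localized_smult[OF M' q' as(1,2) f(1)[OF x(1)] f(1)[OF z(1)]] u(1) by blast
    then show "g (C \<odot>\<^bsub>N\<^esub> X) = C \<odot>\<^bsub>N'\<^esub> g X" using z x as by (simp add: g)
  qed
  then show ?thesis using g by blast
qed

lemma localized_exact:
  assumes M: "Module.module R M" and M': "Module.module R M'" and M'': "Module.module R M''"
    and q: "is_localized q M N" and q': "is_localized q' M' N'" and q'': "is_localized q'' M'' N''"
    and f: "f \<in> module_hom R M M'" and f': "f' \<in> module_hom R M' M''"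
    and exact: "f ` carrier M = module_ker M' M'' f'"
    and g: "g \<in> module_hom L N N'" "\<And>x. x \<in> carrier M \<Longrightarrow> g (q x) = q' (f x)"
    and g': "g' \<in> module_hom L N' N''" "\<And>x. x \<in> carrier M' \<Longrightarrow> g' (q' x) = q'' (f' x)"
  shows "g ` carrier N = module_ker N' N'' g'"
proof (intro equalityI subsetI)
  fix Y assume "Y \<in> g ` carrier N"
  then obtain x where x: "x \<in> carrier M" "Y = q' (f x)" using g(2) is_localizedD(2)[OF q] by auto
  have fx: "f x \<in> carrier M'" "f' (f x) = \<zero>\<^bsub>M''\<^esub>" using exact x(1) unfolding module_ker_def by auto
  then show "Y \<in> module_ker N' N'' g'"
    using x g'(2) is_localizedD(3)[OF q'] localized_zero[OF M'' q''] unfolding module_ker_def by simp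
next
  fix Y assume "Y \<in> module_ker N' N'' g'"
  then obtain y where y: "y \<in> carrier M'" "Y = q' y" "q'' (f' y) = \<zero>\<^bsub>N''\<^esub>"
    using is_localizedD(2)[OF q'] g'(2) unfolding module_ker_def by auto
  interpret M': Module.module R M' by fact
  obtain u where u: "u \<in> S" "u \<odot>\<^bsub>M''\<^esub> f' y = \<zero>\<^bsub>M''\<^esub>"
    using localized_eq_zero[OF M'' q'' module_homD(1)[OF f' y(1)]] y(3) by blast
  have uc: "u \<in> carrier R" using u by simp
  have "u \<odot>\<^bsub>M'\<^esub> y \<in> module_ker M' M'' f'"
    using u(2) module_homD(3)[OF f' uc y(1)] uc y(1) unfolding module_ker_def by simp
  then obtain x where x: "x \<in> carrier M" "u \<odot>\<^bsub>M'\<^esub> y = f x" unfolding exact[symmetric] by blast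
  have "Y = fr \<one> u \<odot>\<^bsub>N'\<^esub> q' (f x)" unfolding y(2) x(2)[symmetric] by (rule localized_unscale[OF M' q' y(1) u(1)])
  also have "\<dots> = g (fr \<one> u \<odot>\<^bsub>N\<^esub> q x)"
    using module_homD(3)[OF g(1), of "fr \<one> u" "q x"] u(1) is_localizedD(3)[OF q x(1)] g(2)[OF x(1)] by simp
  finally show "Y \<in> g ` carrier N"
    using Module.module.smult_closed[OF is_localizedD(1)[OF q], of "fr \<one> u" "q x"] u(1)
      is_localizedD(3)[OF q x(1)] by auto
qed

text \<open>
  The ring itself is in general not divisible by the denominators, so the augmentation is not an
  instance of \<open>localized_hom\<close>. It is given by the image of \<open>\<one>\<close> instead, as \<open>C \<mapsto> C \<cdot> q (\<epsilon> \<one>)\<close>.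
\<close>

theorem finite_injective_dimension_localization:
  fixes E :: "nat \<Rightarrow> ('a, 'e) module" and enc :: "'e \<Rightarrow> (nat \<times> ('a \<times> 'a) set) set"
  assumes noeth: "noetherian_ring R"
    and E: "\<And>i. Module.module R (E i)" and B: "\<And>i. baer R (E i)"
    and enc: "\<And>i. inj_on enc (carrier (E i))"
    and \<epsilon>: "\<epsilon> \<in> module_hom R (self_module R) (E 0)" and d: "\<And>i. d i \<in> module_hom R (E i) (E (Suc i))"
    and inj: "inj_on \<epsilon> (carrier R)" and ex0: "\<epsilon> ` carrier R = module_ker (E 0) (E 1) (d 0)"
    and ex: "\<And>i. d i ` carrier (E i) = module_ker (E (Suc i)) (E (Suc (Suc i))) (d (Suc i))"
    and zero: "\<And>i. i > n \<Longrightarrow> carrier (E i) = {\<zero>\<^bsub>E i\<^esub>}"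
  shows "finite_injective_dimension L (self_module L)"
proof -
  have "\<exists>q (N :: (('a \<times> 'a) set, (nat \<times> ('a \<times> 'a) set) set) module). is_localized q (E i) N" for i
    by (rule exists_localized[OF E _ enc])
      (use baer_divisible[OF domain_axioms E B] S_carr S_nonzero in blast)
  then obtain q and N :: "nat \<Rightarrow> (('a \<times> 'a) set, (nat \<times> ('a \<times> 'a) set) set) module"
    where q: "\<And>i. is_localized (q i) (E i) (N i)" by metis
  have "\<exists>g\<in>module_hom L (N i) (N (Suc i)). \<forall>x\<in>carrier (E i). g (q i x) = q (Suc i) (d i x)" for i
    by (rule localized_hom[OF E E q q d])
  then obtain g where g: "\<And>i. g i \<in> module_hom L (N i) (N (Suc i))"
    and gq: "\<And>i x. x \<in> carrier (E i) \<Longrightarrow> g i (q i x) = q (Suc i) (d i x)" by metis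
  have N: "Module.module L (N i)" for i by (rule is_localizedD(1)[OF q])
  have inj_mod: "injective_module L (N i)" for i
    unfolding injective_module_def
    using N baer_extend[OF N baer_localized[OF noeth E B q]] by blast
  interpret N0: Module.module L "N 0" by (rule N)
  interpret N1: Module.module L "N (Suc 0)" by (rule N)
  interpret E0: Module.module R "E 0" by (rule E)
  interpret E1: Module.module R "E (Suc 0)" by (rule E)
  note \<epsilon>D = module_homD[OF \<epsilon>, simplified self_module_def, simplified]
  note D0 = is_localizedD[OF q[of 0]]
  define e where "e = \<epsilon> \<one>"
  have e: "e \<in> carrier (E 0)" unfolding e_def by (rule \<epsilon>D(1)) simp
  have \<epsilon>e: "\<epsilon> a = a \<odot>\<^bsub>E 0\<^esub> e" if "a \<in> carrier R" for a
    using \<epsilon>D(3)[OF that one_closed] that unfolding e_def by simp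
  define Q where "Q = q 0 e"
  have Q: "Q \<in> carrier (N 0)" unfolding Q_def by (rule D0(3)[OF e])
  define \<eta> where "\<eta> C = C \<odot>\<^bsub>N 0\<^esub> Q" for C
  have \<eta>: "\<eta> \<in> module_hom L (self_module L) (N 0)"
    unfolding module_hom_def \<eta>_def
    using Q by (auto simp: self_module_def N0.smult_l_distr N0.smult_assoc1)
  have \<eta>_fr: "\<eta> (fr a s) = fr \<one> s \<odot>\<^bsub>N 0\<^esub> q 0 (\<epsilon> a)" if "a \<in> carrier R" "s \<in> S" for a s
  proof -
    have "\<eta> (fr a s) = (fr \<one> s \<otimes>\<^bsub>L\<^esub> fr a \<one>) \<odot>\<^bsub>N 0\<^esub> Q" unfolding \<eta>_def fr_split[OF that] ..
    also have "\<dots> = fr \<one> s \<odot>\<^bsub>N 0\<^esub> (fr a \<one> \<odot>\<^bsub>N 0\<^esub> Q)"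
      by (rule N0.smult_assoc1) (use that S_one Q in auto)
    also have "fr a \<one> \<odot>\<^bsub>N 0\<^esub> Q = q 0 (\<epsilon> a)" using that e by (simp add: \<epsilon>e D0(5) Q_def)
    finally show ?thesis .
  qed
  have \<eta>_zero: "C = \<zero>\<^bsub>L\<^esub>" if C: "C \<in> carrier L" and "\<eta> C = \<zero>\<^bsub>N 0\<^esub>" for C
  proof -
    obtain a s where as: "a \<in> carrier R" "s \<in> S" "C = fr a s" using C L_carrierE by blast
    have qa: "q 0 (\<epsilon> a) \<in> carrier (N 0)" using D0(3) \<epsilon>D(1) as by simp
    have "fr \<one> s \<odot>\<^bsub>N 0\<^esub> q 0 (\<epsilon> a) = \<zero>\<^bsub>N 0\<^esub>" using \<eta>_fr[OF as(1,2)] \<open>\<eta> C = \<zero>\<^bsub>N 0\<^esub>\<close> as(3) by simp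
    then have "fr s \<one> \<odot>\<^bsub>N 0\<^esub> (fr \<one> s \<odot>\<^bsub>N 0\<^esub> q 0 (\<epsilon> a)) = \<zero>\<^bsub>N 0\<^esub>"
      using as S_one by simp
    then have "q 0 (\<epsilon> a) = \<zero>\<^bsub>N 0\<^esub>"
      using as S_one qa fr_inverse[OF as(2)] N0.smult_left_comm[of "fr s \<one>" "fr \<one> s" "q 0 (\<epsilon> a)"]
      by (simp flip: N0.smult_assoc1)
    then obtain u where u: "u \<in> S" "u \<odot>\<^bsub>E 0\<^esub> \<epsilon> a = \<zero>\<^bsub>E 0\<^esub>"
      using localized_eq_zero[OF E q \<epsilon>D(1)[OF as(1)]] by blast
    have uc: "u \<in> carrier R" using u by simp
    have "\<epsilon> (u \<otimes> a) = \<epsilon> \<zero>" using \<epsilon>D(3)[OF uc as(1)] u(2) \<epsilon>e[of \<zero>] e by simp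
    then have "u \<otimes> a = \<zero>" using inj uc as(1) by (auto dest: inj_onD)
    then have "a = \<zero>" using integral[of u a] S_nonzero[OF u(1)] uc as(1) by blast
    then show ?thesis unfolding as(3) L_zero using as S_one by (intro fr_eqI) auto
  qed
  have \<eta>_inj: "inj_on \<eta> (carrier L)"
  proof (rule inj_onI)
    fix C D assume h: "C \<in> carrier L" "D \<in> carrier L" "\<eta> C = \<eta> D"
    have "\<eta> (C \<oplus>\<^bsub>L\<^esub> \<ominus>\<^bsub>L\<^esub> D) = \<zero>\<^bsub>N 0\<^esub>"
      using h Q unfolding \<eta>_def by (simp add: N0.smult_l_distr N0.smult_l_minus N0.M.r_neg)
    then have "C \<oplus>\<^bsub>L\<^esub> \<ominus>\<^bsub>L\<^esub> D = \<zero>\<^bsub>L\<^esub>" using h by (intro \<eta>_zero) auto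
    then show "C = D" using h by (metis N0.R.a_inv_closed N0.R.minus_equality N0.R.minus_minus)
  qed
  have \<eta>_ex: "\<eta> ` carrier L = module_ker (N 0) (N 1) (g 0)"
  proof (intro equalityI subsetI)
    fix Y assume "Y \<in> \<eta> ` carrier L"
    then obtain C where C: "C \<in> carrier L" "Y = \<eta> C" by blast
    have "e \<in> module_ker (E 0) (E 1) (d 0)" unfolding ex0[symmetric] e_def by auto
    then have "d 0 e = \<zero>\<^bsub>E (Suc 0)\<^esub>" unfolding module_ker_def by simp
    then have "g 0 Q = \<zero>\<^bsub>N (Suc 0)\<^esub>" unfolding Q_def gq[OF e] by (simp add: localized_zero[OF E q])
    then show "Y \<in> module_ker (N 0) (N 1) (g 0)"
      using C Q module_homD(3)[OF g[of 0] C(1) Q] unfolding module_ker_def \<eta>_def by simp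
  next
    fix Y assume "Y \<in> module_ker (N 0) (N 1) (g 0)"
    then obtain y where y: "y \<in> carrier (E 0)" "Y = q 0 y" "q (Suc 0) (d 0 y) = \<zero>\<^bsub>N (Suc 0)\<^esub>"
      using D0(2) gq[of _ 0] unfolding module_ker_def by auto
    obtain u where u: "u \<in> S" "u \<odot>\<^bsub>E (Suc 0)\<^esub> d 0 y = \<zero>\<^bsub>E (Suc 0)\<^esub>"
      using localized_eq_zero[OF E q module_homD(1)[OF d y(1)]] y(3) by blast
    have uc: "u \<in> carrier R" using u by simp
    have "u \<odot>\<^bsub>E 0\<^esub> y \<in> module_ker (E 0) (E 1) (d 0)"
      using u(2) module_homD(3)[OF d[of 0] uc y(1)] uc y(1) unfolding module_ker_def by simp
    then obtain a where a: "a \<in> carrier R" "u \<odot>\<^bsub>E 0\<^esub> y = \<epsilon> a" unfolding ex0[symmetric] by blast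
    have "Y = \<eta> (fr a u)" unfolding y(2) \<eta>_fr[OF a(1) u(1)] a(2)[symmetric]
      by (rule localized_unscale[OF E q y(1) u(1)])
    then show "Y \<in> \<eta> ` carrier L" using a u by auto
  qed
  have "injective_resolution L (self_module L) \<eta> N g"
    unfolding injective_resolution_def
    using inj_mod \<eta> g \<eta>_inj \<eta>_ex localized_exact[OF E E E q q q d d ex g gq g gq]
    by (simp add: self_module_def)
  moreover have "carrier (N i) = {\<zero>\<^bsub>N i\<^esub>}" if "i > n" for i
    using is_localizedD(2)[OF q[of i]] zero[OF that] localized_zero[OF E q, of i] by simp
  ultimately show ?thesis unfolding finite_injective_dimension_def by blast
qed

end

section \<open>Semigroup rings are Noetherian domains\<close>

text \<open>
  The lexicographic order is a monomial order on pairs of exponents; it is what makes semigroup rings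
  in two variables domains and allows leading monomials.
\<close>

instance prod :: (ordered_cancel_comm_monoid_add, ordered_cancel_comm_monoid_add) ordered_cancel_comm_monoid_add
  by standard (auto simp: less_eq_prod_def intro: add_strict_left_mono add_left_mono)

locale submonoid_add =
  fixes S :: "'s::comm_monoid_add set"
  assumes zero_mem [simp]: "0 \<in> S" and add_mem [simp]: "x \<in> S \<Longrightarrow> y \<in> S \<Longrightarrow> x + y \<in> S"

lemma semigroup_ring_simps [simp]:
  "\<zero>\<^bsub>semigroup_ring S\<^esub> = 0" "\<one>\<^bsub>semigroup_ring S\<^esub> = 1"
  "p \<oplus>\<^bsub>semigroup_ring S\<^esub> q = p + q" "p \<otimes>\<^bsub>semigroup_ring S\<^esub> q = p * q"
  by (simp_all add: semigroup_ring_def)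

lemma semigroup_ring_carrier: "p \<in> carrier (semigroup_ring S) \<longleftrightarrow> Poly_Mapping.keys p \<subseteq> S"
  by (simp add: semigroup_ring_def)

context submonoid_add
begin

lemma carrier_zero [simp]: "(0 :: 's \<Rightarrow>\<^sub>0 'k::field) \<in> carrier (semigroup_ring S)"
  by (simp add: semigroup_ring_carrier)

lemma carrier_single [simp]: "m \<in> S \<Longrightarrow> Poly_Mapping.single m (c :: 'k::field) \<in> carrier (semigroup_ring S)"
  by (simp add: semigroup_ring_carrier)

lemma carrier_one [simp]: "(1 :: 's \<Rightarrow>\<^sub>0 'k::field) \<in> carrier (semigroup_ring S)"
  unfolding single_one[symmetric] by (rule carrier_single[OF zero_mem])

lemma carrier_add [simp]:
  "(p :: 's \<Rightarrow>\<^sub>0 'k::field) \<in> carrier (semigroup_ring S) \<Longrightarrow> q \<in> carrier (semigroup_ring S) \<Longrightarrow>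
     p + q \<in> carrier (semigroup_ring S)"
  using Poly_Mapping.keys_add[of p q] by (auto simp: semigroup_ring_carrier)

lemma carrier_uminus [simp]:
  "(p :: 's \<Rightarrow>\<^sub>0 'k::field) \<in> carrier (semigroup_ring S) \<Longrightarrow> - p \<in> carrier (semigroup_ring S)"
  by (auto simp: semigroup_ring_carrier in_keys_iff)

lemma carrier_diff [simp]:
  "(p :: 's \<Rightarrow>\<^sub>0 'k::field) \<in> carrier (semigroup_ring S) \<Longrightarrow> q \<in> carrier (semigroup_ring S) \<Longrightarrow>
     p - q \<in> carrier (semigroup_ring S)"
  using carrier_add[of p "- q"] carrier_uminus[of q] by simp

lemma carrier_mult [simp]:
  "(p :: 's \<Rightarrow>\<^sub>0 'k::field) \<in> carrier (semigroup_ring S) \<Longrightarrow> q \<in> carrier (semigroup_ring S) \<Longrightarrow>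
     p * q \<in> carrier (semigroup_ring S)"
  using Poly_Mapping.keys_mult[of p q] add_mem by (fastforce simp: semigroup_ring_carrier)

lemma semigroup_ring_cring: "cring (semigroup_ring S :: ('s \<Rightarrow>\<^sub>0 'k::field) ring)"
proof (rule cringI)
  show "abelian_group (semigroup_ring S :: ('s \<Rightarrow>\<^sub>0 'k) ring)"
  proof (rule abelian_groupI)
    fix x :: "'s \<Rightarrow>\<^sub>0 'k" assume "x \<in> carrier (semigroup_ring S)"
    then show "\<exists>y\<in>carrier (semigroup_ring S). y \<oplus>\<^bsub>semigroup_ring S\<^esub> x = \<zero>\<^bsub>semigroup_ring S\<^esub>"
      by (intro bexI[of _ "- x"]) (auto intro: carrier_uminus)
  qed (auto simp: algebra_simps intro: carrier_add)
  show "comm_monoid (semigroup_ring S :: ('s \<Rightarrow>\<^sub>0 'k) ring)"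
    by (rule comm_monoidI) (auto simp: algebra_simps intro: carrier_mult)
qed (auto simp: algebra_simps)

lemma semigroup_ring_uminus:
  assumes "(x :: 's \<Rightarrow>\<^sub>0 'k::field) \<in> carrier (semigroup_ring S)"
  shows "\<ominus>\<^bsub>semigroup_ring S\<^esub> x = - x"
proof -
  interpret cring "semigroup_ring S :: ('s \<Rightarrow>\<^sub>0 'k) ring" by (rule semigroup_ring_cring)
  show ?thesis by (rule minus_equality) (use assms carrier_uminus in auto)
qed

end

text \<open>
  Multiplication by a monomial shifts the coefficients. This uses cancellation in the monoid.
\<close>

lemma lookup_single_mult:
  fixes g :: "'s::{comm_monoid_add, cancel_ab_semigroup_add} \<Rightarrow>\<^sub>0 'k::comm_semiring_1"
  shows "Poly_Mapping.lookup (Poly_Mapping.single m c * g) (m + n) = c * Poly_Mapping.lookup g n"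
proof -
  have "Sum_any (\<lambda>l. Poly_Mapping.lookup (Poly_Mapping.single m c) l *
        Sum_any (\<lambda>q. Poly_Mapping.lookup g q when m + n = l + q)) =
      Sum_any (\<lambda>l. c * Sum_any (\<lambda>q. Poly_Mapping.lookup g q when m + n = l + q) when l = m)"
    by (rule Sum_any.cong) (auto simp: lookup_single when_def)
  also have "\<dots> = c * Poly_Mapping.lookup g n"
    by (simp add: eq_commute[of n])
  finally show ?thesis by (simp add: lookup_mult)
qed

lemma keys_single_mult:
  fixes g :: "'s::{comm_monoid_add, cancel_ab_semigroup_add} \<Rightarrow>\<^sub>0 'k::comm_semiring_1"
  shows "Poly_Mapping.keys (Poly_Mapping.single m c * g) \<subseteq> (\<lambda>n. m + n) ` Poly_Mapping.keys g"
  using Poly_Mapping.keys_mult[of "Poly_Mapping.single m c" g] by (auto split: if_splits)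

lemma semigroup_ring_domain:
  fixes S :: "'s::{ordered_cancel_comm_monoid_add, linorder} set"
  assumes "submonoid_add S"
  shows "domain (semigroup_ring S :: ('s \<Rightarrow>\<^sub>0 'k::field) ring)"
proof -
  interpret submonoid_add S by fact
  show ?thesis
    by (intro domain.intro domain_axioms.intro semigroup_ring_cring) auto
qed

abbreviation lead :: "('s::linorder \<Rightarrow>\<^sub>0 'k::zero) \<Rightarrow> 's" where
  "lead f \<equiv> Max (Poly_Mapping.keys f)"

text \<open>
  The argument of Hilbert's basis theorem in the language of leading monomials. By the hypothesis,
  finitely many leading monomials of an ideal divide, inside \<open>S\<close>, all of its leading monomials;
  polynomials having them generate the ideal, by well-founded induction on the leading monomial of the
  element to be expressed.
\<close>

theorem semigroup_ring_noetherian: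
  fixes S :: "'s::{ordered_cancel_comm_monoid_add, wellorder} set"
  assumes S: "submonoid_add S"
    and dickson: "\<And>T. T \<subseteq> S \<Longrightarrow> \<exists>T0\<subseteq>T. finite T0 \<and> (\<forall>t\<in>T. \<exists>t0\<in>T0. \<exists>s\<in>S. t = s + t0)"
  shows "noetherian_ring (semigroup_ring S :: ('s \<Rightarrow>\<^sub>0 'k::field) ring)"
proof -
  interpret submonoid_add S by fact
  interpret R: cring "semigroup_ring S :: ('s \<Rightarrow>\<^sub>0 'k) ring" by (rule semigroup_ring_cring)
  show ?thesis
  proof (rule R.noetherian_ringI)
    fix I assume I: "ideal I (semigroup_ring S :: ('s \<Rightarrow>\<^sub>0 'k) ring)"
    interpret I: ideal I "semigroup_ring S :: ('s \<Rightarrow>\<^sub>0 'k) ring" by fact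
    define T where "T = lead ` (I - {0})"
    have Ic: "f \<in> carrier (semigroup_ring S)" if "f \<in> I" for f using that I.a_subset by blast
    have leadS: "lead f \<in> Poly_Mapping.keys f" if "f \<noteq> 0" for f :: "'s \<Rightarrow>\<^sub>0 'k"
      by (rule Max_in) (use that in auto)
    have "T \<subseteq> S" using leadS Ic unfolding T_def semigroup_ring_carrier by blast
    then obtain T0 where T0: "T0 \<subseteq> T" "finite T0" "\<And>t. t \<in> T \<Longrightarrow> \<exists>t0\<in>T0. \<exists>s\<in>S. t = s + t0"
      using dickson by metis
    have "\<forall>t\<in>T0. \<exists>g. g \<in> I \<and> g \<noteq> 0 \<and> lead g = t" using T0(1) unfolding T_def by blast
    then obtain g where g: "\<And>t. t \<in> T0 \<Longrightarrow> g t \<in> I \<and> g t \<noteq> 0 \<and> lead (g t) = t" by metis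
    define A where "A = g ` T0"
    have AI: "A \<subseteq> I" using g unfolding A_def by blast
    have Ac: "A \<subseteq> carrier (semigroup_ring S)" using AI Ic by blast
    interpret G: ideal "genideal (semigroup_ring S) A" "semigroup_ring S :: ('s \<Rightarrow>\<^sub>0 'k) ring"
      by (rule R.genideal_ideal[OF Ac])
    have reduce: "f \<in> genideal (semigroup_ring S) A" if "f \<in> I" "f \<noteq> 0" "lead f = t" for f t
      using that
    proof (induction t arbitrary: f rule: less_induct)
      case (less t)
      have "t \<in> T" using less.prems unfolding T_def by blast
      then obtain t0 s where t0: "t0 \<in> T0" "s \<in> S" "t = s + t0" using T0(3) by blast
      note g0 = g[OF t0(1)]
      \<comment> \<open>Subtracting \<open>h\<close> cancels the leading term of \<open>f\<close>.\<close>
      define c where "c = Poly_Mapping.lookup f t / Poly_Mapping.lookup (g t0) t0"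
      define h where "h = Poly_Mapping.single s c * g t0"
      have g0l: "Poly_Mapping.lookup (g t0) t0 \<noteq> 0" using leadS[of "g t0"] g0 by (simp add: in_keys_iff)
      have sc: "Poly_Mapping.single s c \<in> carrier (semigroup_ring S)" by (rule carrier_single[OF t0(2)])
      have gG: "g t0 \<in> genideal (semigroup_ring S) A"
        using R.genideal_self[OF Ac] t0(1) unfolding A_def by blast
      have hG: "h \<in> genideal (semigroup_ring S) A" using G.I_l_closed[OF gG sc] unfolding h_def by simp
      have hI: "h \<in> I" using I.I_l_closed[OF _ sc, of "g t0"] g0 unfolding h_def by simp
      have fh: "f - h \<in> I"
        using I.a_closed[OF less.prems(1) I.a_inv_closed[OF hI]] semigroup_ring_uminus[OF Ic[OF hI]] by simp
      have hk: "n \<le> t" if n: "n \<in> Poly_Mapping.keys h" for n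
      proof -
        have "Poly_Mapping.keys h \<subseteq> (\<lambda>k. s + k) ` Poly_Mapping.keys (g t0)"
          unfolding h_def by (rule keys_single_mult)
        then have "n \<in> (\<lambda>k. s + k) ` Poly_Mapping.keys (g t0)" using n by (rule subsetD)
        then obtain k where k: "n = s + k" "k \<in> Poly_Mapping.keys (g t0)" by blast
        then have "k \<le> t0" using g0 Max_ge[OF finite_keys, of k "g t0"] by simp
        then show ?thesis unfolding k(1) t0(3) by (rule add_left_mono)
      qed
      have fk: "n \<le> t" if "n \<in> Poly_Mapping.keys f" for n
        using that less.prems Max_ge[OF finite_keys, of n f] by simp
      have zero: "Poly_Mapping.lookup (f - h) t = 0"
        unfolding h_def t0(3) lookup_minus lookup_single_mult c_def using g0l t0(3) by simp
      have "f - h \<in> genideal (semigroup_ring S) A"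
      proof (cases "f - h = 0")
        case True
        then show ?thesis using G.zero_closed by simp
      next
        case False
        have l: "lead (f - h) \<in> Poly_Mapping.keys (f - h)" by (rule leadS[OF False])
        then have "lead (f - h) \<in> Poly_Mapping.keys f \<union> Poly_Mapping.keys h"
          by (auto simp: in_keys_iff lookup_minus)
        then have "lead (f - h) \<le> t" using fk hk by blast
        moreover have "lead (f - h) \<noteq> t" using l zero by (auto simp: in_keys_iff)
        ultimately have "lead (f - h) < t" by simp
        then show ?thesis using less.IH fh False by blast
      qed
      then show ?case using G.a_closed[OF _ hG] by fastforce
    qed
    have "I = genideal (semigroup_ring S) A"
    proof
      show "I \<subseteq> genideal (semigroup_ring S) A"
        using reduce G.zero_closed by fastforce
      show "genideal (semigroup_ring S) A \<subseteq> I" by (rule R.genideal_minimal[OF I AI])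
    qed
    then show "\<exists>A\<subseteq>carrier (semigroup_ring S). finite A \<and> I = genideal (semigroup_ring S) A"
      using Ac T0(2) unfolding A_def by blast
  qed
qed

text \<open>
  Relative to one point \<open>(a, b)\<close> of \<open>D\<close>, every point that does not dominate it lies in one of finitely
  many columns \<open>x < a\<close> or rows \<open>y < b\<close>, and each of these has a least element.
\<close>

lemma dickson_nat_pairs:
  fixes D :: "(nat \<times> nat) set"
  shows "\<exists>D0\<subseteq>D. finite D0 \<and> (\<forall>x y. (x, y) \<in> D \<longrightarrow> (\<exists>x0 y0. (x0, y0) \<in> D0 \<and> x0 \<le> x \<and> y0 \<le> y))"
proof (cases "D = {}")
  case True
  then show ?thesis by (intro exI[of _ "{}"]) auto
next
  case False
  then obtain a b where ab: "(a, b) \<in> D" by auto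
  define p where "p x = (x, LEAST y. (x, y) \<in> D)" for x
  define q where "q y = (LEAST x. (x, y) \<in> D, y)" for y
  have p: "p x \<in> D" "snd (p x) \<le> y" if "(x, y) \<in> D" for x y
    using that unfolding p_def by (auto intro: LeastI Least_le)
  have q: "q y \<in> D" "fst (q y) \<le> x" if "(x, y) \<in> D" for x y
    using that unfolding q_def by (auto intro: LeastI Least_le)
  define D0 where "D0 = insert (a, b) (p ` {..<a} \<union> q ` {..<b}) \<inter> D"
  have "\<exists>x0 y0. (x0, y0) \<in> D0 \<and> x0 \<le> x \<and> y0 \<le> y" if xy: "(x, y) \<in> D" for x y
  proof -
    consider "x < a" | "y < b" | "a \<le> x \<and> b \<le> y" by linarith
    then show ?thesis
    proof cases
      case 1
      then have "p x \<in> D0" using p(1)[OF xy] unfolding D0_def by blast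
      then show ?thesis using p(2)[OF xy] unfolding p_def by auto
    next
      case 2
      then have "q y \<in> D0" using q(1)[OF xy] unfolding D0_def by blast
      then show ?thesis using q(2)[OF xy] unfolding q_def by auto
    next
      case 3
      then show ?thesis using ab unfolding D0_def by blast
    qed
  qed
  moreover have "D0 \<subseteq> D" "finite D0" unfolding D0_def by auto
  ultimately show ?thesis by blast
qed

section \<open>Linear maps on a semigroup ring\<close>

abbreviation monomial :: "'s \<Rightarrow> 's \<Rightarrow>\<^sub>0 'k::zero_neq_one" where
  "monomial m \<equiv> Poly_Mapping.single m 1"

abbreviation scalar :: "'k::zero \<Rightarrow> 's::zero \<Rightarrow>\<^sub>0 'k" where
  "scalar c \<equiv> Poly_Mapping.single 0 c"

lemma poly_mapping_sum_single:
  "(\<Sum>m\<in>Poly_Mapping.keys x. Poly_Mapping.single m (Poly_Mapping.lookup x m)) = x"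
proof (rule poly_mapping_eqI)
  fix k
  have "Poly_Mapping.lookup (\<Sum>m\<in>Poly_Mapping.keys x. Poly_Mapping.single m (Poly_Mapping.lookup x m)) k =
    (\<Sum>m\<in>Poly_Mapping.keys x. if m = k then Poly_Mapping.lookup x k else 0)"
    unfolding lookup_sum by (intro sum.cong) (auto simp: lookup_single when_def)
  then show "Poly_Mapping.lookup (\<Sum>m\<in>Poly_Mapping.keys x. Poly_Mapping.single m (Poly_Mapping.lookup x m)) k =
    Poly_Mapping.lookup x k"
    by (simp add: in_keys_iff)
qed

context submonoid_add
begin

text \<open>
  These are the \<open>K\<close>-linear maps into a monoid ring, the scalars being the constants. They vanish
  outside the carrier so that they are determined by their restriction to it.
\<close>

definition linmaps :: "(('s \<Rightarrow>\<^sub>0 'k::field) \<Rightarrow> ('t::comm_monoid_add \<Rightarrow>\<^sub>0 'k)) set" where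
  "linmaps = {\<Phi>. (\<forall>x\<in>carrier (semigroup_ring S). \<forall>y\<in>carrier (semigroup_ring S). \<Phi> (x + y) = \<Phi> x + \<Phi> y) \<and>
     (\<forall>c. \<forall>x\<in>carrier (semigroup_ring S). \<Phi> (scalar c * x) = scalar c * \<Phi> x) \<and>
     (\<forall>x. x \<notin> carrier (semigroup_ring S) \<longrightarrow> \<Phi> x = 0)}"

text \<open>
  The module structure through the source: \<open>(r \<Phi>)(x) = \<Phi>(r x)\<close>.
\<close>

definition act :: "('s \<Rightarrow>\<^sub>0 'k::field) \<Rightarrow> (('s \<Rightarrow>\<^sub>0 'k) \<Rightarrow> 'v::zero) \<Rightarrow> ('s \<Rightarrow>\<^sub>0 'k) \<Rightarrow> 'v" where
  "act r \<Phi> = (\<lambda>x. if x \<in> carrier (semigroup_ring S) then \<Phi> (r * x) else 0)"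

text \<open>
  A linear map intertwines multiplication by \<open>X\<^sup>u\<close> in the source with multiplication by \<open>X\<^sup>v\<close> in the target
  if and only if its discrepancy vanishes.
\<close>

definition discrepancy ::
    "'s \<Rightarrow> 't \<Rightarrow> (('s \<Rightarrow>\<^sub>0 'k::field) \<Rightarrow> ('t::comm_monoid_add \<Rightarrow>\<^sub>0 'k)) \<Rightarrow> ('s \<Rightarrow>\<^sub>0 'k) \<Rightarrow> ('t \<Rightarrow>\<^sub>0 'k)" where
  "discrepancy u v \<Phi> = (\<lambda>x. if x \<in> carrier (semigroup_ring S) then \<Phi> (monomial u * x) - monomial v * \<Phi> x else 0)"

lemma linmapsD:
  assumes "\<Phi> \<in> linmaps"
  shows "\<And>x y. x \<in> carrier (semigroup_ring S) \<Longrightarrow> y \<in> carrier (semigroup_ring S) \<Longrightarrow> \<Phi> (x + y) = \<Phi> x + \<Phi> y"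
    and "\<And>c x. x \<in> carrier (semigroup_ring S) \<Longrightarrow> \<Phi> (scalar c * x) = scalar c * \<Phi> x"
    and "\<And>x. x \<notin> carrier (semigroup_ring S) \<Longrightarrow> \<Phi> x = 0"
    and "\<Phi> 0 = 0"
proof -
  show 2: "\<And>c x. x \<in> carrier (semigroup_ring S) \<Longrightarrow> \<Phi> (scalar c * x) = scalar c * \<Phi> x"
    using assms unfolding linmaps_def by blast
  show "\<Phi> 0 = 0" using 2[of 0 0] by simp
qed (use assms in \<open>auto simp: linmaps_def\<close>)

lemma carrier_sum:
  assumes "\<And>i. i \<in> A \<Longrightarrow> (f i :: 's \<Rightarrow>\<^sub>0 'k::field) \<in> carrier (semigroup_ring S)"
  shows "(\<Sum>i\<in>A. f i) \<in> carrier (semigroup_ring S)"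
  using assms by (induction A rule: infinite_finite_induct) auto

lemma linmaps_sum:
  assumes \<Phi>: "\<Phi> \<in> linmaps" and "\<And>i. i \<in> A \<Longrightarrow> f i \<in> carrier (semigroup_ring S)"
  shows "\<Phi> (\<Sum>i\<in>A. f i) = (\<Sum>i\<in>A. \<Phi> (f i))"
  using assms(2)
proof (induction A rule: infinite_finite_induct)
  case (insert i A)
  then show ?case using linmapsD(1)[OF \<Phi>] carrier_sum[of A f] by auto
qed (auto simp: linmapsD(4)[OF \<Phi>])

lemma linmaps_expand:
  assumes \<Phi>: "\<Phi> \<in> linmaps" and x: "x \<in> carrier (semigroup_ring S)"
  shows "\<Phi> x = (\<Sum>m\<in>Poly_Mapping.keys x. scalar (Poly_Mapping.lookup x m) * \<Phi> (monomial m))"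
proof -
  have m: "m \<in> S" if "m \<in> Poly_Mapping.keys x" for m using x that by (auto simp: semigroup_ring_carrier)
  have "\<Phi> x = \<Phi> (\<Sum>m\<in>Poly_Mapping.keys x. scalar (Poly_Mapping.lookup x m) * monomial m)"
    by (subst (1) poly_mapping_sum_single[of x, symmetric]) (simp add: mult_single)
  also have "\<dots> = (\<Sum>m\<in>Poly_Mapping.keys x. \<Phi> (scalar (Poly_Mapping.lookup x m) * monomial m))"
    using linmaps_sum[OF \<Phi>, of "Poly_Mapping.keys x" "\<lambda>m. scalar (Poly_Mapping.lookup x m) * monomial m"] m
    by (simp add: mult_single carrier_single)
  also have "\<dots> = (\<Sum>m\<in>Poly_Mapping.keys x. scalar (Poly_Mapping.lookup x m) * \<Phi> (monomial m))"
    using m by (intro sum.cong refl linmapsD(2)[OF \<Phi>] carrier_single)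
  finally show ?thesis .
qed

lemma linmaps_eqI:
  assumes "\<Phi> \<in> linmaps" "\<Psi> \<in> linmaps" and eq: "\<And>m. m \<in> S \<Longrightarrow> \<Phi> (monomial m) = \<Psi> (monomial m)"
  shows "\<Phi> = \<Psi>"
proof
  fix x
  show "\<Phi> x = \<Psi> x"
  proof (cases "x \<in> carrier (semigroup_ring S)")
    case True
    then show ?thesis
      unfolding linmaps_expand[OF assms(1) True] linmaps_expand[OF assms(2) True]
      by (intro sum.cong refl) (auto simp: semigroup_ring_carrier eq)
  next
    case False
    then show ?thesis using linmapsD(3)[OF assms(1)] linmapsD(3)[OF assms(2)] by simp
  qed
qed

lemma linmaps_extend:
  fixes \<phi> :: "'s \<Rightarrow> ('t::comm_monoid_add \<Rightarrow>\<^sub>0 'k::field)"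
  shows "\<exists>\<Phi>\<in>linmaps. \<forall>m\<in>S. \<Phi> (monomial m) = \<phi> m"
proof -
  define \<Phi> where "\<Phi> x = (if x \<in> carrier (semigroup_ring S)
    then \<Sum>m\<in>Poly_Mapping.keys x. scalar (Poly_Mapping.lookup x m) * \<phi> m else 0)" for x
  have "\<Phi> \<in> linmaps"
    unfolding linmaps_def
  proof (intro CollectI conjI ballI allI impI)
    fix x y :: "'s \<Rightarrow>\<^sub>0 'k" assume xy: "x \<in> carrier (semigroup_ring S)" "y \<in> carrier (semigroup_ring S)"
    have "(\<Sum>m\<in>Poly_Mapping.keys (x + y). scalar (Poly_Mapping.lookup (x + y) m) * \<phi> m) =
      (\<Sum>m\<in>Poly_Mapping.keys x. scalar (Poly_Mapping.lookup x m) * \<phi> m) +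
      (\<Sum>m\<in>Poly_Mapping.keys y. scalar (Poly_Mapping.lookup y m) * \<phi> m)"
      by (rule setsum_keys_plus_distrib[of "\<lambda>m c. scalar c * \<phi> m"]) (auto simp: single_add algebra_simps)
    then show "\<Phi> (x + y) = \<Phi> x + \<Phi> y" using xy by (simp add: \<Phi>_def)
  next
    fix c and x :: "'s \<Rightarrow>\<^sub>0 'k" assume x: "x \<in> carrier (semigroup_ring S)"
    have l: "Poly_Mapping.lookup (scalar c * x) m = c * Poly_Mapping.lookup x m" for m
    proof -
      have "Sum_any (\<lambda>l. Poly_Mapping.lookup (scalar c) l *
          Sum_any (\<lambda>q. Poly_Mapping.lookup x q when m = l + q)) =
        Sum_any (\<lambda>l. c * Sum_any (\<lambda>q. Poly_Mapping.lookup x q when m = l + q) when l = 0)"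
        by (rule Sum_any.cong) (auto simp: lookup_single when_def)
      then show ?thesis by (simp add: lookup_mult)
    qed
    have k: "Poly_Mapping.keys (scalar c * x) \<subseteq> Poly_Mapping.keys x" by (auto simp: in_keys_iff l)
    have "(\<Sum>m\<in>Poly_Mapping.keys (scalar c * x). scalar (Poly_Mapping.lookup (scalar c * x) m) * \<phi> m) =
        (\<Sum>m\<in>Poly_Mapping.keys x. scalar (Poly_Mapping.lookup (scalar c * x) m) * \<phi> m)"
      by (rule sum.mono_neutral_left) (use k in \<open>auto simp: in_keys_iff\<close>)
    also have "\<dots> = scalar c * (\<Sum>m\<in>Poly_Mapping.keys x. scalar (Poly_Mapping.lookup x m) * \<phi> m)"
      by (simp add: l sum_distrib_left mult_single flip: mult.assoc)
    finally show "\<Phi> (scalar c * x) = scalar c * \<Phi> x"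
      using x by (simp add: \<Phi>_def)
  qed (simp add: \<Phi>_def)
  moreover have "\<Phi> (monomial m) = \<phi> m" if "m \<in> S" for m
    using that by (simp add: \<Phi>_def)
  ultimately show ?thesis by blast
qed

lemma linmaps_zero [simp]: "(\<lambda>_. 0) \<in> linmaps"
  by (simp add: linmaps_def)

lemma linmaps_add: "\<Phi> \<in> linmaps \<Longrightarrow> \<Psi> \<in> linmaps \<Longrightarrow> (\<lambda>x. \<Phi> x + \<Psi> x) \<in> linmaps"
  by (simp add: linmaps_def algebra_simps)

lemma linmaps_diff: "\<Phi> \<in> linmaps \<Longrightarrow> \<Psi> \<in> linmaps \<Longrightarrow> (\<lambda>x. \<Phi> x - \<Psi> x) \<in> linmaps"
  by (simp add: linmaps_def algebra_simps)

lemma linmaps_uminus: "\<Phi> \<in> linmaps \<Longrightarrow> (\<lambda>x. - \<Phi> x) \<in> linmaps"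
  by (simp add: linmaps_def algebra_simps)

lemma linmaps_act:
  assumes r: "r \<in> carrier (semigroup_ring S)" and \<Phi>: "\<Phi> \<in> linmaps"
  shows "act r \<Phi> \<in> linmaps"
proof -
  have "\<Phi> (r * (scalar c * x)) = scalar c * \<Phi> (r * x)" if "x \<in> carrier (semigroup_ring S)" for c x
    using linmapsD(2)[OF \<Phi>, of "r * x" c] r that by (simp add: mult.left_commute[of r])
  then show ?thesis
    using r linmapsD(1)[OF \<Phi>] by (auto simp: linmaps_def act_def distrib_left)
qed

lemma act_zero [simp]: "act r (\<lambda>_. 0) = (\<lambda>_. 0)"
  by (simp add: act_def)

lemma linmaps_discrepancy: "u \<in> S \<Longrightarrow> \<Phi> \<in> linmaps \<Longrightarrow> discrepancy u v \<Phi> \<in> linmaps"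
  by (auto simp: linmaps_def discrepancy_def distrib_left right_diff_distrib mult.left_commute)

lemma discrepancy_commute:
  "u \<in> S \<Longrightarrow> u' \<in> S \<Longrightarrow> discrepancy u v (discrepancy u' v' \<Phi>) = discrepancy u' v' (discrepancy u v \<Phi>)"
  by (intro ext) (auto simp: discrepancy_def algebra_simps)

lemma discrepancy_act:
  "u \<in> S \<Longrightarrow> r \<in> carrier (semigroup_ring S) \<Longrightarrow> discrepancy u v (act r \<Phi>) = act r (discrepancy u v \<Phi>)"
  by (intro ext) (auto simp: discrepancy_def act_def mult.left_commute)

lemma discrepancy_add: "discrepancy u v (\<lambda>x. \<Phi> x + \<Psi> x) = (\<lambda>x. discrepancy u v \<Phi> x + discrepancy u v \<Psi> x)"
  by (auto simp: discrepancy_def algebra_simps)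

lemma discrepancy_diff: "discrepancy u v (\<lambda>x. \<Phi> x - \<Psi> x) = (\<lambda>x. discrepancy u v \<Phi> x - discrepancy u v \<Psi> x)"
  by (auto simp: discrepancy_def algebra_simps)

lemma discrepancy_mono:
  "m \<in> S \<Longrightarrow> discrepancy u v \<Phi> (monomial m) = \<Phi> (monomial (u + m)) - monomial v * \<Phi> (monomial m)"
  by (simp add: discrepancy_def mult_single)

text \<open>
  The semigroup is a disjoint union of rays in the direction \<open>u\<close>. A solution is built along each ray,
  starting from \<open>0\<close>, by the recursion \<open>\<Phi>(X\<^bsup>u+m\<^esup>) = X\<^sup>v \<Phi>(X\<^sup>m) + \<Psi>(X\<^sup>m)\<close>. The starting value and the recursion are
  compatible with the direction \<open>u'\<close>, which transports vanishing of the other discrepancy from \<open>\<Psi>\<close> to \<open>\<Phi>\<close>.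
\<close>

lemma discrepancy_surj:
  fixes pt :: "'c \<Rightarrow> nat \<Rightarrow> nat \<Rightarrow> 's"
    and \<Psi> :: "('s \<Rightarrow>\<^sub>0 'k::field) \<Rightarrow> ('t::comm_monoid_add \<Rightarrow>\<^sub>0 'k)"
  assumes u: "u \<in> S" and u': "u' \<in> S"
    and pt_mem: "\<And>c i j. c \<in> C \<Longrightarrow> pt c i j \<in> S"
    and pt_surj: "\<And>m. m \<in> S \<Longrightarrow> \<exists>c\<in>C. \<exists>i j. m = pt c i j"
    and pt_inj: "\<And>c i j c' i' j'. c \<in> C \<Longrightarrow> c' \<in> C \<Longrightarrow> pt c i j = pt c' i' j' \<Longrightarrow> c = c' \<and> i = i' \<and> j = j'"
    and pt_Suc1: "\<And>c i j. pt c (Suc i) j = u + pt c i j" and pt_Suc2: "\<And>c i j. pt c i (Suc j) = u' + pt c i j"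
    and \<Psi>: "\<Psi> \<in> linmaps"
  shows "\<exists>\<Phi>\<in>linmaps. discrepancy u v \<Phi> = \<Psi> \<and>
    (discrepancy u' v' \<Psi> = (\<lambda>_. 0) \<longrightarrow> discrepancy u' v' \<Phi> = (\<lambda>_. 0))"
proof -
  \<comment> \<open>The values along the ray through \<open>pt c 0 j\<close> in the direction \<open>u\<close>.\<close>
  define f where "f c j = rec_nat 0 (\<lambda>i y. monomial v * y + \<Psi> (monomial (pt c i j)))" for c j
  have f0: "f c j 0 = 0" and fS: "f c j (Suc i) = monomial v * f c j i + \<Psi> (monomial (pt c i j))" for c i j
    by (simp_all add: f_def)
  define \<phi> where "\<phi> m = (THE y. \<exists>c\<in>C. \<exists>i j. m = pt c i j \<and> y = f c j i)" for m
  have \<phi>: "\<phi> (pt c i j) = f c j i" if c: "c \<in> C" for c i j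
    unfolding \<phi>_def
  proof (rule the_equality)
    show "\<exists>c'\<in>C. \<exists>i' j'. pt c i j = pt c' i' j' \<and> f c j i = f c' j' i'" using c by blast
    show "y = f c j i" if "\<exists>c'\<in>C. \<exists>i' j'. pt c i j = pt c' i' j' \<and> y = f c' j' i'" for y
      using \<open>\<exists>c'\<in>C. \<exists>i' j'. pt c i j = pt c' i' j' \<and> y = f c' j' i'\<close> pt_inj[OF c] by blast
  qed
  obtain \<Phi> where \<Phi>: "\<Phi> \<in> linmaps" "\<And>m. m \<in> S \<Longrightarrow> \<Phi> (monomial m) = \<phi> m" using linmaps_extend by blast
  have \<Phi>pt: "\<Phi> (monomial (pt c i j)) = f c j i" if "c \<in> C" for c i j
    using \<Phi>(2)[OF pt_mem[OF that]] \<phi>[OF that] by simp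
  have "discrepancy u v \<Phi> = \<Psi>"
  proof (rule linmaps_eqI[OF linmaps_discrepancy[OF u \<Phi>(1)] \<Psi>])
    fix m assume m: "m \<in> S"
    then obtain c i j where c: "c \<in> C" "m = pt c i j" using pt_surj by blast
    show "discrepancy u v \<Phi> (monomial m) = \<Psi> (monomial m)"
      unfolding discrepancy_mono[OF m] unfolding c(2) pt_Suc1[symmetric] \<Phi>pt[OF c(1)] fS by simp
  qed
  moreover have "discrepancy u' v' \<Phi> = (\<lambda>_. 0)" if \<Psi>0: "discrepancy u' v' \<Psi> = (\<lambda>_. 0)"
  proof (rule linmaps_eqI[OF linmaps_discrepancy[OF u' \<Phi>(1)] linmaps_zero])
    fix m assume m: "m \<in> S"
    then obtain c i j where c: "c \<in> C" "m = pt c i j" using pt_surj by blast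
    have P: "\<Psi> (monomial (pt c i (Suc j))) = monomial v' * \<Psi> (monomial (pt c i j))" for i
      using discrepancy_mono[OF pt_mem[OF c(1)], of u' v' \<Psi> i j] \<Psi>0 unfolding pt_Suc2 by simp
    have "f c (Suc j) i = monomial v' * f c j i" for i
      by (induction i) (simp_all add: f0 fS P algebra_simps)
    then show "discrepancy u' v' \<Phi> (monomial m) = 0"
      unfolding discrepancy_mono[OF m] unfolding c(2) pt_Suc2[symmetric] \<Phi>pt[OF c(1)] by simp
  qed
  ultimately show ?thesis using \<Phi>(1) by blast
qed

text \<open>
  The homomorphism \<open>f\<close> corresponds to the \<open>K\<close>-linear form \<open>x \<mapsto> f x 1\<close> on \<open>J\<close>, because \<open>f x y = f (y x) 1\<close>. Any
  \<open>K\<close>-linear extension of this form to the whole ring solves the extension problem.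
\<close>

lemma linmaps_baer:
  fixes f :: "('s \<Rightarrow>\<^sub>0 'k::field) \<Rightarrow> ('s \<Rightarrow>\<^sub>0 'k) \<Rightarrow> ('t::comm_monoid_add \<Rightarrow>\<^sub>0 'k)"
  assumes J: "ideal J (semigroup_ring S)"
    and f_mem: "\<And>x. x \<in> J \<Longrightarrow> f x \<in> linmaps"
    and f_add: "\<And>x y. x \<in> J \<Longrightarrow> y \<in> J \<Longrightarrow> f (x + y) = (\<lambda>z. f x z + f y z)"
    and f_act: "\<And>r x. r \<in> carrier (semigroup_ring S) \<Longrightarrow> x \<in> J \<Longrightarrow> f (r * x) = act r (f x)"
  shows "\<exists>e\<in>linmaps. \<forall>x\<in>J. f x = act x e"
proof -
  interpret R: cring "semigroup_ring S :: ('s \<Rightarrow>\<^sub>0 'k) ring" by (rule semigroup_ring_cring)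
  interpret J: ideal J "semigroup_ring S :: ('s \<Rightarrow>\<^sub>0 'k) ring" by fact
  interpret vs: vector_space_pair "\<lambda>(c::'k) (p::'s \<Rightarrow>\<^sub>0 'k). scalar c * p" "\<lambda>(c::'k) (p::'t \<Rightarrow>\<^sub>0 'k). scalar c * p"
    by unfold_locales (auto simp: algebra_simps single_add mult_single simp flip: mult.assoc)
  have Jc: "x \<in> carrier (semigroup_ring S)" if "x \<in> J" for x using that J.a_subset by blast
  have const_mem: "scalar c \<in> carrier (semigroup_ring S)" for c :: 'k by (rule carrier_single[OF zero_mem])
  have J_add: "x + y \<in> J" if "x \<in> J" "y \<in> J" for x y using J.a_closed[OF that] by simp
  have J_mult: "r * x \<in> J" if "x \<in> J" "r \<in> carrier (semigroup_ring S)" for r x using J.I_l_closed[OF that] by simp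
  have J_zero: "0 \<in> J" using J.zero_closed by simp
  obtain B where B: "B \<subseteq> J" "vs.vs1.independent B" "J \<subseteq> vs.vs1.span B"
    by (rule vs.vs1.maximal_independent_subset)
  obtain g where g: "Vector_Spaces.linear (\<lambda>c p. scalar c * p) (\<lambda>c p. scalar c * p) g"
    and gB: "\<And>x. x \<in> B \<Longrightarrow> g x = f x 1"
    using vs.linear_independent_extend[OF B(2), of "\<lambda>x. f x 1"] by blast
  interpret g: Vector_Spaces.linear "\<lambda>(c::'k) (p::'s \<Rightarrow>\<^sub>0 'k). scalar c * p" "\<lambda>(c::'k) (p::'t \<Rightarrow>\<^sub>0 'k). scalar c * p" g
    by (rule g)
  have f0: "f 0 1 = 0"
  proof -
    have "f 0 = act 0 (f 0)" using f_act[OF carrier_zero J_zero] unfolding mult_zero_left .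
    then have "f 0 1 = act 0 (f 0) 1" by (rule fun_cong)
    also have "\<dots> = f 0 0" unfolding act_def by (simp only: mult_zero_left carrier_one if_True)
    also have "\<dots> = 0" by (rule linmapsD(4)[OF f_mem[OF J_zero]])
    finally show ?thesis .
  qed
  have gf: "g x = f x 1" if "x \<in> J" for x
  proof -
    have "x \<in> vs.vs1.span B" using that B(3) by blast
    then have "x \<in> J \<and> g x = f x 1"
    proof (induction rule: vs.vs1.span_induct_alt)
      case base
      then show ?case using J_zero f0 g.zero by simp
    next
      case (step c b y)
      have b: "b \<in> J" "scalar c * b \<in> J" using step B(1) J_mult const_mem by auto
      have "f (scalar c * b) 1 = scalar c * f b 1"
        using f_act[OF const_mem b(1)] linmapsD(2)[OF f_mem[OF b(1)], of 1 c] by (simp add: act_def)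
      then show ?case
        using step b J_add[OF b(2)] f_add[OF b(2), of y] gB by (simp add: g.add g.scale)
    qed
    then show ?thesis by simp
  qed
  define e where "e x = (if x \<in> carrier (semigroup_ring S) then g x else 0)" for x
  have "e \<in> linmaps"
    by (auto simp: linmaps_def e_def g.add g.scale)
  moreover have "f x = act x e" if x: "x \<in> J" for x
  proof
    fix y
    show "f x y = act x e y"
    proof (cases "y \<in> carrier (semigroup_ring S)")
      case True
      have "act x e y = g (y * x)"
        using True carrier_mult[OF Jc[OF x] True] by (simp add: act_def e_def mult.commute)
      also have "\<dots> = f (y * x) 1" by (rule gf[OF J_mult[OF x True]])
      also have "\<dots> = f x y" unfolding f_act[OF True x] by (simp add: act_def)
      finally show ?thesis by simp
    next
      case False
      then show ?thesis using linmapsD(3)[OF f_mem[OF x]] by (simp add: act_def)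
    qed
  qed
  ultimately show ?thesis by blast
qed

end

section \<open>Symmetric semigroups and the Frobenius form\<close>

text \<open>
  The point \<open>c + i a + j b\<close>.
\<close>

definition shifted :: "'s::comm_monoid_add \<Rightarrow> 's \<Rightarrow> 's \<Rightarrow> nat \<Rightarrow> nat \<Rightarrow> 's" where
  "shifted a b c i j = (((+) a) ^^ i) ((((+) b) ^^ j) c)"

lemma shifted_0 [simp]: "shifted a b c 0 0 = c"
  by (simp add: shifted_def)

lemma shifted_Suc1: "shifted a b c (Suc i) j = a + shifted a b c i j"
  by (simp add: shifted_def)

lemma shifted_Suc2: "shifted a b c i (Suc j) = b + shifted a b c i j"
  by (induction i) (simp_all add: shifted_def add.left_commute)

lemma shifted_add: "shifted a b (c + d) i j = c + shifted a b d i j"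
proof (induction i)
  case 0
  show ?case by (induction j) (simp_all add: shifted_Suc2 add.left_commute)
next
  case (Suc i)
  then show ?case by (simp add: shifted_Suc1 add.left_commute)
qed

lemma shifted_shifted: "shifted a b (shifted a b c i' j') i j = shifted a b c (i + i') (j + j')"
proof (induction i)
  case 0
  show ?case by (induction j) (simp_all add: shifted_Suc2)
next
  case (Suc i)
  then show ?case by (simp add: shifted_Suc1)
qed

text \<open>
  The semigroup ring is free over the polynomial ring generated by the monomials of \<open>a\<close> and \<open>b\<close>, with
  basis \<open>C\<close> (this is the Cohen-Macaulay property), and the basis is symmetric.
\<close>

locale symmetric_semigroup = submonoid_add S for S :: "'s::{ordered_cancel_comm_monoid_add, wellorder} set" +
  fixes C a b c0
  assumes finite_C: "finite C"
    and C_mem: "c \<in> C \<Longrightarrow> shifted a b c i j \<in> S"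
    and surj: "m \<in> S \<Longrightarrow> \<exists>c\<in>C. \<exists>i j. m = shifted a b c i j"
    and inj: "c \<in> C \<Longrightarrow> c' \<in> C \<Longrightarrow> shifted a b c i j = shifted a b c' i' j' \<Longrightarrow> c = c' \<and> i = i' \<and> j = j'"
    and c0: "c0 \<in> C" and dual: "c \<in> C \<Longrightarrow> \<exists>c'\<in>C. c + c' = c0"
begin

lemma zero_C: "0 \<in> C"
proof -
  obtain c' where c': "c' \<in> C" "c0 + c' = c0" using dual[OF c0] by blast
  then have "c0 + c' = c0 + 0" by simp
  then have "c' = 0" by (rule add_left_imp_eq)
  then show ?thesis using c' by simp
qed

lemma C_S: "c \<in> C \<Longrightarrow> c \<in> S"
  using C_mem[of c 0 0] by simp

lemma a_S: "a \<in> S" and b_S: "b \<in> S"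
  using C_mem[OF zero_C, of 1 0] C_mem[OF zero_C, of 0 1]
  by (simp_all add: shifted_Suc1 shifted_Suc2)

text \<open>
  On each of the finitely many translates, divisibility inside \<open>S\<close> contains the componentwise order of
  the coordinates \<open>(i, j)\<close>.
\<close>

lemma dickson:
  assumes T: "T \<subseteq> S"
  shows "\<exists>T0\<subseteq>T. finite T0 \<and> (\<forall>t\<in>T. \<exists>t0\<in>T0. \<exists>s\<in>S. t = s + t0)"
proof -
  define D where "D c = {(i, j). shifted a b c i j \<in> T}" for c
  have "\<forall>c. \<exists>X\<subseteq>D c. finite X \<and>
      (\<forall>i j. (i, j) \<in> D c \<longrightarrow> (\<exists>i0 j0. (i0, j0) \<in> X \<and> i0 \<le> i \<and> j0 \<le> j))"
    by (intro allI dickson_nat_pairs)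
  then obtain D0 where D0: "\<And>c. D0 c \<subseteq> D c" "\<And>c. finite (D0 c)"
    "\<And>c i j. (i, j) \<in> D c \<Longrightarrow> \<exists>i0 j0. (i0, j0) \<in> D0 c \<and> i0 \<le> i \<and> j0 \<le> j" by metis
  define T0 where "T0 = (\<Union>c\<in>C. (\<lambda>(i, j). shifted a b c i j) ` D0 c)"
  have "\<exists>t0\<in>T0. \<exists>s\<in>S. t = s + t0" if t: "t \<in> T" for t
  proof -
    obtain c i j where c: "c \<in> C" "t = shifted a b c i j" using surj T t by blast
    then have "(i, j) \<in> D c" using t unfolding D_def by simp
    then obtain i0 j0 where ij: "(i0, j0) \<in> D0 c" "i0 \<le> i" "j0 \<le> j" using D0(3) by blast
    have "t = shifted a b (shifted a b c i0 j0 + 0) (i - i0) (j - j0)"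
      using ij c(2) by (simp add: shifted_shifted)
    also have "\<dots> = shifted a b 0 (i - i0) (j - j0) + shifted a b c i0 j0"
      unfolding shifted_add by (simp add: add.commute)
    finally show ?thesis using C_mem[OF zero_C, of "i - i0" "j - j0"] c(1) ij(1) unfolding T0_def by force
  qed
  moreover have "T0 \<subseteq> T" using D0(1) unfolding T0_def D_def by fastforce
  moreover have "finite T0" using finite_C D0(2) unfolding T0_def by simp
  ultimately show ?thesis by blast
qed

lemma noetherian: "noetherian_ring (semigroup_ring S :: ('s \<Rightarrow>\<^sub>0 'k::field) ring)"
  by (rule semigroup_ring_noetherian[OF submonoid_add_axioms dickson])

abbreviation da :: "(('s \<Rightarrow>\<^sub>0 'k::field) \<Rightarrow> (nat \<times> nat \<Rightarrow>\<^sub>0 'k)) \<Rightarrow> _" where "da \<equiv> discrepancy a (1, 0)"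
abbreviation db :: "(('s \<Rightarrow>\<^sub>0 'k::field) \<Rightarrow> (nat \<times> nat \<Rightarrow>\<^sub>0 'k)) \<Rightarrow> _" where "db \<equiv> discrepancy b (0, 1)"

lemma da_surj:
  assumes "\<Psi> \<in> linmaps"
  shows "\<exists>\<Phi>\<in>linmaps. da \<Phi> = \<Psi> \<and> (db \<Psi> = (\<lambda>_. 0) \<longrightarrow> db \<Phi> = (\<lambda>_. 0))"
  by (rule discrepancy_surj[where pt = "shifted a b" and C = C])
    (use a_S b_S C_mem surj inj shifted_Suc1 shifted_Suc2 assms in blast)+

lemma db_surj:
  assumes "\<Psi> \<in> linmaps"
  shows "\<exists>\<Phi>\<in>linmaps. db \<Phi> = \<Psi> \<and> (da \<Psi> = (\<lambda>_. 0) \<longrightarrow> da \<Phi> = (\<lambda>_. 0))"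
  by (rule discrepancy_surj[where pt = "\<lambda>c i j. shifted a b c j i" and C = C])
    (use a_S b_S C_mem surj inj shifted_Suc1 shifted_Suc2 assms in blast)+

text \<open>
  First solve \<open>D\<^sub>a F = \<Phi>\<^sub>1\<close>. The error \<open>\<Phi>\<^sub>2 - D\<^sub>b F\<close> is then annihilated by \<open>D\<^sub>a\<close>, and can be corrected by a map
  annihilated by \<open>D\<^sub>a\<close>.
\<close>

lemma koszul_exact:
  assumes \<Phi>1: "\<Phi>1 \<in> linmaps" and \<Phi>2: "\<Phi>2 \<in> linmaps" and eq: "db \<Phi>1 = da \<Phi>2"
  shows "\<exists>\<Phi>\<in>linmaps. da \<Phi> = \<Phi>1 \<and> db \<Phi> = \<Phi>2"
proof -
  obtain F where F: "F \<in> linmaps" "da F = \<Phi>1" using da_surj[OF \<Phi>1] by blast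
  define G where "G = (\<lambda>x. \<Phi>2 x - db F x)"
  have G: "G \<in> linmaps" unfolding G_def by (rule linmaps_diff[OF \<Phi>2 linmaps_discrepancy[OF b_S F(1)]])
  have "da G = (\<lambda>x. da \<Phi>2 x - da (db F) x)" unfolding G_def by (rule discrepancy_diff)
  also have "da (db F) = db \<Phi>1" unfolding discrepancy_commute[OF a_S b_S] F(2) ..
  finally have "da G = (\<lambda>_. 0)" using eq by simp
  then obtain H where H: "H \<in> linmaps" "db H = G" "da H = (\<lambda>_. 0)" using db_surj[OF G] by blast
  have "da (\<lambda>x. F x + H x) = \<Phi>1" unfolding discrepancy_add F(2) H(3) by simp
  moreover have "db (\<lambda>x. F x + H x) = \<Phi>2" unfolding discrepancy_add H(2) by (simp add: G_def)
  ultimately show ?thesis using linmaps_add[OF F(1) H(1)] by blast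
qed

lemma semilinear_eqI:
  assumes \<Phi>: "\<Phi> \<in> linmaps" "da \<Phi> = (\<lambda>_. 0)" "db \<Phi> = (\<lambda>_. 0)"
    and \<Psi>: "\<Psi> \<in> linmaps" "da \<Psi> = (\<lambda>_. 0)" "db \<Psi> = (\<lambda>_. 0)"
    and eq: "\<And>c. c \<in> C \<Longrightarrow> \<Phi> (monomial c) = \<Psi> (monomial c)"
  shows "\<Phi> = \<Psi>"
proof (rule linmaps_eqI[OF \<Phi>(1) \<Psi>(1)])
  fix m assume "m \<in> S"
  then obtain c i j where c: "c \<in> C" "m = shifted a b c i j" using surj by blast
  have step: "F (monomial (a + n)) = monomial (1, 0) * F (monomial n)" "F (monomial (b + n)) = monomial (0, 1) * F (monomial n)"
    if n: "n \<in> S" and F: "da F = (\<lambda>_. 0)" "db F = (\<lambda>_. 0)" for F and n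
    using discrepancy_mono[OF n, of a "(1, 0)" F] discrepancy_mono[OF n, of b "(0, 1)" F] F by auto
  have "\<Phi> (monomial (shifted a b c i j)) = \<Psi> (monomial (shifted a b c i j))"
  proof (induction i)
    case 0
    show ?case
    proof (induction j)
      case 0
      show ?case using eq[OF c(1)] by simp
    next
      case (Suc j)
      show ?case unfolding shifted_Suc2
        using step(2)[OF C_mem[OF c(1)] \<Phi>(2,3)] step(2)[OF C_mem[OF c(1)] \<Psi>(2,3)] Suc by simp
    qed
  next
    case (Suc i)
    show ?case unfolding shifted_Suc1
      using step(1)[OF C_mem[OF c(1)] \<Phi>(2,3)] step(1)[OF C_mem[OF c(1)] \<Psi>(2,3)] Suc by simp
  qed
  then show "\<Phi> (monomial m) = \<Psi> (monomial m)" using c by simp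
qed

lemma exists_frobenius_form:
  "\<exists>\<tau> :: ('s \<Rightarrow>\<^sub>0 'k::field) \<Rightarrow> (nat \<times> nat \<Rightarrow>\<^sub>0 'k). \<tau> \<in> linmaps \<and> da \<tau> = (\<lambda>_. 0) \<and> db \<tau> = (\<lambda>_. 0) \<and>
     (\<forall>c\<in>C. \<forall>i j. \<tau> (monomial (shifted a b c i j)) = (if c = c0 then monomial (i, j) else 0))"
proof -
  define \<phi> :: "'s \<Rightarrow> (nat \<times> nat \<Rightarrow>\<^sub>0 'k)" where
    "\<phi> m = (THE y. \<exists>c\<in>C. \<exists>i j. m = shifted a b c i j \<and> y = (if c = c0 then monomial (i, j) else 0))" for m
  have \<phi>: "\<phi> (shifted a b c i j) = (if c = c0 then monomial (i, j) else 0)" if c: "c \<in> C" for c i j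
    unfolding \<phi>_def
  proof (rule the_equality)
    show "\<exists>c'\<in>C. \<exists>i' j'. shifted a b c i j = shifted a b c' i' j' \<and>
      (if c = c0 then monomial (i, j) else 0) = (if c' = c0 then monomial (i', j') else 0)" using c by blast
    show "y = (if c = c0 then monomial (i, j) else 0)" if y: "\<exists>c'\<in>C. \<exists>i' j'. shifted a b c i j = shifted a b c' i' j' \<and>
      y = (if c' = c0 then monomial (i', j') else 0)" for y
      using y inj[OF c] by metis
  qed
  obtain \<tau> where \<tau>: "\<tau> \<in> linmaps" "\<And>m. m \<in> S \<Longrightarrow> \<tau> (monomial m) = \<phi> m" using linmaps_extend[of \<phi>] by blast
  have \<tau>s: "\<tau> (monomial (shifted a b c i j)) = (if c = c0 then monomial (i, j) else 0)" if "c \<in> C" for c i j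
    using \<tau>(2)[OF C_mem[OF that]] \<phi>[OF that] by simp
  have "da \<tau> = (\<lambda>_. 0)"
  proof (rule linmaps_eqI[OF linmaps_discrepancy[OF a_S \<tau>(1)] linmaps_zero])
    fix m assume m: "m \<in> S"
    then obtain c i j where c: "c \<in> C" "m = shifted a b c i j" using surj by blast
    show "da \<tau> (monomial m) = 0"
      unfolding discrepancy_mono[OF m] unfolding c(2) shifted_Suc1[symmetric] \<tau>s[OF c(1)]
      by (simp add: mult_single)
  qed
  moreover have "db \<tau> = (\<lambda>_. 0)"
  proof (rule linmaps_eqI[OF linmaps_discrepancy[OF b_S \<tau>(1)] linmaps_zero])
    fix m assume m: "m \<in> S"
    then obtain c i j where c: "c \<in> C" "m = shifted a b c i j" using surj by blast
    show "db \<tau> (monomial m) = 0"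
      unfolding discrepancy_mono[OF m] unfolding c(2) shifted_Suc2[symmetric] \<tau>s[OF c(1)]
      by (simp add: mult_single)
  qed
  ultimately show ?thesis using \<tau>(1) \<tau>s by blast
qed

text \<open>
  The coordinate function at \<open>c0\<close> with respect to the basis \<open>C\<close>, a linear map over the polynomial ring.
\<close>

definition frob :: "('s \<Rightarrow>\<^sub>0 'k::field) \<Rightarrow> (nat \<times> nat \<Rightarrow>\<^sub>0 'k)" where
  "frob = (SOME \<tau>. \<tau> \<in> linmaps \<and> da \<tau> = (\<lambda>_. 0) \<and> db \<tau> = (\<lambda>_. 0) \<and>
     (\<forall>c\<in>C. \<forall>i j. \<tau> (monomial (shifted a b c i j)) = (if c = c0 then monomial (i, j) else 0)))"

lemma frob:
  "frob \<in> linmaps" "da frob = (\<lambda>_. 0)" "db frob = (\<lambda>_. 0)"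
  "c \<in> C \<Longrightarrow> frob (monomial (shifted a b c i j)) = (if c = c0 then monomial (i, j) else 0)"
  using someI_ex[OF exists_frobenius_form] unfolding frob_def by blast+

lemma lookup_frob:
  assumes "m \<in> S"
  shows "Poly_Mapping.lookup (frob (monomial m) :: nat \<times> nat \<Rightarrow>\<^sub>0 'k::field) (i, j) =
    (if m = shifted a b c0 i j then 1 else 0)"
proof -
  obtain c i' j' where c: "c \<in> C" "m = shifted a b c i' j'" using surj assms by blast
  show ?thesis
    unfolding c(2) frob(4)[OF c(1)] using inj[OF c(1) c0, of i' j' i j]
    by (auto simp: lookup_single when_def)
qed

text \<open>
  The point \<open>c' + d\<close> lies in the translate of \<open>c0 = c + c'\<close> only if, after adding \<open>c\<close> and cancelling \<open>c0\<close>, the point \<open>d\<close>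
  lies in the translate of \<open>c\<close>. So multiplication by \<open>c'\<close> picks out the coordinate at \<open>c\<close>: the Frobenius
  pairing is a permutation matrix in the basis \<open>C\<close>.
\<close>

lemma frob_dual:
  assumes c: "c \<in> C" and c': "c' \<in> C" "c + c' = c0" and d: "d \<in> C"
  shows "frob (monomial (shifted a b (c' + d) i j)) = (if d = c then monomial (i, j) else 0 :: nat \<times> nat \<Rightarrow>\<^sub>0 'k::field)"
proof (cases "d = c")
  case True
  then show ?thesis using frob(4)[OF c0] c'(2) by (simp add: add.commute)
next
  case False
  have "c' + d \<in> S" using C_S c'(1) d by simp
  then obtain e k l where e: "e \<in> C" "c' + d = shifted a b e k l" using surj by blast
  have "e \<noteq> c0"
  proof
    assume "e = c0"
    have "c0 + d = c + (c' + d)" unfolding c'(2)[symmetric] by (rule add.assoc)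
    also have "\<dots> = c + shifted a b c0 k l" using e(2) \<open>e = c0\<close> by simp
    also have "\<dots> = c0 + shifted a b c k l" using shifted_add[of a b c c0] shifted_add[of a b c0 c] by (simp add: add.commute)
    finally have "d = shifted a b c k l" by (rule add_left_imp_eq)
    then show False using inj[OF d c, of 0 0 k l] False by simp
  qed
  then show ?thesis using frob(4)[OF e(1)] False e(2) by (simp add: shifted_shifted)
qed

text \<open>
  If \<open>m0 = c + i a + j b\<close> occurs in \<open>r\<close>, then the coefficient of \<open>r\<close> at \<open>m0\<close> appears at \<open>(i, j)\<close> in the value
  at \<open>r \<cdot> X\<^bsup>c'\<^esup>\<close>, where \<open>c'\<close> is the dual of \<open>c\<close>.
\<close>

lemma frob_nondegenerate:
  assumes r: "r \<in> carrier (semigroup_ring S)" and zero: "act r frob = (\<lambda>_. 0 :: nat \<times> nat \<Rightarrow>\<^sub>0 'k::field)"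
  shows "r = 0"
proof (rule ccontr)
  assume "r \<noteq> 0"
  then obtain m0 where m0: "m0 \<in> Poly_Mapping.keys r" by (metis keys_eq_empty ex_in_conv)
  have rS: "m \<in> S" if "m \<in> Poly_Mapping.keys r" for m using r that by (auto simp: semigroup_ring_carrier)
  obtain c i j where c: "c \<in> C" "m0 = shifted a b c i j" using surj rS[OF m0] by blast
  obtain c' where c': "c' \<in> C" "c + c' = c0" using dual[OF c(1)] by blast
  have c'S: "c' \<in> S" by (rule C_S[OF c'(1)])
  have key: "m + c' = shifted a b c0 i j \<longleftrightarrow> m = m0" for m
  proof -
    have "m0 + c' = shifted a b c0 i j"
      unfolding c(2) c'(2)[symmetric] add.commute[of c c'] shifted_add by (simp add: add.commute)
    then show ?thesis by (metis add_right_imp_eq)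
  qed
  let ?f = "\<lambda>m. Poly_Mapping.single (m + c') (Poly_Mapping.lookup r m)"
  have "r * monomial c' = (\<Sum>m\<in>Poly_Mapping.keys r. ?f m)"
    by (subst (1) poly_mapping_sum_single[of r, symmetric]) (simp add: sum_distrib_right mult_single)
  then have "frob (r * monomial c') = (\<Sum>m\<in>Poly_Mapping.keys r. frob (?f m) :: nat \<times> nat \<Rightarrow>\<^sub>0 'k)"
    using linmaps_sum[OF frob(1), of "Poly_Mapping.keys r" ?f] rS c'S by simp
  also have "\<dots> = (\<Sum>m\<in>Poly_Mapping.keys r. scalar (Poly_Mapping.lookup r m) * frob (monomial (m + c')))"
    using linmapsD(2)[OF frob(1), of "monomial _" ] rS c'S by (intro sum.cong refl) (simp add: mult_single flip: linmapsD(2)[OF frob(1)])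
  finally have "Poly_Mapping.lookup (frob (r * monomial c')) (i, j) =
      (\<Sum>m\<in>Poly_Mapping.keys r. Poly_Mapping.lookup (scalar (Poly_Mapping.lookup r m) * (frob (monomial (m + c')) :: nat \<times> nat \<Rightarrow>\<^sub>0 'k)) (i, j))"
    by (simp add: lookup_sum)
  also have "\<dots> = (\<Sum>m\<in>Poly_Mapping.keys r. if m = m0 then Poly_Mapping.lookup r m else 0)"
  proof (rule sum.cong[OF refl])
    fix m assume m: "m \<in> Poly_Mapping.keys r"
    have "m + c' \<in> S" using rS[OF m] c'S by simp
    from lookup_frob[OF this, where ?'k = 'k, of i j]
    show "Poly_Mapping.lookup (scalar (Poly_Mapping.lookup r m) * (frob (monomial (m + c')) :: nat \<times> nat \<Rightarrow>\<^sub>0 'k)) (i, j) =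
      (if m = m0 then Poly_Mapping.lookup r m else 0)"
      using lookup_single_mult[of 0 "Poly_Mapping.lookup r m" "frob (monomial (m + c'))" "(i, j)"]
      unfolding key by simp
  qed
  also have "\<dots> = Poly_Mapping.lookup r m0" using m0 by simp
  finally have "Poly_Mapping.lookup r m0 = Poly_Mapping.lookup (act r frob (monomial c') :: nat \<times> nat \<Rightarrow>\<^sub>0 'k) (i, j)"
    using c'S by (simp add: act_def)
  then show False using zero m0 by (simp add: in_keys_iff)
qed

lemma act_frob_semilinear:
  assumes r: "r \<in> carrier (semigroup_ring S)"
  shows "act r frob \<in> linmaps" "da (act r frob) = (\<lambda>_. 0)" "db (act r frob) = (\<lambda>_. 0)"
  by (rule linmaps_act[OF r frob(1)])
    (simp_all only: discrepancy_act[OF a_S r] discrepancy_act[OF b_S r] frob(2,3) act_zero)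

text \<open>
  Expanding in the dual basis, \<open>r\<close> is the sum of \<open>\<Phi>(X\<^sup>c) \<cdot> X\<^bsup>c'\<^esup>\<close> over \<open>c \<in> C\<close>, where \<open>c'\<close> is the dual of \<open>c\<close> and the
  variables of \<open>\<Phi>(X\<^sup>c)\<close> are replaced by the monomials of \<open>a\<close> and \<open>b\<close>.
\<close>

lemma semilinear_eq_act_frob:
  fixes \<Phi> :: "('s \<Rightarrow>\<^sub>0 'k::field) \<Rightarrow> (nat \<times> nat \<Rightarrow>\<^sub>0 'k)"
  assumes \<Phi>: "\<Phi> \<in> linmaps" "da \<Phi> = (\<lambda>_. 0)" "db \<Phi> = (\<lambda>_. 0)"
  shows "\<exists>r\<in>carrier (semigroup_ring S). \<Phi> = act r frob"
proof -
  obtain \<sigma> where \<sigma>: "\<And>c. c \<in> C \<Longrightarrow> \<sigma> c \<in> C \<and> c + \<sigma> c = c0" using dual by metis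
  define t where "t c p = Poly_Mapping.single (shifted a b (\<sigma> c) (fst p) (snd p)) (Poly_Mapping.lookup (\<Phi> (monomial c)) p)" for c p
  define r where "r = (\<Sum>c\<in>C. \<Sum>p\<in>Poly_Mapping.keys (\<Phi> (monomial c)). t c p)"
  have tc: "t c p \<in> carrier (semigroup_ring S)" if "c \<in> C" for c p
    using C_mem \<sigma>[OF that] unfolding t_def by simp
  have rc: "r \<in> carrier (semigroup_ring S)"
    unfolding r_def by (intro carrier_sum tc)
  have agree: "act r frob (monomial d) = \<Phi> (monomial d)" if d: "d \<in> C" for d
  proof -
    have dS: "d \<in> S" by (rule C_S[OF d])
    have tdc: "t c p * monomial d \<in> carrier (semigroup_ring S)" if "c \<in> C" for c p
      using tc[OF that] dS by simp
    have ft: "frob (t c p * monomial d) = (if d = c then Poly_Mapping.single p (Poly_Mapping.lookup (\<Phi> (monomial c)) p) else 0)"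
      if c: "c \<in> C" for c p
    proof -
      have "t c p * monomial d = scalar (Poly_Mapping.lookup (\<Phi> (monomial c)) p) * monomial (shifted a b (\<sigma> c + d) (fst p) (snd p))"
        unfolding t_def add.commute[of "\<sigma> c"] shifted_add by (simp add: mult_single add.commute)
      moreover have "shifted a b (\<sigma> c + d) (fst p) (snd p) \<in> S"
        unfolding add.commute[of "\<sigma> c"] shifted_add using dS C_mem \<sigma>[OF c] by simp
      ultimately have "frob (t c p * monomial d) = scalar (Poly_Mapping.lookup (\<Phi> (monomial c)) p) *
          (frob (monomial (shifted a b (\<sigma> c + d) (fst p) (snd p))) :: nat \<times> nat \<Rightarrow>\<^sub>0 'k)"
        by (simp add: linmapsD(2)[OF frob(1)])
      moreover have "frob (monomial (shifted a b (\<sigma> c + d) (fst p) (snd p))) =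
          (if d = c then monomial p else 0 :: nat \<times> nat \<Rightarrow>\<^sub>0 'k)"
        by (subst frob_dual[OF c _ _ d]) (use \<sigma>[OF c] in auto)
      ultimately show ?thesis by (simp add: mult_single)
    qed
    have "act r frob (monomial d) = frob (\<Sum>c\<in>C. \<Sum>p\<in>Poly_Mapping.keys (\<Phi> (monomial c)). t c p * monomial d)"
      using dS unfolding act_def r_def by (simp add: sum_distrib_right)
    also have "\<dots> = (\<Sum>c\<in>C. frob (\<Sum>p\<in>Poly_Mapping.keys (\<Phi> (monomial c)). t c p * monomial d))"
      by (rule linmaps_sum[OF frob(1)]) (intro carrier_sum tdc)
    also have "\<dots> = (\<Sum>c\<in>C. \<Sum>p\<in>Poly_Mapping.keys (\<Phi> (monomial c)). frob (t c p * monomial d))"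
      by (rule sum.cong[OF refl], rule linmaps_sum[OF frob(1)], rule tdc)
    also have "\<dots> = (\<Sum>c\<in>C. if d = c then \<Phi> (monomial d) else 0)"
      by (rule sum.cong[OF refl]) (auto simp: ft poly_mapping_sum_single)
    also have "\<dots> = \<Phi> (monomial d)" using finite_C d by simp
    finally show ?thesis .
  qed
  have "\<Phi> = act r frob"
    by (rule semilinear_eqI[OF \<Phi> act_frob_semilinear[OF rc]]) (simp only: agree)
  then show ?thesis using rc by blast
qed

end

section \<open>A finite injective resolution\<close>

context submonoid_add
begin

text \<open>
  All terms of the resolution are pairs of linear maps; taking them in one type allows a single
  sequence of modules, with zero in unused components.
\<close>

definition pair_module ::
    "(('s \<Rightarrow>\<^sub>0 'k::field) \<Rightarrow> ('t::comm_monoid_add \<Rightarrow>\<^sub>0 'k)) set \<Rightarrow> (('s \<Rightarrow>\<^sub>0 'k) \<Rightarrow> ('t \<Rightarrow>\<^sub>0 'k)) set \<Rightarrow>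
      ('s \<Rightarrow>\<^sub>0 'k, (('s \<Rightarrow>\<^sub>0 'k) \<Rightarrow> ('t \<Rightarrow>\<^sub>0 'k)) \<times> (('s \<Rightarrow>\<^sub>0 'k) \<Rightarrow> ('t \<Rightarrow>\<^sub>0 'k))) module" where
  "pair_module V W =
     \<lparr>carrier = V \<times> W, mult = (\<lambda>X Y. X), one = (\<lambda>_. 0, \<lambda>_. 0), zero = (\<lambda>_. 0, \<lambda>_. 0),
      add = (\<lambda>X Y. (\<lambda>x. fst X x + fst Y x, \<lambda>x. snd X x + snd Y x)),
      smult = (\<lambda>r X. (act r (fst X), act r (snd X)))\<rparr>"

definition full_or_zero :: "(('s \<Rightarrow>\<^sub>0 'k::field) \<Rightarrow> ('t::comm_monoid_add \<Rightarrow>\<^sub>0 'k)) set \<Rightarrow> bool" where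
  "full_or_zero V \<longleftrightarrow> V = linmaps \<or> V = {\<lambda>_. 0}"

lemma full_or_zeroD:
  assumes "full_or_zero V"
  shows "\<And>F. F \<in> V \<Longrightarrow> F \<in> linmaps" "(\<lambda>_. 0) \<in> V"
    and "\<And>F G. F \<in> V \<Longrightarrow> G \<in> V \<Longrightarrow> (\<lambda>x. F x + G x) \<in> V"
    and "\<And>F. F \<in> V \<Longrightarrow> (\<lambda>x. - F x) \<in> V"
    and "\<And>F r. r \<in> carrier (semigroup_ring S) \<Longrightarrow> F \<in> V \<Longrightarrow> act r F \<in> V"
  using assms linmaps_add linmaps_uminus linmaps_act by (auto simp: full_or_zero_def)

lemma act_simps:
  assumes "F \<in> linmaps"
  shows "r \<in> carrier (semigroup_ring S) \<Longrightarrow> s \<in> carrier (semigroup_ring S) \<Longrightarrow>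
      act (r + s) F = (\<lambda>x. act r F x + act s F x)"
    and "act r (\<lambda>x. F x + G x) = (\<lambda>x. act r F x + act r G x)"
    and "r \<in> carrier (semigroup_ring S) \<Longrightarrow> act (r * s) F = act r (act s F)"
    and "act 1 F = F"
  using linmapsD(1,3)[OF assms] by (auto simp: act_def fun_eq_iff distrib_right mult.left_commute mult.commute[of r s] mult.assoc)

lemma pair_module_module:
  assumes V: "full_or_zero V" and W: "full_or_zero W"
  shows "Module.module (semigroup_ring S) (pair_module V W)"
proof (rule moduleI)
  note VD = full_or_zeroD[OF V] and WD = full_or_zeroD[OF W]
  show "cring (semigroup_ring S)" by (rule semigroup_ring_cring)
  show "abelian_group (pair_module V W)"
  proof (rule abelian_groupI)
    fix X assume "X \<in> carrier (pair_module V W)"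
    then show "\<exists>Y\<in>carrier (pair_module V W). Y \<oplus>\<^bsub>pair_module V W\<^esub> X = \<zero>\<^bsub>pair_module V W\<^esub>"
      using VD(4) WD(4) by (intro bexI[of _ "(\<lambda>x. - fst X x, \<lambda>x. - snd X x)"]) (auto simp: pair_module_def)
  qed (use VD(2,3) WD(2,3) in \<open>auto simp: pair_module_def add_ac\<close>)
qed (use full_or_zeroD(1,5)[OF V] full_or_zeroD(1,5)[OF W] in \<open>auto simp: pair_module_def act_simps\<close>)

lemma full_or_zero_baer:
  assumes V: "full_or_zero V" and J: "ideal J (semigroup_ring S)"
    and f_mem: "\<And>x. x \<in> J \<Longrightarrow> f x \<in> V"
    and f_add: "\<And>x y. x \<in> J \<Longrightarrow> y \<in> J \<Longrightarrow> f (x + y) = (\<lambda>z. f x z + f y z)"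
    and f_act: "\<And>r x. r \<in> carrier (semigroup_ring S) \<Longrightarrow> x \<in> J \<Longrightarrow> f (r * x) = act r (f x)"
  shows "\<exists>e\<in>V. \<forall>x\<in>J. f x = act x e"
proof (cases "V = linmaps")
  case True
  then show ?thesis using linmaps_baer[OF J _ f_add f_act] f_mem by blast
next
  case False
  then have "V = {\<lambda>_. 0}" using V unfolding full_or_zero_def by blast
  then show ?thesis using f_mem by auto
qed

lemma pair_module_baer:
  assumes V: "full_or_zero V" and W: "full_or_zero W"
  shows "baer (semigroup_ring S) (pair_module V W)"
  unfolding baer_def
proof (intro allI impI, elim conjE)
  fix J f assume J: "ideal J (semigroup_ring S)"
    and "f \<in> module_hom (semigroup_ring S) ((self_module (semigroup_ring S))\<lparr>carrier := J\<rparr>) (pair_module V W)"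
  note f = module_homD[OF this(2), unfolded self_module_def pair_module_def, simplified]
  have "\<exists>e\<in>V. \<forall>x\<in>J. fst (f x) = act x e"
    by (rule full_or_zero_baer[OF V J]) (use f in \<open>auto simp: mem_Times_iff\<close>)
  then obtain e where e: "e \<in> V" "\<forall>x\<in>J. fst (f x) = act x e" by blast
  have "\<exists>e\<in>W. \<forall>x\<in>J. snd (f x) = act x e"
    by (rule full_or_zero_baer[OF W J]) (use f in \<open>auto simp: mem_Times_iff\<close>)
  then obtain e' where e': "e' \<in> W" "\<forall>x\<in>J. snd (f x) = act x e'" by blast
  show "\<exists>e\<in>carrier (pair_module V W). \<forall>c\<in>J. f c = c \<odot>\<^bsub>pair_module V W\<^esub> e"
    using e e' by (intro bexI[of _ "(e, e')"]) (auto simp: pair_module_def prod_eq_iff)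
qed

end

theorem symmetric_semigroup_gorenstein:
  fixes S :: "(nat \<times> nat) set"
  assumes "symmetric_semigroup S C a b c0"
  shows "gorenstein_ring (semigroup_ring S :: (nat \<times> nat \<Rightarrow>\<^sub>0 'k::field) ring)"
proof -
  interpret symmetric_semigroup S C a b c0 by fact
  let ?R = "semigroup_ring S :: (nat \<times> nat \<Rightarrow>\<^sub>0 'k) ring"
  define V :: "nat \<Rightarrow> ((nat \<times> nat \<Rightarrow>\<^sub>0 'k) \<Rightarrow> (nat \<times> nat \<Rightarrow>\<^sub>0 'k)) set" where
    "V i = (if i \<le> 2 then linmaps else {\<lambda>_. 0})" for i
  define W :: "nat \<Rightarrow> ((nat \<times> nat \<Rightarrow>\<^sub>0 'k) \<Rightarrow> (nat \<times> nat \<Rightarrow>\<^sub>0 'k)) set" where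
    "W i = (if i = 1 then linmaps else {\<lambda>_. 0})" for i
  have VW: "full_or_zero (V i)" "full_or_zero (W i)" for i
    by (simp_all add: V_def W_def full_or_zero_def)
  define E where "E i = pair_module (V i) (W i)" for i
  define d where "d i X = (if i = 0 then (da (fst X), db (fst X))
      else if i = 1 then (\<lambda>x. db (fst X) x - da (snd X) x, \<lambda>_. 0) else (\<lambda>_. 0, \<lambda>_. 0))" 
    for i :: nat and X :: "((nat \<times> nat \<Rightarrow>\<^sub>0 'k) \<Rightarrow> (nat \<times> nat \<Rightarrow>\<^sub>0 'k)) \<times> ((nat \<times> nat \<Rightarrow>\<^sub>0 'k) \<Rightarrow> (nat \<times> nat \<Rightarrow>\<^sub>0 'k))"
  define \<epsilon> :: "_ \<Rightarrow> ((nat \<times> nat \<Rightarrow>\<^sub>0 'k) \<Rightarrow> (nat \<times> nat \<Rightarrow>\<^sub>0 'k)) \<times> ((nat \<times> nat \<Rightarrow>\<^sub>0 'k) \<Rightarrow> (nat \<times> nat \<Rightarrow>\<^sub>0 'k))"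
    where "\<epsilon> r = (act r frob, \<lambda>_. 0)"
    for r :: "nat \<times> nat \<Rightarrow>\<^sub>0 'k"
  have Ec: "carrier (E i) = V i \<times> W i" and E0: "\<zero>\<^bsub>E i\<^esub> = (\<lambda>_. 0, \<lambda>_. 0)" for i
    by (simp_all add: E_def pair_module_def)
  have d_mem: "d i X \<in> carrier (E (Suc i))" if "X \<in> carrier (E i)" for i X
    using that unfolding Ec
    by (auto simp: d_def V_def W_def linmaps_discrepancy[OF a_S] linmaps_discrepancy[OF b_S] linmaps_diff split: if_splits)
  have disc_zero: "discrepancy u v (\<lambda>_. 0) = (\<lambda>_. 0)" for u :: "nat \<times> nat" and v :: "nat \<times> nat"
    by (auto simp: discrepancy_def fun_eq_iff)
  define pt where "pt n = (prod_decode n :: nat \<times> nat)" for n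
  \<comment> \<open>Linear maps are determined by their values on the countably many monomials, so a pair of them is encoded as the graph of a function on natural numbers.\<close>
  define enc where "enc X = {(n, {(fst X (monomial (pt n)), snd X (monomial (pt n)))}) | n. pt n \<in> S}"
    for X :: "((nat \<times> nat \<Rightarrow>\<^sub>0 'k) \<Rightarrow> (nat \<times> nat \<Rightarrow>\<^sub>0 'k)) \<times> ((nat \<times> nat \<Rightarrow>\<^sub>0 'k) \<Rightarrow> (nat \<times> nat \<Rightarrow>\<^sub>0 'k))"
  have enc: "inj_on enc (carrier (E i))" for i
  proof (rule inj_onI)
    fix X Y assume h: "X \<in> carrier (E i)" "Y \<in> carrier (E i)" "enc X = enc Y"
    have eq: "fst X (monomial m) = fst Y (monomial m) \<and> snd X (monomial m) = snd Y (monomial m)" if m: "m \<in> S" for m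
    proof -
      have pm: "pt (prod_encode m) = m" by (simp add: pt_def)
      then have "(prod_encode m, {(fst X (monomial m), snd X (monomial m))}) \<in> enc X" using m unfolding enc_def by auto
      then show ?thesis using pm unfolding h(3) unfolding enc_def by auto
    qed
    have "fst X \<in> linmaps" "fst Y \<in> linmaps" "snd X \<in> linmaps" "snd Y \<in> linmaps"
      using h full_or_zeroD(1)[OF VW(1)] full_or_zeroD(1)[OF VW(2)] unfolding Ec by auto
    then show "X = Y" using eq by (auto simp: prod_eq_iff intro!: linmaps_eqI)
  qed
  have E_mod: "Module.module ?R (E i)" for i unfolding E_def by (rule pair_module_module[OF VW])
  have E_baer: "baer ?R (E i)" for i unfolding E_def by (rule pair_module_baer[OF VW])
  have \<epsilon>_hom: "\<epsilon> \<in> module_hom ?R (self_module ?R) (E 0)"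
    unfolding module_hom_def
    by (auto simp: self_module_def E_def pair_module_def V_def W_def \<epsilon>_def
        act_frob_semilinear(1) act_simps(1,3)[OF frob(1)])
  have d_hom: "d i \<in> module_hom ?R (E i) (E (Suc i))" for i
    unfolding module_hom_def
  proof (intro CollectI conjI ballI)
    show "d i \<in> carrier (E i) \<rightarrow> carrier (E (Suc i))" using d_mem by blast
    show "d i (X \<oplus>\<^bsub>E i\<^esub> Y) = d i X \<oplus>\<^bsub>E (Suc i)\<^esub> d i Y" for X Y
      by (auto simp: d_def E_def pair_module_def discrepancy_add)
    show "d i (r \<odot>\<^bsub>E i\<^esub> X) = r \<odot>\<^bsub>E (Suc i)\<^esub> d i X" if "r \<in> carrier ?R" for r X
      by (auto simp: d_def E_def pair_module_def discrepancy_act[OF a_S that] discrepancy_act[OF b_S that])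
        (auto simp: act_def)
  qed
  have \<epsilon>_inj: "inj_on \<epsilon> (carrier ?R)"
  proof (rule inj_onI)
    fix r s assume h: "r \<in> carrier ?R" "s \<in> carrier ?R" "\<epsilon> r = \<epsilon> s"
    then have eq: "act r frob x = act s frob x" for x unfolding \<epsilon>_def by simp
    have "act (r - s) frob = (\<lambda>_. 0 :: nat \<times> nat \<Rightarrow>\<^sub>0 'k)"
    proof
      fix x
      show "act (r - s) frob x = (0 :: nat \<times> nat \<Rightarrow>\<^sub>0 'k)"
        using eq[of x] linmapsD(1)[OF frob(1), of "(r - s) * x" "s * x"] h
        by (auto simp: act_def algebra_simps)
    qed
    then have "r - s = 0" by (rule frob_nondegenerate[rotated]) (use h in simp)
    then show "r = s" by simp
  qed
  have ex0: "\<epsilon> ` carrier ?R = module_ker (E 0) (E 1) (d 0)"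
  proof (intro equalityI subsetI)
    fix X assume "X \<in> \<epsilon> ` carrier ?R"
    then show "X \<in> module_ker (E 0) (E 1) (d 0)"
      unfolding module_ker_def Ec E0 by (auto simp: \<epsilon>_def d_def V_def W_def act_frob_semilinear simp del: One_nat_def)
  next
    fix X assume X: "X \<in> module_ker (E 0) (E 1) (d 0)"
    then have "fst X \<in> linmaps" "da (fst X) = (\<lambda>_. 0)" "db (fst X) = (\<lambda>_. 0)" "snd X = (\<lambda>_. 0)"
      unfolding module_ker_def Ec E0 by (auto simp: d_def V_def W_def)
    then show "X \<in> \<epsilon> ` carrier ?R"
      using semilinear_eq_act_frob[of "fst X"] by (force simp: \<epsilon>_def prod_eq_iff)
  qed
  have ex: "d i ` carrier (E i) = module_ker (E (Suc i)) (E (Suc (Suc i))) (d (Suc i))" for i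
  proof (intro equalityI subsetI)
    fix Y assume "Y \<in> d i ` carrier (E i)"
    then obtain X where X: "X \<in> carrier (E i)" "Y = d i X" by blast
    have "d (Suc i) (d i X) = (\<lambda>_. 0, \<lambda>_. 0)"
      by (auto simp: d_def discrepancy_commute[OF b_S a_S] disc_zero)
    then show "Y \<in> module_ker (E (Suc i)) (E (Suc (Suc i))) (d (Suc i))"
      using X d_mem unfolding module_ker_def E0 by blast
  next
    fix Y assume "Y \<in> module_ker (E (Suc i)) (E (Suc (Suc i))) (d (Suc i))"
    then have Y: "Y \<in> V (Suc i) \<times> W (Suc i)" "d (Suc i) Y = (\<lambda>_. 0, \<lambda>_. 0)"
      unfolding module_ker_def E0 Ec by auto
    consider "i = 0" | "i = 1" | "i \<ge> 2" by linarith
    then show "Y \<in> d i ` carrier (E i)"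
    proof cases
      case 1
      have mem: "fst Y \<in> linmaps" "snd Y \<in> linmaps" using Y(1) 1 by (auto simp: V_def W_def)
      have "db (fst Y) x = da (snd Y) x" for x
        using Y(2) 1 by (auto simp: d_def fun_eq_iff)
      then obtain F where F: "F \<in> linmaps" "da F = fst Y" "db F = snd Y" using koszul_exact[OF mem] by blast
      show ?thesis
        by (rule image_eqI[of _ _ "(F, \<lambda>_. 0)"]) (use F 1 in \<open>auto simp: d_def Ec V_def W_def prod_eq_iff\<close>)
    next
      case 2
      have mem: "fst Y \<in> linmaps" "snd Y = (\<lambda>_. 0)" using Y(1) 2 by (auto simp: V_def W_def)
      obtain F where F: "F \<in> linmaps" "db F = fst Y" using db_surj[OF mem(1)] by blast
      show ?thesis
        by (rule image_eqI[of _ _ "(F, \<lambda>_. 0)"]) (use F 2 mem in \<open>auto simp: d_def Ec V_def W_def prod_eq_iff disc_zero\<close>)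
    next
      case 3
      then have "Y = (\<lambda>_. 0, \<lambda>_. 0)" using Y(1) by (auto simp: V_def W_def)
      then show ?thesis
        using 3 full_or_zeroD(2)[OF VW(1)] full_or_zeroD(2)[OF VW(2)]
        by (intro image_eqI[of _ _ "(\<lambda>_. 0, \<lambda>_. 0)"]) (auto simp: d_def Ec)
    qed
  qed
  have zero: "carrier (E i) = {\<zero>\<^bsub>E i\<^esub>}" if "i > 2" for i
    using that unfolding Ec E0 by (auto simp: V_def W_def)
  have "finite_injective_dimension (localization ?R P) (self_module (localization ?R P))" if "primeideal P ?R" for P
  proof -
    interpret localized_domain ?R P
      by (intro localized_domain.intro localized_domain_axioms.intro that semigroup_ring_domain submonoid_add_axioms)
    show ?thesis
      by (rule finite_injective_dimension_localization[OF noetherian E_mod E_baer enc \<epsilon>_hom d_hom \<epsilon>_inj ex0 ex zero])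
  qed
  then show ?thesis unfolding gorenstein_ring_def using semigroup_ring_cring noetherian by blast
qed

section \<open>The semigroup of the triangle\<close>

text \<open>
  The triangle is cut out by \<open>y \<ge> 0\<close>, \<open>x - y \<ge> 4\<close> and \<open>x + y \<le> 4 + 2 k\<close>, and the \<open>i\<close>-th dilate by the
  multiples of these inequalities.
\<close>

lemma mem_polygonal_triangle_iff:
  assumes k: "k \<ge> 1"
  shows "(x, y) \<in> polygonal_semigroup
      (convex hull {(4, 0), (4 + 2 * real k, 0), (4 + real k, real k)}) \<longleftrightarrow>
    (\<exists>i. y + 4 * i \<le> x \<and> x + y \<le> (4 + 2 * k) * i)" (is "?L \<longleftrightarrow> ?R")
proof
  assume ?L
  then obtain i X where i: "X \<in> convex hull {(4, 0), (4 + 2 * real k, 0), (4 + real k, real k)}"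
    "(real x, real y) = real i *\<^sub>R X" unfolding polygonal_semigroup_def by auto
  then obtain u v w where uvw: "0 \<le> u" "0 \<le> v" "0 \<le> w" "u + v + w = 1"
    "X = u *\<^sub>R (4, 0) + v *\<^sub>R (4 + 2 * real k, 0) + w *\<^sub>R (4 + real k, real k)"
    unfolding convex_hull_3 by blast
  have u: "u = 1 - v - w" using uvw(4) by simp
  have x: "real x = real i * (4 + 2 * real k * v + real k * w)" and y: "real y = real i * (real k * w)"
    using i(2) uvw(5) unfolding u by (simp_all add: algebra_simps)
  have "real y + 4 * real i \<le> real x"
  proof -
    have "0 \<le> real i * (2 * real k * v)" using uvw by simp
    then show ?thesis unfolding x y by (simp add: algebra_simps)
  qed
  moreover have "real x + real y \<le> (4 + 2 * real k) * real i"
  proof -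
    have "0 \<le> real i * (2 * real k * u)" using uvw by simp
    then show ?thesis unfolding x y u by (simp add: algebra_simps)
  qed
  ultimately have "real (y + 4 * i) \<le> real x" "real (x + y) \<le> real ((4 + 2 * k) * i)" by simp_all
  then show ?R unfolding of_nat_le_iff by blast
next
  assume ?R
  then obtain i where i: "y + 4 * i \<le> x" "x + y \<le> (4 + 2 * k) * i" by blast
  show ?L
  proof (cases "i = 0")
    case True
    have "(4, 0) \<in> convex hull {(4, 0), (4 + 2 * real k, 0), (4 + real k, real k)}"
      by (rule hull_inc) simp
    moreover have "x = 0" "y = 0" using i True by auto
    ultimately show ?thesis unfolding polygonal_semigroup_def
      by (auto intro!: exI[of _ "0::nat"] image_eqI[of _ _ "(4, 0)"] simp: zero_prod_def)
  next
    case False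
    have ri: "real y + 4 * real i \<le> real x" "real x + real y \<le> (4 + 2 * real k) * real i"
      using i(1)[folded of_nat_le_iff[where 'a = real]] i(2)[folded of_nat_le_iff[where 'a = real]] by simp_all
    have ik: "real i > 0" "real k > 0" using False k by auto
    \<comment> \<open>The barycentric coordinates of the point divided by \<open>i\<close>.\<close>
    define w where "w = real y / (real k * real i)"
    define v where "v = (real x - real y - 4 * real i) / (2 * real k * real i)"
    define u where "u = ((4 + 2 * real k) * real i - real x - real y) / (2 * real k * real i)"
    have nonneg: "0 \<le> u" "0 \<le> v" "0 \<le> w" unfolding u_def v_def w_def using ri ik by simp_all
    have sum: "u + v + w = 1" unfolding u_def v_def w_def using ik by (simp add: field_simps)
    have e1: "real i * (2 * real k * v) = real x - real y - 4 * real i" unfolding v_def using ik by simp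
    have e2: "real i * (real k * w) = real y" unfolding w_def using ik by simp
    let ?X = "u *\<^sub>R (4, 0) + v *\<^sub>R (4 + 2 * real k, 0) + w *\<^sub>R (4 + real k, real k)"
    have X: "?X \<in> convex hull {(4, 0), (4 + 2 * real k, 0), (4 + real k, real k)}"
      unfolding convex_hull_3 using nonneg sum by blast
    have u': "u = 1 - v - w" using sum by simp
    have "(real x, real y) = real i *\<^sub>R ?X"
      using e1 e2 unfolding u' by (simp add: algebra_simps)
    then have "(real x, real y) \<in> (\<lambda>X. real i *\<^sub>R X) ` (convex hull {(4, 0), (4 + 2 * real k, 0), (4 + real k, real k)})"
      using X by blast
    then show ?thesis unfolding polygonal_semigroup_def by blast
  qed
qed

locale triangle =
  fixes k :: nat
  assumes k: "k \<ge> 2"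
begin

definition triangle_points :: "(nat \<times> nat) set" where
  "triangle_points = {(x, y). \<exists>i. y + 4 * i \<le> x \<and> x + y \<le> (4 + 2 * k) * i}"

text \<open>
  The points of the semigroup from which neither \<open>(4, 0)\<close> nor \<open>(4 + k, k)\<close> can be subtracted within it,
  listed by height: each height below \<open>k\<close> contributes one point for each residue of the abscissa modulo \<open>4\<close>.
  At height \<open>k - 1\<close> the dilates \<open>i = 1\<close> and \<open>i = 2\<close> leave the gap \<open>k + 6\<close>, so the representative of that
  residue is \<open>k + 10\<close>.
\<close>

definition apery :: "(nat \<times> nat) set" where
  "apery = {(x, y). y < k \<and> (if y = 0 then x = 0 \<or> x = 5 \<or> x = 6 \<or> x = 7
     else if Suc y < k then y + 4 \<le> x \<and> x \<le> y + 7
     else x = k + 3 \<or> x = k + 4 \<or> x = k + 5 \<or> x = k + 10)}"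

lemma triangle_points_iff: "(x, y) \<in> triangle_points \<longleftrightarrow> (\<exists>i. y + 4 * i \<le> x \<and> x + y \<le> (4 + 2 * k) * i)"
  by (simp add: triangle_points_def)

lemma submonoid_triangle_points: "submonoid_add triangle_points"
proof
  show "0 \<in> triangle_points" unfolding zero_prod_def triangle_points_iff by (intro exI[of _ 0]) simp
  fix p q assume "p \<in> triangle_points" "q \<in> triangle_points"
  then obtain x y x' y' i i' where "p = (x, y)" "q = (x', y')" "y + 4 * i \<le> x" "x + y \<le> (4 + 2 * k) * i"
    "y' + 4 * i' \<le> x'" "x' + y' \<le> (4 + 2 * k) * i'" unfolding triangle_points_def by blast
  then show "p + q \<in> triangle_points" by (auto simp: triangle_points_iff distrib_left intro!: exI[of _ "i + i'"])
qed

lemma triangle_points_reduce: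
  assumes "(x, y) \<in> triangle_points" "k \<le> y"
  shows "4 + k \<le> x \<and> (x - (4 + k), y - k) \<in> triangle_points"
proof -
  obtain i where i: "y + 4 * i \<le> x" "x + y \<le> (4 + 2 * k) * i" using assms(1) triangle_points_iff by blast
  obtain j where j: "i = Suc j" using i assms(2) k by (cases i) auto
  define z where "z = (4 + 2 * k) * j"
  have z: "x + y \<le> 4 + 2 * k + z" using i(2) unfolding j z_def by simp
  have i1: "y + 4 + 4 * j \<le> x" using i(1) unfolding j by simp
  then have "4 + k \<le> x" using assms(2) by linarith
  then obtain x' where x': "x = 4 + k + x'" using le_Suc_ex by blast
  obtain y' where y': "y = k + y'" using assms(2) le_Suc_ex by blast
  have "y' + 4 * j \<le> x'" "x' + y' \<le> z" using i1 z unfolding x' y' by linarith+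
  then show ?thesis unfolding triangle_points_iff z_def x' y' by auto
qed

text \<open>
  The least candidate for the dilate is \<open>i = (x - y) div 4\<close>, the largest one allowed by the left edge. It also
  satisfies the inequality of the right edge, except at the gap.
\<close>

lemma triangle_points_row:
  assumes y: "y < k"
  shows "(x, y) \<in> triangle_points \<longleftrightarrow> (if y = 0 then x = 0 \<or> 4 \<le> x else y + 4 \<le> x \<and> \<not> (Suc y = k \<and> x = k + 6))"
proof
  assume "(x, y) \<in> triangle_points"
  then obtain i where i: "y + 4 * i \<le> x" "x + y \<le> (4 + 2 * k) * i" using triangle_points_iff by blast
  show "if y = 0 then x = 0 \<or> 4 \<le> x else y + 4 \<le> x \<and> \<not> (Suc y = k \<and> x = k + 6)"
  proof (cases "i \<le> 1")
    case True
    then have "i = 0 \<or> i = 1" by linarith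
    then show ?thesis using i by auto
  next
    case False
    then have "y + 8 \<le> x" using i by linarith
    then show ?thesis by auto
  qed
next
  assume h: "if y = 0 then x = 0 \<or> 4 \<le> x else y + 4 \<le> x \<and> \<not> (Suc y = k \<and> x = k + 6)"
  show "(x, y) \<in> triangle_points"
  proof (cases "x = 0 \<and> y = 0")
    case True
    then show ?thesis unfolding triangle_points_iff by (intro exI[of _ 0]) simp
  next
    case False
    then have yx: "y + 4 \<le> x" using h by (auto split: if_splits)
    define i where "i = (x - y) div 4"
    define r where "r = (x - y) mod 4"
    have x: "x = y + 4 * i + r" unfolding i_def r_def using yx by simp
    have r: "r \<le> 3" unfolding r_def by simp
    have i1: "i \<ge> 1" using x r yx by linarith
    have "2 * y + r \<le> 2 * k * i"
    proof (cases "i = 1")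
      case True
      have "Suc y = k \<Longrightarrow> r \<noteq> 3" using h x True k by (auto split: if_splits)
      then show ?thesis using True y r by (cases "Suc y = k") auto
    next
      case False
      then have "2 * k * 2 \<le> 2 * k * i" using i1 by (intro mult_le_mono2) linarith
      then show ?thesis using y r by linarith
    qed
    then have "y + 4 * i \<le> x \<and> x + y \<le> (4 + 2 * k) * i" unfolding x by (simp add: add_mult_distrib)
    then show ?thesis unfolding triangle_points_iff by blast
  qed
qed

lemma shifted_pair:
  "shifted (4, 0) (4 + k, k) (p, q) i j = (p + 4 * i + (4 + k) * j, q + k * j :: nat)"
proof (induction i)
  case 0
  show ?case by (induction j) (simp_all add: shifted_Suc2)
next
  case (Suc i)
  then show ?case by (simp add: shifted_Suc1)
qed

lemma apery_subset: "apery \<subseteq> triangle_points"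
  using triangle_points_row k unfolding apery_def by (auto split: if_splits)

lemma apery_shifted: "c \<in> apery \<Longrightarrow> shifted (4, 0) (4 + k, k) c i j \<in> triangle_points"
proof -
  interpret submonoid_add triangle_points by (rule submonoid_triangle_points)
  have ab: "(4, 0) \<in> triangle_points" "(4 + k, k) \<in> triangle_points" unfolding triangle_points_iff by (auto intro!: exI[of _ 1])
  assume c: "c \<in> apery"
  show ?thesis
  proof (induction i)
    case 0
    show ?case using c apery_subset ab add_mem by (induction j) (auto simp only: shifted_0 shifted_Suc2)
  next
    case (Suc i)
    then show ?case using ab add_mem by (auto simp only: shifted_Suc1)
  qed
qed

lemma row_decomposition:
  assumes y: "y < k" and xy: "(x, y) \<in> triangle_points"
  shows "\<exists>p i. (p, y) \<in> apery \<and> x = p + 4 * i"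
proof -
  show ?thesis
  proof (cases "y = 0")
    case True
    then have x: "x = 0 \<or> 4 \<le> x" using triangle_points_row[OF y] xy by simp
    define r where "r = x mod 4"
    have r: "r \<le> 3" "x = 4 * (x div 4) + r" unfolding r_def by simp_all
    show ?thesis
    proof (cases "r = 0")
      case r0: True
      have "(0, y) \<in> apery" using True k by (auto simp: apery_def)
      then show ?thesis using r(2) r0 by fastforce
    next
      case r0: False
      then have "4 \<le> x" using x r_def by auto
      then have "x = (4 + r) + 4 * (x div 4 - 1)" using r by linarith
      moreover have "(4 + r, y) \<in> apery" using True k r0 r(1) by (auto simp: apery_def)
      ultimately show ?thesis by blast
    qed
  next
    case False
    then have x: "y + 4 \<le> x" "\<not> (Suc y = k \<and> x = k + 6)" using triangle_points_row[OF y] xy by simp_all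
    define r where "r = (x - (y + 4)) mod 4"
    have r: "r \<le> 3" "x = y + 4 + r + 4 * ((x - (y + 4)) div 4)" unfolding r_def using x by auto
    show ?thesis
    proof (cases "Suc y = k \<and> r = 3")
      case True
      define d where "d = (x - (y + 4)) div 4"
      have x2: "x = k + 6 + 4 * d" using r(2) True unfolding d_def by linarith
      then have "x = k + 10 + 4 * (d - 1)" using x(2) True by (cases d) auto
      moreover have "(k + 10, y) \<in> apery" using True False by (auto simp: apery_def)
      ultimately show ?thesis by blast
    next
      case 2: False
      have "(y + 4 + r, y) \<in> apery" using 2 False y r(1) unfolding apery_def by auto
      then show ?thesis using r(2) by blast
    qed
  qed
qed

lemma decomposition: "(x, y) \<in> triangle_points \<Longrightarrow> \<exists>c\<in>apery. \<exists>i j. (x, y) = shifted (4, 0) (4 + k, k) c i j"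
proof (induction y arbitrary: x rule: less_induct)
  case (less y)
  show ?case
  proof (cases "y < k")
    case True
    obtain p i where "(p, y) \<in> apery" "x = p + 4 * i" using row_decomposition[OF True less.prems] by blast
    then show ?thesis by (intro bexI[of _ "(p, y)"] exI[of _ i] exI[of _ 0]) (auto simp: shifted_pair)
  next
    case False
    then have k': "k \<le> y" by simp
    note red = triangle_points_reduce[OF less.prems k']
    have "y - k < y" using k k' by linarith
    from less.IH[OF this conjunct2[OF red]] obtain c i j
      where c: "c \<in> apery" "(x - (4 + k), y - k) = shifted (4, 0) (4 + k, k) c i j" by blast
    have "(x, y) = (4 + k, k) + (x - (4 + k), y - k)" using red k' by simp
    then have "(x, y) = shifted (4, 0) (4 + k, k) c i (Suc j)" unfolding shifted_Suc2 c(2) .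
    then show ?thesis using c(1) by blast
  qed
qed

lemma apery_row_inj:
  assumes "(p, y) \<in> apery" "(p', y) \<in> apery" "p + 4 * i = p' + 4 * i'"
  shows "p = p' \<and> i = i'"
proof -
  \<comment> \<open>In each row the points of the list have different residues modulo \<open>4\<close>.\<close>
  have residue: "a = b" if "a + 4 * i = b + 4 * i'" "a \<in> A" "b \<in> A"
    and A: "\<forall>a\<in>A. \<forall>b\<in>A. a mod 4 = b mod 4 \<longrightarrow> a = b" for a b :: nat and A
  proof -
    have "a mod 4 = (a + 4 * i) mod 4" by simp
    also have "\<dots> = b mod 4" unfolding that(1) by simp
    finally show ?thesis using A that(2,3) by blast
  qed
  consider "y = 0" | "y \<noteq> 0" "Suc y < k" | "y \<noteq> 0" "Suc y = k"
    using assms(1) unfolding apery_def by fastforce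
  then have "p = p'"
  proof cases
    case 1
    then have "p \<in> {0, 5, 6, 7}" "p' \<in> {0, 5, 6, 7}" using assms by (auto simp: apery_def)
    then show ?thesis by (rule residue[OF assms(3)]) simp
  next
    case 2
    then have "y + 4 \<le> p" "p \<le> y + 7" "y + 4 \<le> p'" "p' \<le> y + 7" using assms by (auto simp: apery_def)
    then show ?thesis using assms(3) by (cases "i < i'"; cases "i' < i") linarith+
  next
    case 3
    then obtain a b where ab: "p = k + a" "a \<in> {3, 4, 5, 10}" "p' = k + b" "b \<in> {3, 4, 5, 10}"
      using assms(1,2) unfolding apery_def by auto
    have "a + 4 * i = b + 4 * i'" using assms(3) unfolding ab(1,3) by linarith
    then have "a = b" using ab(2,4) by (rule residue) simp
    then show ?thesis unfolding ab(1,3) by simp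
  qed
  then show ?thesis using assms(3) by simp
qed

lemma symmetric_triangle_points: "symmetric_semigroup triangle_points apery (4, 0) (4 + k, k) (k + 10, k - 1)"
proof -
  interpret submonoid_add triangle_points by (rule submonoid_triangle_points)
  show ?thesis
  proof
    have "apery \<subseteq> {..k + 10} \<times> {..k}" unfolding apery_def by (auto split: if_splits)
    then show "finite apery" by (rule finite_subset) simp
    show "shifted (4, 0) (4 + k, k) c i j \<in> triangle_points" if "c \<in> apery" for c i j by (rule apery_shifted[OF that])
    show "\<exists>c\<in>apery. \<exists>i j. m = shifted (4, 0) (4 + k, k) c i j" if "m \<in> triangle_points" for m
      using decomposition[of "fst m" "snd m"] that by simp
    show "c = c' \<and> i = i' \<and> j = j'"
      if h: "c \<in> apery" "c' \<in> apery" "shifted (4, 0) (4 + k, k) c i j = shifted (4, 0) (4 + k, k) c' i' j'"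
      for c i j c' i' j'
    proof -
      obtain p q p' q' where c: "c = (p, q)" "c' = (p', q')" by force
      have q: "q < k" "q' < k" using h unfolding c apery_def by auto
      have eq: "p + 4 * i + (4 + k) * j = p' + 4 * i' + (4 + k) * j'" "q + k * j = q' + k * j'"
        using h(3) unfolding c shifted_pair by auto
      have "(q + k * j) div k = j" "(q' + k * j') div k = j'" using q by auto
      then have j: "j = j'" using eq(2) by simp
      then have qq: "q = q'" using eq(2) by simp
      have "p + 4 * i = p' + 4 * i'" using eq(1) j by simp
      then show ?thesis using apery_row_inj[of p q p' i i'] h qq j unfolding c by simp
    qed
    show "(k + 10, k - 1) \<in> apery" using k by (auto simp: apery_def)
    show "\<exists>c'\<in>apery. c + c' = (k + 10, k - 1)" if c: "c \<in> apery" for c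
    proof -
      obtain x y where xy: "c = (x, y)" by force
      have "x \<le> k + 10" "y \<le> k - 1" "(k + 10 - x, k - 1 - y) \<in> apery"
        using c k unfolding xy apery_def by (auto split: if_splits)
      then show ?thesis unfolding xy by (intro bexI[of _ "(k + 10 - x, k - 1 - y)"]) auto
    qed
  qed
qed

end

theorem mainTheorem13:
  fixes k :: nat
  assumes "k \<ge> 2"
  shows "gorenstein_semigroup TYPE('k::field)
           (polygonal_semigroup
              (convex hull {(4, 0), (4 + 2 * real k, 0), (4 + real k, real k)}))"
proof -
  interpret triangle k by unfold_locales (rule assms)
  have "polygonal_semigroup (convex hull {(4, 0), (4 + 2 * real k, 0), (4 + real k, real k)}) = triangle_points"
    using mem_polygonal_triangle_iff[of k] assms by (auto simp: triangle_points_iff)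
  then show ?thesis
    unfolding gorenstein_semigroup_def by (simp add: symmetric_semigroup_gorenstein[OF symmetric_triangle_points])
qed

end
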